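(* Let $d\ge1$, $\mu\in\mathcal{P}_8(\mathbb{R}^d)$ and $\Phi\in\mathcal{M}^L_4(\mathcal{P}_2(\mathbb{R}^d))$. Then there exist constants $C_1,C_2,\epsilon_0>0$ such that for every $\epsilon\in(0,\epsilon_0)$ there exist $L$ and a sequence $(M_\ell)_{\ell=0}^L$ for which the antithetic multilevel Monte Carlo estimator $\mathcal{A}^{\text{A-MLMC}}$ built from i.i.d. samples of $\mu$ satisfies $$\mathbb{E}\big[(\Phi(\mu)-\mathcal{A}^{\text{A-MLMC}})^2\big]\le C_1\epsilon^2$$ and the computational cost of $\mathcal{A}^{\text{A-MLMC}}$ is at most $C_2\epsilon^{-2}$.
   Context: $\mathcal{P}_k(\mathbb{R}^d)$ is the set of Borel probability measures on $\mathbb{R}^d$ with finite $k$-th moment; $\mathcal{P}_2(\mathbb{R}^d)$ carries the 2-Wasserstein metric $W_2$. Estimator. Let $N_\ell:=2^\ell$, and let $(M_\ell)_{\ell=0}^L$ be a non-increasing sequence of positive integers. Let $\{X_{i,\ell,\theta}\}$, $0\le\ell\le L$, $1\le\theta\le M_\ell$, $1\le i\le N_\ell$, be i.i.d. random variables with law $\mu$ (all independent over $i,\ell,\theta$). Set $\mu^{N_\ell,\theta,\ell}:=\frac1{N_\ell}\sum_{i=1}^{N_\ell}\delta_{X_{i,\ell,\theta}}$ and, for $\ell\ge1$, $\mu^{N_\ell,(1),\theta,\ell}:=\frac1{N_\ell/2}\sum_{i=1}^{N_\ell/2}\delta_{X_{i,\ell,\theta}}$, $\mu^{N_\ell,(2),\theta,\ell}:=\frac1{N_\ell/2}\sum_{i=N_\ell/2+1}^{N_\ell}\delta_{X_{i,\ell,\theta}}$.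 Then $$\mathcal{A}^{\text{A-MLMC}}:=\frac1{M_0}\sum_{\theta=1}^{M_0}\Phi(\mu^{N_0,\theta,0})+\sum_{\ell=1}^L\frac1{M_\ell}\sum_{\theta=1}^{M_\ell}\Big[\Phi(\mu^{N_\ell,\theta,\ell})-\tfrac12\big(\Phi(\mu^{N_\ell,(1),\theta,\ell})+\Phi(\mu^{N_\ell,(2),\theta,\ell})\big)\Big].$$ The computational cost is the number of random samples that need to be generated to compute the estimator, i.e. $\sum_{\ell=0}^L M_\ell N_\ell$. Linear functional derivatives. A continuous function $\frac{\delta U}{\delta m}:\mathcal{P}_2(\mathbb{R}^d)\times\mathbb{R}^d\to\mathbb{R}$ is the linear functional derivative of $U:\mathcal{P}_2(\mathbb{R}^d)\to\mathbb{R}$ if (i) for any bounded $\mathcal{K}\subset\mathcal{P}_2(\mathbb{R}^d)$, $y\mapsto\frac{\delta U}{\delta m}(m,y)$ has at most quadratic growth in $y$ uniformly in $m\in\mathcal{K}$, and (ii) for all $m,m'\in\mathcal{P}_2(\mathbb{R}^d)$, $U(m')-U(m)=\int_0^1\int_{\mathbb{R}^d}\frac{\delta U}{\delta m}((1-s)m+sm',y)\,(m'-m)(dy)\,ds$. For $p\ge 2$, provided the $(p-1)$-th order derivative is well defined, the $p$-th order linear functional derivative is a continuous function $\frac{\delta^pU}{\delta m^p}:\mathcal{P}_2(\mathbb{R}^d)\times(\mathbb{R}^d)^{p-1}\times\mathbb{R}^d\to\mathbb{R}$ such that $(y,y')\mapsto\frac{\delta^pU}{\delta m^p}(m,y,y')$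 has at most quadratic growth uniformly in $m$ in bounded subsets of $\mathcal{P}_2(\mathbb{R}^d)$, and for all $m,m'$ and $y\in(\mathbb{R}^d)^{p-1}$, $\frac{\delta^{p-1}U}{\delta m^{p-1}}(m',y)-\frac{\delta^{p-1}U}{\delta m^{p-1}}(m,y)=\int_0^1\int_{\mathbb{R}^d}\frac{\delta^pU}{\delta m^p}((1-s)m+sm',y,y')\,(m'-m)(dy')\,ds$. The derivatives are normalised by $\frac{\delta^pU}{\delta m^p}(m,y_1,\ldots,y_p)=0$ whenever $y_i=0$ for some $i$. Class $\mathcal{M}^L_k(\mathcal{P}_2(\mathbb{R}^d))$: the functions $U:\mathcal{P}_2(\mathbb{R}^d)\to\mathbb{R}$ that are $k$ times differentiable in the sense of linear functional derivatives and satisfy $\big|\frac{\delta^kU}{\delta m^k}(m,y_1,\ldots,y_k)\big|\le C(|y_1|^k+\cdots+|y_k|^k)$ for some constant $C>0$ not depending on $m,y_1,\ldots,y_k$. *)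

theory Defs
  imports "HOL-Probability.Probability"
begin

definition finite_moment_measures :: "nat \<Rightarrow> 'a::euclidean_space measure set" where
  "finite_moment_measures k =
     {m. prob_space m \<and> sets m = sets borel \<and> integrable m (\<lambda>x. norm x ^ k)}"

abbreviation P2 :: "'a::euclidean_space measure set" where
  "P2 \<equiv> finite_moment_measures 2"

definition couplings ::
  "'a::euclidean_space measure \<Rightarrow> 'a measure \<Rightarrow> ('a \<times> 'a) measure set" where
  "couplings m m' =
     {p. prob_space p \<and> sets p = sets borel \<and> distr p borel fst = m \<and> distr p borel snd = m'}"

text \<open>For \<open>m, m' \<in> P2\<close> every coupling has an integrable cost and the product measure is a
  coupling, so neither the integral nor the infimum below takes a default value.\<close>

definition W2 :: "'a::euclidean_space measure \<Rightarrow> 'a measure \<Rightarrow> real" where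
  "W2 m m' = sqrt (INF p \<in> couplings m m'. \<integral>z. (dist (fst z) (snd z))\<^sup>2 \<partial>p)"

definition W2_bounded :: "'a::euclidean_space measure set \<Rightarrow> bool" where
  "W2_bounded K \<longleftrightarrow> K \<subseteq> P2 \<and> (\<exists>m0\<in>P2. \<exists>R. \<forall>m\<in>K. W2 m0 m \<le> R)"

text \<open>Points of \<open>(\<real>\<^sup>d)\<^sup>p\<close> are lists of length \<open>p\<close>. Functions of a measure and a list are only
  ever evaluated on \<open>P2\<close> and on lists of the appropriate length. The following is joint
  continuity for the product of \<open>W2\<close> with the Euclidean distance.\<close>

definition continuous_P2 ::
  "nat \<Rightarrow> ('a::euclidean_space measure \<Rightarrow> 'a list \<Rightarrow> real) \<Rightarrow> bool" where
  "continuous_P2 p G \<longleftrightarrow>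
     (\<forall>m\<in>P2. \<forall>ys. length ys = p \<longrightarrow>
       (\<forall>e>0. \<exists>\<delta>>0. \<forall>m'\<in>P2. \<forall>ys'. length ys' = p \<longrightarrow>
          W2 m m' < \<delta> \<longrightarrow> (\<forall>i<p. dist (ys ! i) (ys' ! i) < \<delta>) \<longrightarrow> \<bar>G m' ys' - G m ys\<bar> < e))"

definition quadratic_growth_P2 ::
  "nat \<Rightarrow> ('a::euclidean_space measure \<Rightarrow> 'a list \<Rightarrow> real) \<Rightarrow> bool" where
  "quadratic_growth_P2 p G \<longleftrightarrow>
     (\<forall>K. W2_bounded K \<longrightarrow>
       (\<exists>C. \<forall>m\<in>K. \<forall>ys. length ys = p \<longrightarrow> \<bar>G m ys\<bar> \<le> C * (1 + (\<Sum>y\<leftarrow>ys. (norm y)\<^sup>2))))"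

text \<open>The measure \<open>(1 - s) m + s m'\<close>, for \<open>0 \<le> s \<le> 1\<close>.\<close>

definition mixture ::
  "real \<Rightarrow> 'a::euclidean_space measure \<Rightarrow> 'a measure \<Rightarrow> 'a measure" where
  "mixture s m m' =
     measure_of UNIV (sets borel) (\<lambda>A. ennreal (1 - s) * emeasure m A + ennreal s * emeasure m' A)"

lemma sets_mixture [simp]: "sets (mixture s m m') = sets borel"
  by (simp add: mixture_def sets.sigma_sets_eq[of borel, simplified])

lemma emeasure_mixture:
  assumes m: "sets m = sets borel" and m': "sets m' = sets borel" and A: "A \<in> sets borel"
  shows "emeasure (mixture s m m') A = ennreal (1 - s) * emeasure m A + ennreal s * emeasure m' A"
proof (rule emeasure_measure_of[OF mixture_def])
  show "countably_additive (sets (mixture s m m'))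
          (\<lambda>A. ennreal (1 - s) * emeasure m A + ennreal s * emeasure m' A)"
    using m m'
    by (auto simp: countably_additive_def suminf_add[symmetric] suminf_emeasure)
qed (use A in \<open>auto simp: positive_def\<close>)

text \<open>\<open>G\<close>, a function of a measure and \<open>p + 1\<close> points, is the normalised linear functional
  derivative of \<open>F\<close>, a function of a measure and \<open>p\<close> points; the new variable is appended last.
  The integral against the signed measure \<open>m' - m\<close> is the difference of two integrals. Continuity
  and quadratic growth make all the integrands integrable.\<close>

definition linear_functional_derivative ::
  "nat \<Rightarrow> ('a::euclidean_space measure \<Rightarrow> 'a list \<Rightarrow> real)
     \<Rightarrow> ('a measure \<Rightarrow> 'a list \<Rightarrow> real) \<Rightarrow> bool" where
  "linear_functional_derivative p F G \<longleftrightarrow>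
     continuous_P2 (Suc p) G \<and>
     quadratic_growth_P2 (Suc p) G \<and>
     (\<forall>m\<in>P2. \<forall>m'\<in>P2. \<forall>ys. length ys = p \<longrightarrow>
        F m' ys - F m ys =
          (LINT s:{0..1}|lborel. (\<integral>y. G (mixture s m m') (ys @ [y]) \<partial>m')
                               - (\<integral>y. G (mixture s m m') (ys @ [y]) \<partial>m))) \<and>
     (\<forall>m\<in>P2. \<forall>ys. length ys = Suc p \<longrightarrow> 0 \<in> set ys \<longrightarrow> G m ys = 0)"

text \<open>\<open>D p\<close> is the derivative of order \<open>p\<close>. It is determined on \<open>P2\<close> by \<open>U\<close>, because of the
  normalisation.\<close>

definition class_ML :: "nat \<Rightarrow> ('a::euclidean_space measure \<Rightarrow> real) set" where
  "class_ML k =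
     {U. \<exists>D. (\<forall>m\<in>P2. D 0 m [] = U m) \<and>
             (\<forall>p<k. linear_functional_derivative p (D p) (D (Suc p))) \<and>
             (\<exists>C>0. \<forall>m\<in>P2. \<forall>ys. length ys = k \<longrightarrow> \<bar>D k m ys\<bar> \<le> C * (\<Sum>y\<leftarrow>ys. norm y ^ k))}"

definition empirical_measure :: "nat set \<Rightarrow> (nat \<Rightarrow> 'a::euclidean_space) \<Rightarrow> 'a measure" where
  "empirical_measure I x =
     measure_of UNIV (sets borel)
       (\<lambda>A. (\<Sum>i\<in>I. emeasure (return borel (x i)) A) / of_nat (card I))"

lemma sets_empirical_measure [simp]: "sets (empirical_measure I x) = sets borel"
  by (simp add: empirical_measure_def sets.sigma_sets_eq[of borel, simplified])

lemma emeasure_empirical_measure: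
  assumes A: "A \<in> sets borel"
  shows "emeasure (empirical_measure I x) A =
           (\<Sum>i\<in>I. emeasure (return borel (x i)) A) / of_nat (card I)"
proof (rule emeasure_measure_of[OF empirical_measure_def])
  show "countably_additive (sets (empirical_measure I x))
          (\<lambda>A. (\<Sum>i\<in>I. emeasure (return borel (x i)) A) / of_nat (card I))"
    unfolding countably_additive_def
  proof safe
    fix B :: "nat \<Rightarrow> 'a set"
    assume B: "range B \<subseteq> sets (empirical_measure I x)" "disjoint_family B"
    have "(\<Sum>n. \<Sum>i\<in>I. emeasure (return borel (x i)) (B n))
            = (\<Sum>i\<in>I. \<Sum>n. emeasure (return borel (x i)) (B n))"
      by (rule suminf_sum) auto
    also have "\<dots> = (\<Sum>i\<in>I. emeasure (return borel (x i)) (\<Union>n. B n))"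
      using B by (intro sum.cong refl suminf_emeasure) auto
    finally show "(\<Sum>n. (\<Sum>i\<in>I. emeasure (return borel (x i)) (B n)) / of_nat (card I))
            = (\<Sum>i\<in>I. emeasure (return borel (x i)) (\<Union>n. B n)) / of_nat (card I)"
      by (simp add: divide_ennreal_def ennreal_suminf_multc)
  qed
qed (use A in \<open>auto simp: positive_def\<close>)

text \<open>The sample \<open>X\<^sub>i\<^sub>,\<^sub>l\<^sub>,\<^sub>\<theta>\<close> is written \<open>x i l \<theta>\<close>.\<close>

definition amlmc_estimator ::
  "('a::euclidean_space measure \<Rightarrow> real) \<Rightarrow> nat \<Rightarrow> (nat \<Rightarrow> nat) \<Rightarrow> (nat \<Rightarrow> nat \<Rightarrow> nat \<Rightarrow> 'a) \<Rightarrow> real" where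
  "amlmc_estimator \<Phi> L M x =
     1 / real (M 0) * (\<Sum>\<theta>=1..M 0. \<Phi> (empirical_measure {1..2 ^ 0} (\<lambda>i. x i 0 \<theta>)))
     + (\<Sum>l=1..L. 1 / real (M l) *
         (\<Sum>\<theta>=1..M l.
            \<Phi> (empirical_measure {1..2 ^ l} (\<lambda>i. x i l \<theta>))
            - 1 / 2 * (\<Phi> (empirical_measure {1..2 ^ l div 2} (\<lambda>i. x i l \<theta>))
                       + \<Phi> (empirical_measure {2 ^ l div 2 + 1..2 ^ l} (\<lambda>i. x i l \<theta>)))))"

definition amlmc_indices :: "nat \<Rightarrow> (nat \<Rightarrow> nat) \<Rightarrow> (nat \<times> nat \<times> nat) set" where
  "amlmc_indices L M = {(i, l, \<theta>). l \<le> L \<and> 1 \<le> \<theta> \<and> \<theta> \<le> M l \<and> 1 \<le> i \<and> i \<le> 2 ^ l}"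

definition amlmc_cost :: "nat \<Rightarrow> (nat \<Rightarrow> nat) \<Rightarrow> nat" where
  "amlmc_cost L M = (\<Sum>l=0..L. M l * 2 ^ l)"

definition iid_samples ::
  "'w measure \<Rightarrow> 'a::euclidean_space measure \<Rightarrow> (nat \<times> nat \<times> nat) set
     \<Rightarrow> (nat \<Rightarrow> nat \<Rightarrow> nat \<Rightarrow> 'w \<Rightarrow> 'a) \<Rightarrow> bool" where
  "iid_samples P \<mu> I X \<longleftrightarrow>
     prob_space.indep_vars P (\<lambda>_. borel) (\<lambda>(i, l, \<theta>). X i l \<theta>) I \<and>
     (\<forall>(i, l, \<theta>)\<in>I. distr P borel (X i l \<theta>) = \<mu>)"

end

theory Submission imports Defs begin

text \<open>
Write \<open>\<Phi>\<close> for the functional, \<open>D\<^sub>p\<close> for its derivative of order \<open>p\<close> and \<open>\<mu>\<^sup>n\<close> for the empirical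
measure of \<open>n\<close> independent points \<open>X\<^sub>1, \<dots>, X\<^sub>n\<close> with law \<open>\<mu>\<close>. Everything rests on one estimate: the
error of linearising \<open>\<Phi>\<close> at \<open>\<mu>\<close>,
\<open>R\<^sub>n = \<Phi>(\<mu>\<^sup>n) - \<Phi>(\<mu>) - 1/n \<Sum>\<^sub>i (D\<^sub>1(\<mu>, X\<^sub>i) - \<integral> D\<^sub>1(\<mu>, \<cdot>) d\<mu>)\<close>,
satisfies \<open>E R\<^sub>n\<^sup>2 \<le> B / n\<^sup>2\<close> (\<open>class_ML_linearisation\<close>). The linear term is centred, so the bias of
\<open>\<Phi>(\<mu>\<^sup>n)\<close> is \<open>O(1/n)\<close>. The linear terms of a sample and of its two halves cancel in the antithetic
difference, whose second moment at level \<open>l\<close> is therefore \<open>O(4\<^sup>-\<^sup>l)\<close> (\<open>antithetic_term_moments\<close>). The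
expectations telescope over the levels, the terms are independent, and \<open>M\<^sub>l\<close> proportional to
\<open>\<epsilon>\<^sup>-\<^sup>2 3\<^sup>-\<^sup>l\<close> keeps both the variance \<open>\<Sum>\<^sub>l 4\<^sup>-\<^sup>l / M\<^sub>l\<close> and the cost \<open>\<Sum>\<^sub>l 2\<^sup>l M\<^sub>l\<close> geometric, as the ratio
\<open>3\<close> lies strictly between \<open>2\<close> and \<open>4\<close>.

A second-order Taylor expansion of \<open>\<Phi>(\<mu>\<^sup>n)\<close> around \<open>\<mu>\<close> does not give the estimate directly, since
\<open>\<mu>\<^sup>n - \<mu>\<close> is not small in total variation. Instead the law is replaced by the sample one point at a time,
along the measures \<open>m\<^sub>k = 1/n (\<Sum>\<^sub>i\<^sub>\<le>\<^sub>k \<delta>(X\<^sub>i) + (n - k) \<mu>)\<close>. A step moves the measure by \<open>(\<delta>(X\<^sub>k) - \<mu>)/n\<close>,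
and \<open>m\<^sub>k\<^sub>-\<^sub>1\<close> is independent of \<open>X\<^sub>k\<close>. So the first-order term of a step is a martingale difference, and the
second-order term is \<open>O(n\<^sup>-\<^sup>2)\<close> and may be summed without cancellation
(\<open>partial_empirical_second_order\<close>, \<open>approximate_martingale_bound\<close>). This is used twice. With
\<open>m \<mapsto> D\<^sub>1(m, y)\<close> it gives \<open>E (D\<^sub>1(m\<^sub>k, y) - D\<^sub>1(\<mu>, y))\<^sup>2 = O(1/n)\<close> (\<open>sample_functional_L2_rate\<close>). With
\<open>\<Phi>\<close> minus its linear part the martingale differences are the centred values of
\<open>(D\<^sub>1(m\<^sub>k, X) - D\<^sub>1(\<mu>, X))/n\<close>, of second moment \<open>O(n\<^sup>-\<^sup>3)\<close>, and \<open>n\<close> of them add up to \<open>O(n\<^sup>-\<^sup>2)\<close>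
(\<open>sample_linearisation_L2_rate\<close>).

The derivatives of orders one, two and three enter. The global bound on \<open>D\<^sub>4\<close> serves to control their
growth: integrated downwards it gives \<open>\<bar>D\<^sub>p(m, y\<^sub>1, \<dots>, y\<^sub>p)\<bar> \<le> C (1 + \<Sum>\<^sub>i \<bar>y\<^sub>i\<bar>\<^sup>4 + \<integral> \<bar>y\<bar>\<^sup>4 dm)\<close>
(\<open>derivatives_quartic_bound\<close>), and the squares of such quantities are integrable because \<open>\<mu>\<close> has a finite
eighth moment.
\<close>

section \<open>Integrals against finite combinations of measures\<close>

text \<open>Mixtures and empirical measures are given by their values on sets. The passage to integrals is the
usual one, from indicators through simple functions to monotone limits.\<close>

lemma nn_integral_finite_combination:
  fixes m :: "'b measure" and \<nu> :: "'i \<Rightarrow> 'b measure"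
  assumes sm: "sets m = sets N" and sn: "\<And>i. i \<in> I \<Longrightarrow> sets (\<nu> i) = sets N"
    and em: "\<And>A. A \<in> sets N \<Longrightarrow> emeasure m A = (\<Sum>i\<in>I. w i * emeasure (\<nu> i) A)"
    and f: "f \<in> borel_measurable N"
  shows "(\<integral>\<^sup>+y. f y \<partial>m) = (\<Sum>i\<in>I. w i * (\<integral>\<^sup>+y. f y \<partial>\<nu> i))"
  using f
proof (induction rule: borel_measurable_induct)
  have spm: "space m = space N" using sm by (rule sets_eq_imp_space_eq)
  have spn: "space (\<nu> i) = space N" if "i \<in> I" for i using sn[OF that] by (rule sets_eq_imp_space_eq)
  have mm: "\<And>f::'b\<Rightarrow>ennreal. f \<in> borel_measurable N \<Longrightarrow> f \<in> borel_measurable m"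
    using measurable_cong_sets[OF sm refl] by auto
  have mn: "\<And>i f. i\<in>I \<Longrightarrow> (f::'b\<Rightarrow>ennreal) \<in> borel_measurable N \<Longrightarrow> f \<in> borel_measurable (\<nu> i)"
    using measurable_cong_sets[OF sn refl] by auto
  {
    case (cong f g)
    have "(\<integral>\<^sup>+y. f y \<partial>m) = (\<integral>\<^sup>+y. g y \<partial>m)"
      by (rule nn_integral_cong) (simp add: spm cong.hyps(3))
    moreover have "(\<integral>\<^sup>+y. f y \<partial>\<nu> i) = (\<integral>\<^sup>+y. g y \<partial>\<nu> i)" if "i \<in> I" for i
      by (rule nn_integral_cong) (simp add: spn[OF that] cong.hyps(3))
    ultimately show ?case using cong.IH by (simp cong: sum.cong)
  next
    case (set A)
    have "(\<integral>\<^sup>+y. indicator A y \<partial>m) = emeasure m A"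
      using set sm by (intro nn_integral_indicator) auto
    moreover have "(\<integral>\<^sup>+y. indicator A y \<partial>\<nu> i) = emeasure (\<nu> i) A" if "i \<in> I" for i
      using set sn[OF that] by (intro nn_integral_indicator) auto
    ultimately show ?case using em[OF set] by (simp cong: sum.cong)
  next
    case (mult u v)
    have "(\<integral>\<^sup>+y. v * u y \<partial>m) = v * (\<integral>\<^sup>+y. u y \<partial>m)"
      by (rule nn_integral_cmult[OF mm[OF mult.hyps(2)]])
    moreover have "(\<integral>\<^sup>+y. v * u y \<partial>\<nu> i) = v * (\<integral>\<^sup>+y. u y \<partial>\<nu> i)" if "i \<in> I" for i
      by (rule nn_integral_cmult[OF mn[OF that mult.hyps(2)]])
    ultimately show ?case using mult.IH
      by (simp add: sum_distrib_left mult.left_commute cong: sum.cong)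
  next
    case (add u v)
    have "(\<integral>\<^sup>+y. v y + u y \<partial>m) = (\<integral>\<^sup>+y. v y \<partial>m) + (\<integral>\<^sup>+y. u y \<partial>m)"
      by (rule nn_integral_add[OF mm[OF add.hyps(3)] mm[OF add.hyps(1)]])
    moreover have "(\<integral>\<^sup>+y. v y + u y \<partial>\<nu> i) = (\<integral>\<^sup>+y. v y \<partial>\<nu> i) + (\<integral>\<^sup>+y. u y \<partial>\<nu> i)"
      if "i \<in> I" for i
      by (rule nn_integral_add[OF mn[OF that add.hyps(3)] mn[OF that add.hyps(1)]])
    ultimately show ?case using add.IH
      by (simp add: sum.distrib distrib_left cong: sum.cong)
  next
    case (seq U)
    have "(\<lambda>n. \<integral>\<^sup>+y. U n y \<partial>m) \<longlonglongrightarrow> (\<integral>\<^sup>+y. Sup (range U) y \<partial>m)"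
    proof (rule nn_integral_LIMSEQ[OF seq.hyps(3) mm[OF seq.hyps(1)]])
      show "(\<lambda>n. U n y) \<longlonglongrightarrow> Sup (range U) y" for y
        unfolding SUP_apply using seq.hyps(3) by (intro LIMSEQ_SUP) (auto simp: incseq_def le_fun_def)
    qed
    moreover have "(\<lambda>n. \<Sum>i\<in>I. w i * (\<integral>\<^sup>+y. U n y \<partial>\<nu> i)) \<longlonglongrightarrow> (\<Sum>i\<in>I. w i * (\<integral>\<^sup>+y. Sup (range U) y \<partial>\<nu> i))"
    proof (intro tendsto_sum)
      fix i assume i: "i \<in> I"
      have "(\<integral>\<^sup>+y. Sup (range U) y \<partial>\<nu> i) = (SUP n. \<integral>\<^sup>+y. U n y \<partial>\<nu> i)"
        unfolding SUP_apply by (rule nn_integral_monotone_convergence_SUP[OF seq.hyps(3) mn[OF i seq.hyps(1)]])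
      then have "w i * (\<integral>\<^sup>+y. Sup (range U) y \<partial>\<nu> i) = (SUP n. w i * (\<integral>\<^sup>+y. U n y \<partial>\<nu> i))"
        by (simp add: SUP_mult_left_ennreal)
      moreover have "incseq (\<lambda>n. w i * (\<integral>\<^sup>+y. U n y \<partial>\<nu> i))"
        using seq.hyps(3) unfolding incseq_def le_fun_def
        by (intro allI impI mult_left_mono nn_integral_mono) auto
      ultimately show "(\<lambda>n. w i * (\<integral>\<^sup>+y. U n y \<partial>\<nu> i)) \<longlonglongrightarrow> w i * (\<integral>\<^sup>+y. Sup (range U) y \<partial>\<nu> i)"
        by (simp add: LIMSEQ_SUP)
    qed
    ultimately show ?case unfolding seq.IH using LIMSEQ_unique by blast
  }
qed

lemma integral_finite_combination:
  fixes m :: "'b measure" and \<nu> :: "'i \<Rightarrow> 'b measure" and f :: "'b \<Rightarrow> real"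
  assumes sm: "sets m = sets N" and sn: "\<And>i. i \<in> I \<Longrightarrow> sets (\<nu> i) = sets N"
    and em: "\<And>A. A \<in> sets N \<Longrightarrow> emeasure m A = (\<Sum>i\<in>I. ennreal (w i) * emeasure (\<nu> i) A)"
    and w: "\<And>i. i \<in> I \<Longrightarrow> 0 \<le> w i"
    and fm: "f \<in> borel_measurable N"
    and f: "\<And>i. i \<in> I \<Longrightarrow> integrable (\<nu> i) f"
  shows "integrable m f" "(\<integral>y. f y \<partial>m) = (\<Sum>i\<in>I. w i * (\<integral>y. f y \<partial>\<nu> i))"
proof -
  have fm': "f \<in> borel_measurable m" using measurable_cong_sets[OF sm refl] fm by auto
  have nn: "(\<integral>\<^sup>+y. ennreal (g y) \<partial>m) = ennreal (\<Sum>i\<in>I. w i * (\<integral>y. g y \<partial>\<nu> i))"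
    if g: "\<And>y. 0 \<le> g y" "g \<in> borel_measurable N" "\<And>i. i \<in> I \<Longrightarrow> integrable (\<nu> i) g" for g
  proof -
    have "(\<integral>\<^sup>+y. ennreal (g y) \<partial>m) = (\<Sum>i\<in>I. ennreal (w i) * (\<integral>\<^sup>+y. ennreal (g y) \<partial>\<nu> i))"
      using g by (intro nn_integral_finite_combination[OF sm sn em]) auto
    also have "\<dots> = (\<Sum>i\<in>I. ennreal (w i * (\<integral>y. g y \<partial>\<nu> i)))"
      using g w by (intro sum.cong refl) (simp add: nn_integral_eq_integral ennreal_mult')
    also have "\<dots> = ennreal (\<Sum>i\<in>I. w i * (\<integral>y. g y \<partial>\<nu> i))"
      using g w by (intro sum_ennreal) simp
    finally show ?thesis .
  qed
  show int: "integrable m f"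
    using nn[of "\<lambda>y. \<bar>f y\<bar>"] fm fm' f by (auto simp: integrable_iff_bounded)
  have p: "\<And>i. i \<in> I \<Longrightarrow> integrable (\<nu> i) (\<lambda>y. max 0 (f y))" "\<And>i. i \<in> I \<Longrightarrow> integrable (\<nu> i) (\<lambda>y. max 0 (- f y))"
    using f by auto
  have nng: "0 \<le> (\<Sum>i\<in>I. w i * (\<integral>y. max 0 (f y) \<partial>\<nu> i))" "0 \<le> (\<Sum>i\<in>I. w i * (\<integral>y. max 0 (- f y) \<partial>\<nu> i))"
    using w by (auto intro!: sum_nonneg)
  have "(\<integral>y. f y \<partial>m) = (\<Sum>i\<in>I. w i * (\<integral>y. max 0 (f y) \<partial>\<nu> i)) - (\<Sum>i\<in>I. w i * (\<integral>y. max 0 (- f y) \<partial>\<nu> i))"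
    using nn[of "\<lambda>y. max 0 (f y)"] nn[of "\<lambda>y. max 0 (- f y)"] p fm nng
    by (subst real_lebesgue_integral_def[OF int]) simp
  also have "\<dots> = (\<Sum>i\<in>I. w i * (\<integral>y. max 0 (f y) - max 0 (- f y) \<partial>\<nu> i))"
    using p by (simp add: sum_subtractf[symmetric] right_diff_distrib)
  also have "\<dots> = (\<Sum>i\<in>I. w i * (\<integral>y. f y \<partial>\<nu> i))"
    by (intro sum.cong refl arg_cong2[where f="(*)"] Bochner_Integration.integral_cong) auto
  finally show "(\<integral>y. f y \<partial>m) = (\<Sum>i\<in>I. w i * (\<integral>y. f y \<partial>\<nu> i))" .
qed

lemma integral_mixture:
  fixes f :: "'a::euclidean_space \<Rightarrow> real"
  assumes "0 \<le> s" "s \<le> 1" "sets m = sets borel" "sets m' = sets borel"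
    and "integrable m f" "integrable m' f"
  shows "integrable (mixture s m m') f"
    and "(\<integral>y. f y \<partial>mixture s m m') = (1 - s) * (\<integral>y. f y \<partial>m) + s * (\<integral>y. f y \<partial>m')"
proof -
  let ?w = "\<lambda>b. if b then s else 1 - s" and ?\<nu> = "\<lambda>b. if b then m' else m"
  have fm: "f \<in> borel_measurable borel"
    using assms(3,5) measurable_cong_sets by blast
  have em: "emeasure (mixture s m m') A = (\<Sum>b\<in>UNIV. ennreal (?w b) * emeasure (?\<nu> b) A)"
    if "A \<in> sets borel" for A
    unfolding emeasure_mixture[OF assms(3,4) that] by (simp add: UNIV_bool add.commute)
  have sn: "sets (?\<nu> b) = sets borel" and w: "0 \<le> ?w b" and fi: "integrable (?\<nu> b) f" for b
    using assms by (cases b; simp)+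
  note * = integral_finite_combination[where \<nu> = ?\<nu> and w = ?w, OF sets_mixture sn em w fm fi]
  show "integrable (mixture s m m') f"
    by (rule *(1))
  show "(\<integral>y. f y \<partial>mixture s m m') = (1 - s) * (\<integral>y. f y \<partial>m) + s * (\<integral>y. f y \<partial>m')"
    using *(2) by (simp add: UNIV_bool add.commute)
qed

lemma integral_empirical_measure:
  fixes f :: "'a::euclidean_space \<Rightarrow> real"
  assumes f: "f \<in> borel_measurable borel"
  shows "integrable (empirical_measure J x) f"
    and "(\<integral>y. f y \<partial>empirical_measure J x) = (\<Sum>i\<in>J. f (x i)) / card J"
proof -
  let ?w = "\<lambda>_::nat. 1 / real (card J)"
  have em: "emeasure (empirical_measure J x) A = (\<Sum>i\<in>J. ennreal (1 / card J) * emeasure (return borel (x i)) A)"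
    if A: "A \<in> sets borel" for A
  proof (cases "card J = 0")
    case True
    then show ?thesis by (auto simp: emeasure_empirical_measure[OF A] card_eq_0_iff)
  next
    case False
    then show ?thesis unfolding emeasure_empirical_measure[OF A] sum_distrib_left[symmetric]
      by (subst mult.commute)
        (simp add: divide_ennreal_def ennreal_of_nat_eq_real_of_nat inverse_ennreal inverse_eq_divide)
  qed
  have ir: "integrable (return borel (x i)) f" for i
    using f by (intro integrableI_bounded) (auto simp: nn_integral_return)
  have w: "0 \<le> 1 / real (card J)" by simp
  note * = integral_finite_combination[where \<nu> = "\<lambda>i. return borel (x i)" and w = ?w, OF sets_empirical_measure sets_return em w f ir]
  show "integrable (empirical_measure J x) f"
    by (rule *(1))
  show "(\<integral>y. f y \<partial>empirical_measure J x) = (\<Sum>i\<in>J. f (x i)) / card J"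
    using *(2) f by (simp add: integral_return sum_divide_distrib)
qed

section \<open>Moments, mixtures and the Wasserstein distance\<close>

abbreviation P4 :: "'a::euclidean_space measure set" where
  "P4 \<equiv> finite_moment_measures 4"

definition fourth_moment :: "'a::euclidean_space measure \<Rightarrow> real" where
  "fourth_moment m = (\<integral>y. norm y ^ 4 \<partial>m)"

lemma finite_moment_measuresD:
  assumes "m \<in> finite_moment_measures k"
  shows "prob_space m" "sets m = sets borel" "space m = UNIV" "integrable m (\<lambda>x. norm x ^ k)"
  using assms sets_eq_imp_space_eq[of m borel] by (auto simp: finite_moment_measures_def)

lemma fourth_moment_nonneg: "0 \<le> fourth_moment m"
  by (simp add: fourth_moment_def)

lemma finite_moment_measures_mono:
  assumes "m \<in> finite_moment_measures k" "j \<le> k"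
  shows "m \<in> finite_moment_measures j"
proof -
  note m = finite_moment_measuresD[OF assms(1)]
  interpret prob_space m by (rule m)
  have 1: "integrable m (\<lambda>x. 1 + norm x ^ k)" using m by simp
  have 2: "(\<lambda>x. norm x ^ j) \<in> borel_measurable m"
    unfolding measurable_cong_sets[OF m(2) refl] by simp
  have 3: "norm (norm x ^ j) \<le> norm (1 + norm x ^ k)" for x :: 'a
  proof (cases "norm x \<le> 1")
    case True
    then have "norm x ^ j \<le> 1" by (simp add: power_le_one)
    then show ?thesis by (simp add: add_increasing2)
  next
    case False
    then have "norm x ^ j \<le> norm x ^ k" using assms(2) by (intro power_increasing) auto
    then show ?thesis by simp
  qed
  have "integrable m (\<lambda>x. norm x ^ j)"
    by (rule Bochner_Integration.integrable_bound[OF 1 2]) (simp only: 3 always_eventually simp_thms)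
  then show ?thesis using m by (simp add: finite_moment_measures_def)
qed

lemma prob_space_mixture:
  assumes "0 \<le> s" "s \<le> 1" "prob_space m" "prob_space m'" "sets m = sets borel" "sets m' = sets borel"
  shows "prob_space (mixture s m m')"
proof (rule prob_spaceI)
  interpret m: prob_space m by fact
  interpret m': prob_space m' by fact
  have "space m = UNIV" "space m' = UNIV" "space (mixture s m m') = UNIV"
    using sets_eq_imp_space_eq[OF assms(5)] sets_eq_imp_space_eq[OF assms(6)]
      sets_eq_imp_space_eq[OF sets_mixture[of s m m']] by simp_all
  then show "emeasure (mixture s m m') (space (mixture s m m')) = 1"
    using m.emeasure_space_1 m'.emeasure_space_1 assms(1,2)
    by (simp add: emeasure_mixture[OF assms(5,6)] ennreal_plus[symmetric] del: ennreal_plus)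
qed

lemma mixture_finite_moment:
  assumes "0 \<le> s" "s \<le> 1" "m \<in> finite_moment_measures k" "m' \<in> finite_moment_measures k"
  shows "mixture s m m' \<in> finite_moment_measures k"
proof -
  note m = finite_moment_measuresD[OF assms(3)] and m' = finite_moment_measuresD[OF assms(4)]
  show ?thesis
    unfolding finite_moment_measures_def
    using prob_space_mixture[OF assms(1,2) m(1) m'(1) m(2) m'(2)]
      integral_mixture(1)[OF assms(1,2) m(2) m'(2) m(4) m'(4)] by simp
qed

lemma fourth_moment_mixture:
  assumes "0 \<le> s" "s \<le> 1" "m \<in> P4" "m' \<in> P4"
  shows "fourth_moment (mixture s m m') = (1 - s) * fourth_moment m + s * fourth_moment m'"
  unfolding fourth_moment_def
  by (rule integral_mixture(2)[OF assms(1,2) finite_moment_measuresD(2)[OF assms(3)]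
      finite_moment_measuresD(2)[OF assms(4)] finite_moment_measuresD(4)[OF assms(3)]
      finite_moment_measuresD(4)[OF assms(4)]])

lemma fourth_moment_mixture_le:
  assumes "0 \<le> s" "s \<le> 1" "m \<in> P4" "m' \<in> P4"
  shows "fourth_moment (mixture s m m') \<le> fourth_moment m + fourth_moment m'"
proof -
  have "(1 - s) * fourth_moment m \<le> 1 * fourth_moment m" "s * fourth_moment m' \<le> 1 * fourth_moment m'"
    using assms by (intro mult_right_mono; simp add: fourth_moment_nonneg)+
  then show ?thesis using fourth_moment_mixture[OF assms] by simp
qed

text \<open>If \<open>h\<close> is not integrable, its integral is \<open>0\<close> and the bound is trivial. Hence the increment formula
of a functional derivative can be estimated before its integrand is known to be measurable in \<open>s\<close>.\<close>

lemma abs_integral_unit_interval_le: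
  fixes h :: "real \<Rightarrow> real"
  assumes h: "\<And>s. 0 \<le> s \<Longrightarrow> s \<le> 1 \<Longrightarrow> \<bar>h s\<bar> \<le> B"
  shows "\<bar>LINT s:{0..1}|lborel. h s\<bar> \<le> B"
proof (cases "set_integrable lborel {0..1} h")
  case True
  have "\<bar>LINT s:{0..1}|lborel. h s\<bar> \<le> (LINT s:{0..1}|lborel. \<bar>h s\<bar>)"
    using set_integral_norm_bound[OF True] by simp
  also have "\<dots> \<le> (LINT s:{0..1::real}|lborel. B)"
    using True h by (intro set_integral_mono set_integrable_abs) (auto simp: set_integrable_def)
  also have "\<dots> = B" by (simp add: set_lebesgue_integral_def)
  finally show ?thesis .
next
  case False
  then have "(LINT s:{0..1}|lborel. h s) = 0"
    by (simp add: set_integrable_def set_lebesgue_integral_def not_integrable_integral_eq)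
  moreover have "0 \<le> B" using h[of 0] by simp
  ultimately show ?thesis by simp
qed

lemma diagonal_coupling:
  fixes m :: "'a::euclidean_space measure"
  assumes m: "m \<in> P2"
  shows "distr m borel (\<lambda>x. (x, x)) \<in> couplings m m"
    and "integrable (distr m borel (\<lambda>x. (x, x))) (\<lambda>z. (dist (fst z) (snd z))\<^sup>2)"
    and "(\<integral>z. (dist (fst z) (snd z))\<^sup>2 \<partial>distr m borel (\<lambda>x. (x, x))) = 0"
proof -
  note m' = finite_moment_measuresD[OF m]
  interpret prob_space m by (rule m')
  have dm: "(\<lambda>x. (x, x)) \<in> measurable m borel"
    unfolding measurable_cong_sets[OF m'(2) refl] borel_prod[symmetric] by measurable
  have cm: "(\<lambda>z. (dist (fst z) (snd z))\<^sup>2) \<in> borel_measurable (borel :: ('a \<times> 'a) measure)"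
    by (intro borel_measurable_continuous_onI continuous_intros)
  let ?p = "distr m borel (\<lambda>x. (x, x))"
  have "distr ?p borel fst = m" "distr ?p borel snd = m"
    using dm m' by (auto simp: distr_distr comp_def borel_prod[symmetric] intro!: distr_id2)
  then show "?p \<in> couplings m m"
    unfolding couplings_def using dm prob_space_distr[OF dm] by simp
  show "integrable ?p (\<lambda>z. (dist (fst z) (snd z))\<^sup>2)"
    using dm cm by (simp add: integrable_distr_eq)
  show "(\<integral>z. (dist (fst z) (snd z))\<^sup>2 \<partial>?p) = 0"
    using dm cm by (simp add: integral_distr)
qed

lemma W2_le_coupling_cost:
  assumes p: "p \<in> couplings m m'"
  shows "W2 m m' \<le> sqrt (\<integral>z. (dist (fst z) (snd z))\<^sup>2 \<partial>p)"
  unfolding W2_def real_sqrt_le_iff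
  by (rule cINF_lower[OF bdd_belowI[of _ 0] p]) auto

text \<open>This turns joint continuity of a derivative into continuity in its points at a fixed measure.\<close>

lemma W2_self:
  fixes m :: "'a::euclidean_space measure"
  assumes "m \<in> P2"
  shows "W2 m m = 0"
proof -
  have "0 \<le> (INF p \<in> couplings m m. \<integral>z. (dist (fst z) (snd z))\<^sup>2 \<partial>p)"
    using diagonal_coupling(1)[OF assms] by (intro cINF_greatest) auto
  then show ?thesis
    using W2_le_coupling_cost[OF diagonal_coupling(1)[OF assms]] diagonal_coupling(3)[OF assms]
    by (simp add: W2_def)
qed

section \<open>Growth and Taylor expansion of functional derivatives\<close>

text \<open>The growth condition that all derivatives inherit from the one of top order. The fourth moment of
\<open>m\<close> is the price of uniformity over measures that are not bounded in \<open>P2\<close>.\<close>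

definition quartic_bound ::
  "nat \<Rightarrow> real \<Rightarrow> ('a::euclidean_space measure \<Rightarrow> 'a list \<Rightarrow> real) \<Rightarrow> bool" where
  "quartic_bound p C G \<longleftrightarrow>
     (\<forall>m\<in>P4. \<forall>ys. length ys = p \<longrightarrow>
        \<bar>G m ys\<bar> \<le> C * (1 + (\<Sum>y\<leftarrow>ys. norm y ^ 4) + fourth_moment m))"

lemma quartic_boundD:
  assumes "quartic_bound p C G" "m \<in> P4" "length ys = p"
  shows "\<bar>G m ys\<bar> \<le> C * (1 + (\<Sum>y\<leftarrow>ys. norm y ^ 4) + fourth_moment m)"
  using assms by (auto simp: quartic_bound_def)

lemma sum_list_norm_nonneg [simp]: "0 \<le> (\<Sum>y\<leftarrow>ys. norm (y::'a::real_normed_vector) ^ k)"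
  by (intro sum_list_nonneg) auto

lemma set_integral_const_unit: "(LINT s:{0..1::real}|lborel. c) = (c::real)"
  by (simp add: set_lebesgue_integral_def)

lemma lfd_derivative_measurable:
  assumes lfd: "linear_functional_derivative p F G" and m: "m \<in> P2" and ys: "length ys = p"
  shows "(\<lambda>y. G m (ys @ [y])) \<in> borel_measurable borel"
proof (rule borel_measurable_continuous_onI)
  show "continuous_on UNIV (\<lambda>y. G m (ys @ [y]))"
    unfolding continuous_on_iff
  proof (intro ballI allI impI)
    fix y :: 'a and e :: real assume e: "0 < e"
    have "continuous_P2 (Suc p) G" using lfd by (simp add: linear_functional_derivative_def)
    then obtain \<delta> where \<delta>: "\<delta> > 0"
      "\<And>m' ys'. m' \<in> P2 \<Longrightarrow> length ys' = Suc p \<Longrightarrow> W2 m m' < \<delta> \<Longrightarrow>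
         (\<forall>i<Suc p. dist ((ys @ [y]) ! i) (ys' ! i) < \<delta>) \<Longrightarrow> \<bar>G m' ys' - G m (ys @ [y])\<bar> < e"
      using m ys e unfolding continuous_P2_def by (metis length_append_singleton)
    show "\<exists>d>0. \<forall>x'\<in>UNIV. dist x' y < d \<longrightarrow> dist (G m (ys @ [x'])) (G m (ys @ [y])) < e"
    proof (intro exI[of _ \<delta>] conjI ballI impI \<delta>(1))
      fix y' assume "dist y' y < \<delta>"
      then have "\<forall>i<Suc p. dist ((ys @ [y]) ! i) ((ys @ [y']) ! i) < \<delta>"
        using ys \<delta>(1) by (auto simp: nth_append less_Suc_eq dist_commute)
      then show "dist (G m (ys @ [y'])) (G m (ys @ [y])) < e"
        using \<delta>(2)[OF m, of "ys @ [y']"] ys W2_self[OF m] \<delta>(1) by (simp add: dist_real_def)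
    qed
  qed
qed

lemma P4_subset_P2: "m \<in> P4 \<Longrightarrow> m \<in> P2"
  by (rule finite_moment_measures_mono) auto

lemma integral_quartic_le:
  fixes g :: "'a::euclidean_space \<Rightarrow> real"
  assumes \<nu>: "\<nu> \<in> P4" and g: "g \<in> borel_measurable borel"
    and b: "\<And>y. \<bar>g y\<bar> \<le> a + C * norm y ^ 4"
  shows "integrable \<nu> g" "\<bar>\<integral>y. g y \<partial>\<nu>\<bar> \<le> a + C * fourth_moment \<nu>"
proof -
  note n = finite_moment_measuresD[OF \<nu>]
  interpret prob_space \<nu> by (rule n)
  have i: "integrable \<nu> (\<lambda>y. a + C * norm y ^ 4)" using n by simp
  have gm: "g \<in> borel_measurable \<nu>" unfolding measurable_cong_sets[OF n(2) refl] by (rule g)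
  have "norm (g y) \<le> norm (a + C * norm y ^ 4)" for y using b[of y] by simp
  then show gi: "integrable \<nu> g"
    by (intro Bochner_Integration.integrable_bound[OF i gm] always_eventually allI)
  have "\<bar>\<integral>y. g y \<partial>\<nu>\<bar> \<le> (\<integral>y. \<bar>g y\<bar> \<partial>\<nu>)" by (rule integral_abs_bound)
  also have "\<dots> \<le> (\<integral>y. a + C * norm y ^ 4 \<partial>\<nu>)"
    using gi i b by (intro integral_mono) auto
  also have "\<dots> = a + C * fourth_moment \<nu>"
    using n prob_space by (simp add: fourth_moment_def)
  finally show "\<bar>\<integral>y. g y \<partial>\<nu>\<bar> \<le> a + C * fourth_moment \<nu>" .
qed

lemma quartic_bound_last:
  assumes G: "quartic_bound (Suc p) C G" and m: "m \<in> P4" and ys: "length ys = p"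
  shows "\<bar>G m (ys @ [y])\<bar> \<le> C * (1 + (\<Sum>y\<leftarrow>ys. norm y ^ 4) + fourth_moment m) + C * norm y ^ 4"
  using quartic_boundD[OF G m, of "ys @ [y]"] ys by (simp add: algebra_simps)

lemma integral_derivative_le:
  assumes lfd: "linear_functional_derivative p F G" and G: "quartic_bound (Suc p) C G"
    and m: "m \<in> P4" and \<nu>: "\<nu> \<in> P4" and ys: "length ys = p"
  shows "integrable \<nu> (\<lambda>y. G m (ys @ [y]))"
    and "\<bar>\<integral>y. G m (ys @ [y]) \<partial>\<nu>\<bar>
           \<le> C * (1 + (\<Sum>y\<leftarrow>ys. norm y ^ 4) + fourth_moment m + fourth_moment \<nu>)"
proof -
  note * = integral_quartic_le[OF \<nu> lfd_derivative_measurable[OF lfd P4_subset_P2[OF m] ys]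
      quartic_bound_last[OF G m ys]]
  show "integrable \<nu> (\<lambda>y. G m (ys @ [y]))" by (rule *(1))
  show "\<bar>\<integral>y. G m (ys @ [y]) \<partial>\<nu>\<bar>
           \<le> C * (1 + (\<Sum>y\<leftarrow>ys. norm y ^ 4) + fourth_moment m + fourth_moment \<nu>)"
    using *(2) by (simp add: algebra_simps)
qed

lemma lfd_increment:
  assumes "linear_functional_derivative p F G" "m \<in> P2" "m' \<in> P2" "length ys = p"
  shows "F m' ys - F m ys = (LINT s:{0..1}|lborel. (\<integral>y. G (mixture s m m') (ys @ [y]) \<partial>m')
                               - (\<integral>y. G (mixture s m m') (ys @ [y]) \<partial>m))"
  using assms by (simp add: linear_functional_derivative_def)

text \<open>Integrate the bound on \<open>G\<close> along the segment from \<open>\<mu>\<close> to \<open>m\<close>: moments of a mixture are bounded by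
those of its end points. At the end point \<open>\<mu>\<close> itself the growth of \<open>F\<close> has to be known.\<close>

lemma quartic_bound_antiderivative:
  assumes lfd: "linear_functional_derivative p F G" and G: "quartic_bound (Suc p) C G"
    and \<mu>: "\<mu> \<in> P4" and C: "0 \<le> C" and A: "0 \<le> A"
    and F: "\<And>ys. length ys = p \<Longrightarrow> \<bar>F \<mu> ys\<bar> \<le> A * (1 + (\<Sum>y\<leftarrow>ys. norm y ^ 4))"
  shows "\<exists>C'\<ge>0. quartic_bound p C' F"
proof (intro exI conjI)
  let ?C = "A + 4 * C * (1 + fourth_moment \<mu>)"
  show "0 \<le> ?C" using A C by (simp add: fourth_moment_nonneg)
  show "quartic_bound p ?C F"
    unfolding quartic_bound_def
  proof (intro ballI allI impI)
    fix m :: "'a measure" and ys :: "'a list"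
    assume m: "m \<in> P4" and ys: "length ys = p"
    let ?S = "(\<Sum>y\<leftarrow>ys. norm y ^ 4)" and ?M = "fourth_moment m" and ?R = "fourth_moment \<mu>"
    have pos: "0 \<le> ?S" "0 \<le> ?M" "0 \<le> ?R" by (auto simp: fourth_moment_nonneg)
    have "\<bar>F m ys - F \<mu> ys\<bar> \<le> C * (2 + 2 * ?S + 3 * ?M + 3 * ?R)"
      unfolding lfd_increment[OF lfd P4_subset_P2[OF \<mu>] P4_subset_P2[OF m] ys]
    proof (rule abs_integral_unit_interval_le)
      fix s :: real assume s: "0 \<le> s" "s \<le> 1"
      let ?x = "mixture s \<mu> m"
      note mx = mixture_finite_moment[OF s \<mu> m]
      have "\<bar>(\<integral>y. G ?x (ys @ [y]) \<partial>m) - (\<integral>y. G ?x (ys @ [y]) \<partial>\<mu>)\<bar>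
          \<le> C * (1 + ?S + fourth_moment ?x + ?M) + C * (1 + ?S + fourth_moment ?x + ?R)"
        using integral_derivative_le(2)[OF lfd G mx m ys] integral_derivative_le(2)[OF lfd G mx \<mu> ys]
        by linarith
      also have "\<dots> = C * ((1 + ?S + fourth_moment ?x + ?M) + (1 + ?S + fourth_moment ?x + ?R))"
        by (simp add: distrib_left)
      also have "\<dots> \<le> C * (2 + 2 * ?S + 3 * ?M + 3 * ?R)"
        using fourth_moment_mixture_le[OF s \<mu> m] C by (intro mult_left_mono) auto
      finally show "\<bar>(\<integral>y. G ?x (ys @ [y]) \<partial>m) - (\<integral>y. G ?x (ys @ [y]) \<partial>\<mu>)\<bar> \<le> C * (2 + 2 * ?S + 3 * ?M + 3 * ?R)" .
    qed
    also have "\<dots> \<le> C * (4 * (1 + ?R) * (1 + ?S + ?M))"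
    proof (rule mult_left_mono[OF _ C])
      have "0 \<le> ?R * ?S" "0 \<le> ?R * ?M" using pos by auto
      then show "2 + 2 * ?S + 3 * ?M + 3 * ?R \<le> 4 * (1 + ?R) * (1 + ?S + ?M)"
        using pos by (simp add: algebra_simps)
    qed
    finally have "\<bar>F m ys\<bar> \<le> \<bar>F \<mu> ys\<bar> + 4 * C * (1 + ?R) * (1 + ?S + ?M)" by (simp add: mult_ac)
    also have "\<bar>F \<mu> ys\<bar> \<le> A * (1 + ?S + ?M)"
      by (rule order_trans[OF F[OF ys] mult_left_mono]) (use A pos in auto)
    finally show "\<bar>F m ys\<bar> \<le> ?C * (1 + ?S + ?M)" by (simp add: algebra_simps)
  qed
qed

text \<open>The signed measures \<open>m' - m\<close> and \<open>\<eta> (\<nu>' - \<nu>)\<close> agree on the functions of quartic growth. In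
the application \<open>\<eta> = 1/n\<close>, \<open>\<nu> = \<mu>\<close> and \<open>\<nu>'\<close> is a point mass, and the factor \<open>\<eta>\<close> is what a
difference quotient gains with each derivative.\<close>

definition moves_along :: "'a::euclidean_space measure \<Rightarrow> 'a measure \<Rightarrow> real \<Rightarrow> 'a measure \<Rightarrow> 'a measure \<Rightarrow> bool" where
  "moves_along m m' \<eta> \<nu> \<nu>' \<longleftrightarrow>
     (\<forall>f::'a \<Rightarrow> real. f \<in> borel_measurable borel \<longrightarrow> (\<exists>a c. \<forall>y. \<bar>f y\<bar> \<le> a + c * norm y ^ 4) \<longrightarrow>
        (\<integral>y. f y \<partial>m') - (\<integral>y. f y \<partial>m) = \<eta> * ((\<integral>y. f y \<partial>\<nu>') - (\<integral>y. f y \<partial>\<nu>)))"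

lemma lfd_increment_moves_along:
  assumes lfd: "linear_functional_derivative p F G" and G: "quartic_bound (Suc p) C G"
    and m: "m \<in> P4" "m' \<in> P4"
    and \<nu>: "\<nu> \<in> P4" "\<nu>' \<in> P4"
    and mv: "moves_along m m' \<eta> \<nu> \<nu>'" and ys: "length ys = p"
  shows "F m' ys - F m ys = (LINT s:{0..1}|lborel. \<eta> * ((\<integral>y. G (mixture s m m') (ys @ [y]) \<partial>\<nu>')
                               - (\<integral>y. G (mixture s m m') (ys @ [y]) \<partial>\<nu>)))"
  unfolding lfd_increment[OF lfd P4_subset_P2[OF m(1)] P4_subset_P2[OF m(2)] ys]
proof (rule set_lebesgue_integral_cong)
  show "\<forall>s. s \<in> {0..1} \<longrightarrow> (\<integral>y. G (mixture s m m') (ys @ [y]) \<partial>m') - (\<integral>y. G (mixture s m m') (ys @ [y]) \<partial>m)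
     = \<eta> * ((\<integral>y. G (mixture s m m') (ys @ [y]) \<partial>\<nu>') - (\<integral>y. G (mixture s m m') (ys @ [y]) \<partial>\<nu>))"
  proof (intro allI impI)
    fix s :: real assume "s \<in> {0..1}"
    then have s: "0 \<le> s" "s \<le> 1" by auto
    note x = mixture_finite_moment[OF s m]
    have b: "\<exists>a c. \<forall>y. \<bar>G (mixture s m m') (ys @ [y])\<bar> \<le> a + c * norm y ^ 4"
      using quartic_bound_last[OF G x ys] by blast
    show "(\<integral>y. G (mixture s m m') (ys @ [y]) \<partial>m') - (\<integral>y. G (mixture s m m') (ys @ [y]) \<partial>m)
     = \<eta> * ((\<integral>y. G (mixture s m m') (ys @ [y]) \<partial>\<nu>') - (\<integral>y. G (mixture s m m') (ys @ [y]) \<partial>\<nu>))"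
      using mv b lfd_derivative_measurable[OF lfd P4_subset_P2[OF x] ys]
      unfolding moves_along_def by blast
  qed
qed simp

lemma first_order_bound:
  assumes lfd: "linear_functional_derivative p F G" and G: "quartic_bound (Suc p) C G" and C: "0 \<le> C"
    and m: "m \<in> P4" "m' \<in> P4"
    and \<nu>: "\<nu> \<in> P4" "\<nu>' \<in> P4"
    and mv: "moves_along m m' \<eta> \<nu> \<nu>'" and ys: "length ys = p"
  shows "\<bar>F m' ys - F m ys\<bar> \<le> \<bar>\<eta>\<bar> * (2 * C * (1 + (\<Sum>y\<leftarrow>ys. norm y ^ 4)
           + (fourth_moment m + fourth_moment m' + fourth_moment \<nu> + fourth_moment \<nu>')))"
  unfolding lfd_increment_moves_along[OF lfd G m \<nu> mv ys]
proof (rule abs_integral_unit_interval_le)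
  fix s :: real assume s: "0 \<le> s" "s \<le> 1"
  let ?x = "mixture s m m'" and ?S = "(\<Sum>y\<leftarrow>ys. norm y ^ 4)"
  note x = mixture_finite_moment[OF s m]
  have "\<bar>(\<integral>y. G ?x (ys @ [y]) \<partial>\<nu>') - (\<integral>y. G ?x (ys @ [y]) \<partial>\<nu>)\<bar>
      \<le> C * (1 + ?S + fourth_moment ?x + fourth_moment \<nu>') + C * (1 + ?S + fourth_moment ?x + fourth_moment \<nu>)"
    using integral_derivative_le(2)[OF lfd G x \<nu>(2) ys] integral_derivative_le(2)[OF lfd G x \<nu>(1) ys]
    by linarith
  also have "\<dots> = C * ((1 + ?S + fourth_moment ?x + fourth_moment \<nu>') + (1 + ?S + fourth_moment ?x + fourth_moment \<nu>))"
    by (simp add: distrib_left)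
  also have "\<dots> \<le> C * (2 * (1 + ?S + (fourth_moment m + fourth_moment m' + fourth_moment \<nu> + fourth_moment \<nu>')))"
    using fourth_moment_mixture_le[OF s m] fourth_moment_nonneg[of \<nu>] fourth_moment_nonneg[of \<nu>'] C
    by (intro mult_left_mono) (simp_all add: distrib_left)
  finally show "\<bar>\<eta> * ((\<integral>y. G ?x (ys @ [y]) \<partial>\<nu>') - (\<integral>y. G ?x (ys @ [y]) \<partial>\<nu>))\<bar>
      \<le> \<bar>\<eta>\<bar> * (2 * C * (1 + ?S + (fourth_moment m + fourth_moment m' + fourth_moment \<nu> + fourth_moment \<nu>')))"
    unfolding abs_mult by (intro mult_left_mono) (auto simp: mult_ac)
qed

lemma moves_along_mixture:
  assumes s: "0 \<le> s" "s \<le> 1" and s': "0 \<le> s'" "s' \<le> 1"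
    and m: "m \<in> P4" "m' \<in> P4"
    and mv: "moves_along m m' \<eta> \<nu> \<nu>'"
  shows "moves_along (mixture s m m') (mixture s' m m') ((s' - s) * \<eta>) \<nu> \<nu>'"
  unfolding moves_along_def
proof (intro allI impI)
  fix f :: "'a \<Rightarrow> real"
  assume f: "f \<in> borel_measurable borel" and b: "\<exists>a c. \<forall>y. \<bar>f y\<bar> \<le> a + c * norm y ^ 4"
  then obtain a c where b': "\<And>y. \<bar>f y\<bar> \<le> a + c * norm y ^ 4" by blast
  note i = integral_quartic_le(1)[OF m(1) f b'] integral_quartic_le(1)[OF m(2) f b']
  note n = finite_moment_measuresD(2)[OF m(1)] finite_moment_measuresD(2)[OF m(2)]
  have e: "(\<integral>y. f y \<partial>m') - (\<integral>y. f y \<partial>m) = \<eta> * ((\<integral>y. f y \<partial>\<nu>') - (\<integral>y. f y \<partial>\<nu>))"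
    using mv f b unfolding moves_along_def by blast
  show "(\<integral>y. f y \<partial>mixture s' m m') - (\<integral>y. f y \<partial>mixture s m m')
      = (s' - s) * \<eta> * ((\<integral>y. f y \<partial>\<nu>') - (\<integral>y. f y \<partial>\<nu>))"
    unfolding integral_mixture(2)[OF s n i] integral_mixture(2)[OF s' n i] mult.assoc[of "s' - s"] e[symmetric]
    by (simp add: algebra_simps)
qed

text \<open>Two points of the segment from \<open>m\<close> to \<open>m'\<close> differ by a multiple of \<open>\<nu>' - \<nu>\<close>, so the next derivative
\<open>H\<close> controls the variation of \<open>G\<close> along the segment. Besides the size of the Taylor remainder this
gives the continuity in \<open>s\<close> of the integrand in the increment formula.\<close>

lemma integral_mixture_Lipschitz:
  assumes lfd: "linear_functional_derivative p F G" "linear_functional_derivative (Suc p) G H"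
    and GH: "quartic_bound (Suc p) C G" "quartic_bound (Suc (Suc p)) C H" and C: "0 \<le> C"
    and m: "m \<in> P4" "m' \<in> P4"
    and \<nu>: "\<nu> \<in> P4" "\<nu>' \<in> P4"
    and \<rho>: "\<rho> \<in> P4"
    and mv: "moves_along m m' \<eta> \<nu> \<nu>'" and ys: "length ys = p"
    and s: "0 \<le> s" "s \<le> 1" and s': "0 \<le> s'" "s' \<le> 1"
  shows "\<bar>(\<integral>y. G (mixture s' m m') (ys @ [y]) \<partial>\<rho>) - (\<integral>y. G (mixture s m m') (ys @ [y]) \<partial>\<rho>)\<bar>
    \<le> \<bar>s' - s\<bar> * \<bar>\<eta>\<bar> * (4 * C * (1 + (\<Sum>y\<leftarrow>ys. norm y ^ 4)
           + (fourth_moment m + fourth_moment m' + fourth_moment \<nu> + fourth_moment \<nu>') + fourth_moment \<rho>))"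
proof -
  let ?x = "mixture s m m'" and ?x' = "mixture s' m m'" and ?S = "(\<Sum>y\<leftarrow>ys. norm y ^ 4)"
  let ?M = "fourth_moment m + fourth_moment m' + fourth_moment \<nu> + fourth_moment \<nu>'"
  let ?e = "\<bar>s' - s\<bar> * \<bar>\<eta>\<bar>"
  note x = mixture_finite_moment[OF s m] and x' = mixture_finite_moment[OF s' m]
  have M: "fourth_moment ?x + fourth_moment ?x' + fourth_moment \<nu> + fourth_moment \<nu>' \<le> 2 * ?M"
    using fourth_moment_mixture_le[OF s m] fourth_moment_mixture_le[OF s' m]
      fourth_moment_nonneg[of \<nu>] fourth_moment_nonneg[of \<nu>'] by (simp add: distrib_left)
  have b: "\<bar>G ?x' (ys @ [y]) - G ?x (ys @ [y])\<bar> \<le> ?e * (4 * C * (1 + ?S + ?M)) + ?e * (4 * C) * norm y ^ 4" for y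
  proof -
    have "\<bar>G ?x' (ys @ [y]) - G ?x (ys @ [y])\<bar> \<le> \<bar>(s' - s) * \<eta>\<bar> * (2 * C * (1 + (\<Sum>y\<leftarrow>ys @ [y]. norm y ^ 4)
           + (fourth_moment ?x + fourth_moment ?x' + fourth_moment \<nu> + fourth_moment \<nu>')))"
      using ys by (intro first_order_bound[OF lfd(2) GH(2) C x x' \<nu> moves_along_mixture[OF s s' m mv]]) simp
    also have "\<dots> \<le> ?e * (2 * C * (2 * (1 + ?S + ?M + norm y ^ 4)))"
    proof -
      have "(\<Sum>y\<leftarrow>ys @ [y]. norm y ^ 4) = ?S + norm y ^ 4" "0 \<le> ?S" "0 \<le> norm y ^ 4" by simp_all
      then have "1 + (\<Sum>y\<leftarrow>ys @ [y]. norm y ^ 4)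
           + (fourth_moment ?x + fourth_moment ?x' + fourth_moment \<nu> + fourth_moment \<nu>')
          \<le> 2 * (1 + ?S + ?M + norm y ^ 4)"
        using M unfolding mult_2 by linarith
      then show ?thesis
        unfolding abs_mult using C by (intro mult_left_mono) auto
    qed
    finally show ?thesis by (simp add: algebra_simps)
  qed
  note gm = lfd_derivative_measurable[OF lfd(1) P4_subset_P2[OF x] ys]
    lfd_derivative_measurable[OF lfd(1) P4_subset_P2[OF x'] ys]
  have "(\<integral>y. G ?x' (ys @ [y]) \<partial>\<rho>) - (\<integral>y. G ?x (ys @ [y]) \<partial>\<rho>) = (\<integral>y. G ?x' (ys @ [y]) - G ?x (ys @ [y]) \<partial>\<rho>)"
    by (rule Bochner_Integration.integral_diff[symmetric])
      (rule integral_derivative_le(1)[OF lfd(1) GH(1) _ \<rho> ys], rule x' x)+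
  then show ?thesis
    using integral_quartic_le(2)[OF \<rho> borel_measurable_diff[OF gm(2) gm(1)] b]
    by (simp add: algebra_simps)
qed

text \<open>The Taylor expansion of first order with a remainder quadratic in \<open>\<eta>\<close>: in the increment formula,
compare the integrand at \<open>s\<close> with its value at \<open>0\<close>.\<close>

lemma second_order_bound:
  assumes lfd: "linear_functional_derivative p F G" "linear_functional_derivative (Suc p) G H"
    and GH: "quartic_bound (Suc p) C G" "quartic_bound (Suc (Suc p)) C H" and C: "0 \<le> C"
    and m: "m \<in> P4" "m' \<in> P4"
    and \<nu>: "\<nu> \<in> P4" "\<nu>' \<in> P4"
    and mv: "moves_along m m' \<eta> \<nu> \<nu>'" and ys: "length ys = p"
  shows "\<bar>F m' ys - F m ys - \<eta> * ((\<integral>y. G m (ys @ [y]) \<partial>\<nu>') - (\<integral>y. G m (ys @ [y]) \<partial>\<nu>))\<bar>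
    \<le> \<eta>\<^sup>2 * (16 * C * (1 + (\<Sum>y\<leftarrow>ys. norm y ^ 4)
           + (fourth_moment m + fourth_moment m' + fourth_moment \<nu> + fourth_moment \<nu>')))"
proof -
  let ?S = "(\<Sum>y\<leftarrow>ys. norm y ^ 4)"
  let ?M = "fourth_moment m + fourth_moment m' + fourth_moment \<nu> + fourth_moment \<nu>'"
  define I where "I \<rho> s = (\<integral>y. G (mixture s m m') (ys @ [y]) \<partial>\<rho>)" for \<rho> s
  have M: "0 \<le> ?M" "0 \<le> ?S" by (simp_all add: fourth_moment_nonneg)
  have Lip: "\<bar>I \<rho> s' - I \<rho> s\<bar> \<le> \<bar>s' - s\<bar> * \<bar>\<eta>\<bar> * (8 * C * (1 + ?S + ?M))"
    if \<rho>: "\<rho> = \<nu> \<or> \<rho> = \<nu>'" and s: "0 \<le> s" "s \<le> 1" and s': "0 \<le> s'" "s' \<le> 1" for \<rho> s s'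
  proof -
    have "\<rho> \<in> P4" using \<rho> \<nu> by auto
    then have "\<bar>I \<rho> s' - I \<rho> s\<bar> \<le> \<bar>s' - s\<bar> * \<bar>\<eta>\<bar> * (4 * C * (1 + ?S + ?M + fourth_moment \<rho>))"
      unfolding I_def by (intro integral_mixture_Lipschitz[OF lfd GH C m \<nu> _ mv ys s s'])
    also have "\<dots> \<le> \<bar>s' - s\<bar> * \<bar>\<eta>\<bar> * (4 * C * (2 * (1 + ?S + ?M)))"
      using C \<rho> M fourth_moment_nonneg[of m] fourth_moment_nonneg[of m'] fourth_moment_nonneg[of \<nu>]
        fourth_moment_nonneg[of \<nu>'] by (intro mult_left_mono) auto
    finally show ?thesis by (simp add: mult_ac)
  qed
  have cont: "continuous_on {0..1} (I \<rho>)" if \<rho>: "\<rho> = \<nu> \<or> \<rho> = \<nu>'" for \<rho>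
  proof (rule lipschitz_on_continuous_on)
    show "(\<bar>\<eta>\<bar> * (8 * C * (1 + ?S + ?M)))-lipschitz_on {0..1} (I \<rho>)"
    proof (rule lipschitz_onI)
      show "dist (I \<rho> x) (I \<rho> y) \<le> \<bar>\<eta>\<bar> * (8 * C * (1 + ?S + ?M)) * dist x y"
        if "x \<in> {0..1}" "y \<in> {0..1}" for x y
        using Lip[OF \<rho>, of y x] that by (simp add: dist_real_def mult_ac)
    qed (use C M in auto)
  qed
  define h where "h s = \<eta> * (I \<nu>' s - I \<nu> s)" for s
  have "continuous_on {0..1} h"
    unfolding h_def by (intro continuous_intros cont) auto
  from borel_integrable_atLeastAtMost'[OF this] borel_integrable_atLeastAtMost'[OF continuous_on_const]
  have h: "set_integrable lborel {0..1} h" "set_integrable lborel {0..1::real} (\<lambda>s. h 0)"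
    by blast+
  have "mixture 0 m m' = m"
    by (rule measure_eqI) (use finite_moment_measuresD(2)[OF m(1)] finite_moment_measuresD(2)[OF m(2)] in
      \<open>auto simp: emeasure_mixture\<close>)
  then have h0: "h 0 = \<eta> * ((\<integral>y. G m (ys @ [y]) \<partial>\<nu>') - (\<integral>y. G m (ys @ [y]) \<partial>\<nu>))"
    by (simp add: h_def I_def)
  have "F m' ys - F m ys - h 0 = (LINT s:{0..1}|lborel. h s) - (LINT s:{0..1::real}|lborel. h 0)"
    unfolding lfd_increment_moves_along[OF lfd(1) GH(1) m \<nu> mv ys]
    by (simp add: h_def I_def set_integral_const_unit)
  also have "\<dots> = (LINT s:{0..1}|lborel. h s - h 0)"
    using h by simp
  finally have "F m' ys - F m ys - h 0 = (LINT s:{0..1}|lborel. h s - h 0)" .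
  also have "\<bar>\<dots>\<bar> \<le> \<eta>\<^sup>2 * (16 * C * (1 + ?S + ?M))"
  proof (rule abs_integral_unit_interval_le)
    fix s :: real assume s: "0 \<le> s" "s \<le> 1"
    let ?B = "\<bar>\<eta>\<bar> * (8 * C * (1 + ?S + ?M))"
    have B: "0 \<le> ?B" using C M by simp
    have "\<bar>I \<rho> s - I \<rho> 0\<bar> \<le> ?B" if "\<rho> = \<nu> \<or> \<rho> = \<nu>'" for \<rho>
    proof -
      have "\<bar>I \<rho> s - I \<rho> 0\<bar> \<le> s * ?B"
        using Lip[OF that, of 0 s] s by (simp add: mult_ac)
      also have "\<dots> \<le> 1 * ?B" using s B by (intro mult_right_mono)
      finally show ?thesis by simp
    qed
    from this[of \<nu>] this[of \<nu>'] have "\<bar>(I \<nu>' s - I \<nu>' 0) - (I \<nu> s - I \<nu> 0)\<bar> \<le> 2 * ?B" by simp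
    then have "\<bar>\<eta>\<bar> * \<bar>(I \<nu>' s - I \<nu>' 0) - (I \<nu> s - I \<nu> 0)\<bar> \<le> \<bar>\<eta>\<bar> * (2 * ?B)"
      by (intro mult_left_mono) auto
    also have "\<bar>\<eta>\<bar> * \<bar>(I \<nu>' s - I \<nu>' 0) - (I \<nu> s - I \<nu> 0)\<bar> = \<bar>h s - h 0\<bar>"
      unfolding h_def abs_mult[symmetric] by (simp add: algebra_simps)
    also have "\<bar>\<eta>\<bar> * (2 * ?B) = \<bar>\<eta>\<bar> * \<bar>\<eta>\<bar> * (16 * C * (1 + ?S + ?M))"
      by (simp add: mult_ac)
    finally show "\<bar>h s - h 0\<bar> \<le> \<eta>\<^sup>2 * (16 * C * (1 + ?S + ?M))"
      by (simp add: power2_eq_square abs_mult[symmetric] del: abs_mult_self_eq)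
  qed
  finally show ?thesis unfolding h0 .
qed

lemma quartic_bound_mono: "quartic_bound p C G \<Longrightarrow> C \<le> C' \<Longrightarrow> quartic_bound p C' G"
  unfolding quartic_bound_def
proof (intro ballI allI impI)
  fix m :: "'a measure" and ys :: "'a list"
  assume G: "\<forall>m\<in>P4. \<forall>ys. length ys = p \<longrightarrow>
      \<bar>G m ys\<bar> \<le> C * (1 + (\<Sum>y\<leftarrow>ys. norm y ^ 4) + fourth_moment m)"
    and C: "C \<le> C'" and m: "m \<in> P4" and ys: "length ys = p"
  have "0 \<le> 1 + (\<Sum>y\<leftarrow>ys. norm y ^ 4) + fourth_moment m"
    by (simp add: fourth_moment_nonneg)
  from order_trans[OF G[rule_format, OF m ys] mult_right_mono[OF C this]]
  show "\<bar>G m ys\<bar> \<le> C' * (1 + (\<Sum>y\<leftarrow>ys. norm y ^ 4) + fourth_moment m)" .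
qed

text \<open>A single measure is a bounded set, so here the quadratic growth in the definition of a derivative
applies; \<open>t\<^sup>2 \<le> 1 + t\<^sup>4\<close> turns it into quartic growth.\<close>

lemma quadratic_growth_at:
  assumes G: "quadratic_growth_P2 p G" and \<mu>: "\<mu> \<in> P2"
  shows "\<exists>A\<ge>0. \<forall>ys. length ys = p \<longrightarrow> \<bar>G \<mu> ys\<bar> \<le> A * (1 + (\<Sum>y\<leftarrow>ys. norm y ^ 4))"
proof -
  have "W2_bounded {\<mu>}" using \<mu> by (auto simp: W2_bounded_def)
  then obtain C where C: "\<And>ys. length ys = p \<Longrightarrow> \<bar>G \<mu> ys\<bar> \<le> C * (1 + (\<Sum>y\<leftarrow>ys. (norm y)\<^sup>2))"
    using G unfolding quadratic_growth_P2_def by (metis singletonI)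
  show ?thesis
  proof (intro exI conjI allI impI)
    show "0 \<le> \<bar>C\<bar> * (1 + real p)" by simp
    fix ys :: "'a list" assume ys: "length ys = p"
    let ?S = "(\<Sum>y\<leftarrow>ys. norm y ^ 4)"
    have sq: "t\<^sup>2 \<le> 1 + t ^ 4" for t :: real
    proof -
      have "0 \<le> (t\<^sup>2 - 1)\<^sup>2 + t\<^sup>2" by simp
      then show ?thesis by (simp add: power2_eq_square power4_eq_xxxx algebra_simps)
    qed
    have "(\<Sum>y\<leftarrow>ys. (norm y)\<^sup>2) \<le> (\<Sum>y\<leftarrow>ys. 1 + norm y ^ 4)"
      by (intro sum_list_mono sq)
    also have "\<dots> = real p + ?S"
      using ys by (simp add: sum_list_addf sum_list_triv)
    finally have 1: "(\<Sum>y\<leftarrow>ys. (norm y)\<^sup>2) \<le> real p + ?S" .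
    have "0 \<le> (\<Sum>y\<leftarrow>ys. (norm y)\<^sup>2)" by simp
    then have "\<bar>G \<mu> ys\<bar> \<le> \<bar>C\<bar> * (1 + (\<Sum>y\<leftarrow>ys. (norm y)\<^sup>2))"
      by (intro order_trans[OF C[OF ys]] mult_right_mono) auto
    also have "\<dots> \<le> \<bar>C\<bar> * ((1 + real p) * (1 + ?S))"
    proof (intro mult_left_mono)
      have "0 \<le> real p * ?S" by simp
      moreover have "(1 + real p) * (1 + ?S) = 1 + real p + ?S + real p * ?S"
        by (simp add: algebra_simps)
      ultimately show "1 + (\<Sum>y\<leftarrow>ys. (norm y)\<^sup>2) \<le> (1 + real p) * (1 + ?S)"
        using 1 by linarith
    qed simp
    finally show "\<bar>G \<mu> ys\<bar> \<le> \<bar>C\<bar> * (1 + real p) * (1 + ?S)" by (simp add: mult_ac)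
  qed
qed

text \<open>Downward induction on the order. The functional of order \<open>0\<close> is left out: the definition of a
derivative says nothing on the growth of a functional that is not itself a derivative.\<close>

lemma derivatives_quartic_bound:
  fixes D :: "nat \<Rightarrow> 'a::euclidean_space measure \<Rightarrow> 'a list \<Rightarrow> real" and \<mu> :: "'a measure"
  assumes lfd: "\<And>p. p < k \<Longrightarrow> linear_functional_derivative p (D p) (D (Suc p))"
    and top: "\<exists>C\<ge>0. quartic_bound k C (D k)" and \<mu>: "\<mu> \<in> P4"
  shows "\<exists>C\<ge>0. \<forall>p\<in>{1..k}. quartic_bound p C (D p)"
proof -
  have "\<exists>C\<ge>0. quartic_bound p C (D p)" if "1 \<le> p" "p \<le> k" for p
    using that(2,1)
  proof (induction rule: inc_induct)
    case base
    show ?case by (rule top)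
  next
    case (step n)
    obtain C where C: "0 \<le> C" "quartic_bound (Suc n) C (D (Suc n))"
      using step by auto
    have "quadratic_growth_P2 n (D n)"
      using lfd[of "n - 1"] step by (simp add: linear_functional_derivative_def)
    then obtain A where A: "0 \<le> A" "\<And>ys. length ys = n \<Longrightarrow> \<bar>D n \<mu> ys\<bar> \<le> A * (1 + (\<Sum>y\<leftarrow>ys. norm y ^ 4))"
      using quadratic_growth_at[OF _ P4_subset_P2[OF \<mu>]] by metis
    show ?case
      using step by (intro quartic_bound_antiderivative[OF lfd C(2) \<mu> C(1) A]) auto
  qed
  then have "\<forall>p\<in>{1..k}. \<exists>C\<ge>0. quartic_bound p C (D p)" by auto
  then obtain C where C: "\<And>p. p \<in> {1..k} \<Longrightarrow> C p \<ge> 0 \<and> quartic_bound p (C p) (D p)"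
    unfolding bchoice_iff by blast
  show ?thesis
  proof (intro exI conjI ballI)
    show "0 \<le> (\<Sum>p\<in>{1..k}. C p)" using C by (intro sum_nonneg) auto
    show "quartic_bound p (\<Sum>p\<in>{1..k}. C p) (D p)" if "p \<in> {1..k}" for p
    proof (rule quartic_bound_mono)
      show "quartic_bound p (C p) (D p)" using C that by blast
      show "C p \<le> (\<Sum>p\<in>{1..k}. C p)" using C that by (intro member_le_sum) auto
    qed
  qed
qed

section \<open>Partial replacement of a law by its sample\<close>

text \<open>The measure \<open>1/n (\<Sum>\<^sub>i\<^sub>\<in>\<^sub>J \<delta>(x i) + (n - card J) \<mu>)\<close>, which interpolates between \<open>\<mu>\<close> for \<open>J = {}\<close> and
the empirical measure for \<open>card J = n\<close>. For \<open>J = {}\<close> the second component of the mixture is the null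
measure, with weight \<open>0\<close>.\<close>

definition partial_empirical ::
  "'a::euclidean_space measure \<Rightarrow> nat \<Rightarrow> nat set \<Rightarrow> (nat \<Rightarrow> 'a) \<Rightarrow> 'a measure" where
  "partial_empirical \<mu> n J x = mixture (card J / n) \<mu> (empirical_measure J x)"

lemma sets_partial_empirical [simp]: "sets (partial_empirical \<mu> n J x) = sets borel"
  by (simp add: partial_empirical_def)

lemma mixture_0: "sets m = sets borel \<Longrightarrow> sets m' = sets borel \<Longrightarrow> mixture 0 m m' = m"
  by (rule measure_eqI) (auto simp: emeasure_mixture)

lemma mixture_1: "sets m = sets borel \<Longrightarrow> sets m' = sets borel \<Longrightarrow> mixture 1 m m' = m'"
  by (rule measure_eqI) (auto simp: emeasure_mixture)

lemma partial_empirical_empty: "sets \<mu> = sets borel \<Longrightarrow> partial_empirical \<mu> n {} x = \<mu>"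
  by (simp add: partial_empirical_def mixture_0)

lemma partial_empirical_full:
  "sets \<mu> = sets borel \<Longrightarrow> 0 < card I \<Longrightarrow> partial_empirical \<mu> (card I) I x = empirical_measure I x"
  by (simp add: partial_empirical_def mixture_1)

lemma empirical_measure_cong:
  assumes "\<And>i. i \<in> J \<Longrightarrow> x i = x' i"
  shows "empirical_measure J x = empirical_measure J x'"
  by (rule measure_eqI) (auto simp: emeasure_empirical_measure assms cong: sum.cong)

lemma partial_empirical_cong:
  assumes "\<And>i. i \<in> J \<Longrightarrow> x i = x' i"
  shows "partial_empirical \<mu> n J x = partial_empirical \<mu> n J x'"
  unfolding partial_empirical_def using empirical_measure_cong[OF assms] by simp

lemma prob_space_empirical_measure:
  assumes "finite J" "J \<noteq> {}"
  shows "prob_space (empirical_measure J x)"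
proof (rule prob_spaceI)
  have "space (empirical_measure J x) = UNIV"
    using sets_eq_imp_space_eq[OF sets_empirical_measure[of J x]] by simp
  moreover have "emeasure (return borel (x i)) UNIV = 1" for i by simp
  ultimately show "emeasure (empirical_measure J x) (space (empirical_measure J x)) = 1"
    using assms by (simp add: emeasure_empirical_measure ennreal_of_nat_eq_real_of_nat divide_ennreal card_gt_0_iff)
qed

lemma integral_partial_empirical:
  fixes f :: "'a::euclidean_space \<Rightarrow> real"
  assumes J: "finite J" "card J \<le> n" "0 < n"
    and \<mu>: "sets \<mu> = sets borel" and f: "f \<in> borel_measurable borel" "integrable \<mu> f"
  shows "integrable (partial_empirical \<mu> n J x) f"
    and "(\<integral>y. f y \<partial>partial_empirical \<mu> n J x) = (1 - card J / n) * (\<integral>y. f y \<partial>\<mu>) + (\<Sum>i\<in>J. f (x i)) / n"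
proof -
  have s: "0 \<le> card J / n" "card J / n \<le> 1" using J by auto
  note * = integral_mixture[OF s \<mu> sets_empirical_measure f(2) integral_empirical_measure(1)[OF f(1)]]
  show "integrable (partial_empirical \<mu> n J x) f"
    unfolding partial_empirical_def by (rule *(1))
  have "card J / n * ((\<Sum>i\<in>J. f (x i)) / card J) = (\<Sum>i\<in>J. f (x i)) / n"
    using J by (cases "J = {}") auto
  then show "(\<integral>y. f y \<partial>partial_empirical \<mu> n J x) = (1 - card J / n) * (\<integral>y. f y \<partial>\<mu>) + (\<Sum>i\<in>J. f (x i)) / n"
    unfolding partial_empirical_def *(2) integral_empirical_measure(2)[OF f(1)] by simp
qed

lemma partial_empirical_finite_moment:
  assumes J: "finite J" "card J \<le> n" "0 < n" and \<mu>: "\<mu> \<in> finite_moment_measures k"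
  shows "partial_empirical \<mu> n J x \<in> finite_moment_measures k"
proof -
  note m = finite_moment_measuresD[OF \<mu>]
  have "prob_space (partial_empirical \<mu> n J x)"
  proof (cases "J = {}")
    case True
    then show ?thesis using m by (simp add: partial_empirical_empty)
  next
    case False
    then show ?thesis unfolding partial_empirical_def using J
      by (intro prob_space_mixture prob_space_empirical_measure m) auto
  qed
  moreover have "integrable (partial_empirical \<mu> n J x) (\<lambda>y. norm y ^ k)"
    using m by (intro integral_partial_empirical J) auto
  ultimately show ?thesis by (simp add: finite_moment_measures_def)
qed

lemma fourth_moment_partial_empirical:
  assumes J: "finite J" "card J \<le> n" "0 < n" and \<mu>: "\<mu> \<in> P4"
  shows "fourth_moment (partial_empirical \<mu> n J x)
           = (1 - card J / n) * fourth_moment \<mu> + (\<Sum>i\<in>J. norm (x i) ^ 4) / n"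
  unfolding fourth_moment_def using finite_moment_measuresD[OF \<mu>]
  by (intro integral_partial_empirical J) auto

lemma return_finite_moment: "return borel x \<in> finite_moment_measures k"
proof -
  have "integrable (return borel x) (\<lambda>x. norm x ^ k)"
    by (intro integrableI_bounded) (auto simp: nn_integral_return)
  then show ?thesis by (simp add: finite_moment_measures_def prob_space_return)
qed

lemma fourth_moment_return: "fourth_moment (return borel x) = norm x ^ 4"
  by (simp add: fourth_moment_def integral_return)

lemma moves_along_partial_empirical:
  assumes J: "finite J" "card J < n" and j: "j \<notin> J" and \<mu>: "\<mu> \<in> P4"
  shows "moves_along (partial_empirical \<mu> n J x) (partial_empirical \<mu> n (insert j J) x) (1 / n)
           \<mu> (return borel (x j))"
  unfolding moves_along_def
proof (intro allI impI)
  fix f :: "'a \<Rightarrow> real"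
  assume f: "f \<in> borel_measurable borel" and "\<exists>a c. \<forall>y. \<bar>f y\<bar> \<le> a + c * norm y ^ 4"
  then obtain a c where b: "\<And>y. \<bar>f y\<bar> \<le> a + c * norm y ^ 4" by blast
  note i = integral_quartic_le(1)[OF \<mu> f b]
  have c: "finite J" "card J \<le> n" "0 < n" "finite (insert j J)" "card (insert j J) \<le> n"
    using J j by auto
  note * = integral_partial_empirical(2)[OF _ _ c(3) finite_moment_measuresD(2)[OF \<mu>] f i]
  show "(\<integral>y. f y \<partial>partial_empirical \<mu> n (insert j J) x) - (\<integral>y. f y \<partial>partial_empirical \<mu> n J x)
      = 1 / n * ((\<integral>y. f y \<partial>return borel (x j)) - (\<integral>y. f y \<partial>\<mu>))"
    unfolding *[OF c(1,2)] *[OF c(4,5)] using J j c(3) f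
    by (simp add: integral_return field_simps)
qed

text \<open>The effect of replacing one more share \<open>1/n\<close> of \<open>\<mu>\<close> by the point mass at \<open>x j\<close>. The bound is
written as a constant depending on \<open>ys\<close> times \<open>n\<^sup>-\<^sup>2\<close> times a weight that is square integrable along
the sample.\<close>

lemma partial_empirical_second_order:
  assumes lfd: "linear_functional_derivative p F G" "linear_functional_derivative (Suc p) G H"
    and GH: "quartic_bound (Suc p) C G" "quartic_bound (Suc (Suc p)) C H" and C: "0 \<le> C"
    and J: "finite J" "card J < n" and j: "j \<notin> J" and \<mu>: "\<mu> \<in> P4"
    and ys: "length ys = p"
  shows "\<bar>F (partial_empirical \<mu> n (insert j J) x) ys - F (partial_empirical \<mu> n J x) ys
      - 1 / n * (G (partial_empirical \<mu> n J x) (ys @ [x j]) - (\<integral>y. G (partial_empirical \<mu> n J x) (ys @ [y]) \<partial>\<mu>))\<bar>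
    \<le> 32 * C * (1 + fourth_moment \<mu>) * (1 + (\<Sum>y\<leftarrow>ys. norm y ^ 4)) / (real n)\<^sup>2
       * (1 + norm (x j) ^ 4 + fourth_moment (partial_empirical \<mu> n J x))"
proof -
  let ?m = "partial_empirical \<mu> n J x" and ?m' = "partial_empirical \<mu> n (insert j J) x"
  let ?S = "(\<Sum>y\<leftarrow>ys. norm y ^ 4)" and ?R = "fourth_moment \<mu>" and ?t = "norm (x j) ^ 4"
  have c: "finite J" "card J \<le> n" "0 < n" "finite (insert j J)" "card (insert j J) \<le> n"
    using J j by auto
  have m: "?m \<in> P4" "?m' \<in> P4"
    using c by (auto intro!: partial_empirical_finite_moment \<mu>)
  have "fourth_moment ?m' - fourth_moment ?m = ?t / n - ?R / n"
    unfolding fourth_moment_partial_empirical[OF c(1-3) \<mu>] fourth_moment_partial_empirical[OF c(4,5,3) \<mu>]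
    using J j c(3) by (simp add: field_simps)
  moreover have "?t / n \<le> ?t" "0 \<le> ?R / n"
    using c(3) fourth_moment_nonneg[of \<mu>] divide_left_mono[of 1 "real n" ?t] by auto
  ultimately have m': "fourth_moment ?m' \<le> fourth_moment ?m + ?t" by linarith
  have pos: "0 \<le> fourth_moment ?m" "0 \<le> ?R" "0 \<le> ?t" "0 \<le> ?S"
    by (auto simp: fourth_moment_nonneg)
  have "(\<lambda>y. G ?m (ys @ [y])) \<in> borel_measurable borel"
    by (rule lfd_derivative_measurable[OF lfd(1) P4_subset_P2[OF m(1)] ys])
  then have r: "(\<integral>y. G ?m (ys @ [y]) \<partial>return borel (x j)) = G ?m (ys @ [x j])"
    by (simp add: integral_return)
  have "\<bar>F ?m' ys - F ?m ys - 1 / n * (G ?m (ys @ [x j]) - (\<integral>y. G ?m (ys @ [y]) \<partial>\<mu>))\<bar>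
      \<le> (1 / real n)\<^sup>2 * (16 * C * (1 + ?S + (fourth_moment ?m + fourth_moment ?m' + ?R + ?t)))"
    using second_order_bound[OF lfd GH C m \<mu> return_finite_moment[of "x j"]
        moves_along_partial_empirical[OF J j \<mu>] ys]
    unfolding r fourth_moment_return by simp
  also have "\<dots> \<le> (1 / real n)\<^sup>2 * (16 * C * (2 * ((1 + ?R) * (1 + ?S) * (1 + ?t + fourth_moment ?m))))"
  proof (intro mult_left_mono)
    have "1 + ?S + (fourth_moment ?m + fourth_moment ?m' + ?R + ?t)
        \<le> 2 * (1 + ?R + ?S + ?t + fourth_moment ?m)"
      using m' pos unfolding mult_2 by linarith
    also have "1 + ?R + ?S + ?t + fourth_moment ?m \<le> (1 + ?R) * (1 + ?S) * (1 + ?t + fourth_moment ?m)"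
    proof -
      let ?M = "fourth_moment ?m"
      have "(1 + ?R) * (1 + ?S) * (1 + ?t + ?M) - (1 + ?R + ?S + ?t + ?M)
          = ?R * ?S + (?R + ?S + ?R * ?S) * (?t + ?M)"
        by (simp add: algebra_simps)
      moreover have "0 \<le> ?R * ?S + (?R + ?S + ?R * ?S) * (?t + ?M)"
        using pos by (intro add_nonneg_nonneg mult_nonneg_nonneg)
      ultimately show ?thesis by linarith
    qed
    finally show "1 + ?S + (fourth_moment ?m + fourth_moment ?m' + ?R + ?t)
        \<le> 2 * ((1 + ?R) * (1 + ?S) * (1 + ?t + fourth_moment ?m))" by simp
  qed (use C in auto)
  also have "\<dots> = 32 * C * (1 + ?R) * (1 + ?S) / (real n)\<^sup>2 * (1 + ?t + fourth_moment ?m)"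
    by (simp add: power_divide)
  finally show ?thesis .
qed

section \<open>Continuity of the partially replaced law\<close>

lemma distr_mixture:
  fixes f :: "'a::euclidean_space \<Rightarrow> 'b::euclidean_space"
  assumes f: "f \<in> borel_measurable borel" and m: "sets m = sets borel" "sets m' = sets borel"
  shows "distr (mixture s m m') borel f = mixture s (distr m borel f) (distr m' borel f)"
proof (rule measure_eqI)
  have sp: "space m = UNIV" "space m' = UNIV" "space (mixture s m m') = UNIV"
    using sets_eq_imp_space_eq[OF m(1)] sets_eq_imp_space_eq[OF m(2)]
      sets_eq_imp_space_eq[OF sets_mixture[of s m m']] by simp_all
  have fm: "f \<in> measurable m borel" "f \<in> measurable m' borel" "f \<in> measurable (mixture s m m') borel"
    unfolding measurable_cong_sets[OF m(1) refl] measurable_cong_sets[OF m(2) refl]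
      measurable_cong_sets[OF sets_mixture refl] by (rule f)+
  fix A assume "A \<in> sets (distr (mixture s m m') borel f)"
  then have A: "A \<in> sets borel" by simp
  have "f -` A \<in> sets borel" using measurable_sets[OF f A] by simp
  then show "emeasure (distr (mixture s m m') borel f) A
      = emeasure (mixture s (distr m borel f) (distr m' borel f)) A"
    using A m fm sp by (simp add: emeasure_mixture emeasure_distr)
qed simp

lemma distr_empirical_measure:
  fixes f :: "'a::euclidean_space \<Rightarrow> 'b::euclidean_space"
  assumes f: "f \<in> borel_measurable borel"
  shows "distr (empirical_measure J x) borel f = empirical_measure J (\<lambda>i. f (x i))"
proof (rule measure_eqI)
  have sp: "space (empirical_measure J x) = UNIV"
    using sets_eq_imp_space_eq[OF sets_empirical_measure[of J x]] by simp
  have fm: "f \<in> measurable (empirical_measure J x) borel"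
    unfolding measurable_cong_sets[OF sets_empirical_measure refl] by (rule f)
  fix A assume "A \<in> sets (distr (empirical_measure J x) borel f)"
  then have A: "A \<in> sets borel" by simp
  have "f -` A \<in> sets borel" using measurable_sets[OF f A] by simp
  then show "emeasure (distr (empirical_measure J x) borel f) A
      = emeasure (empirical_measure J (\<lambda>i. f (x i))) A"
    using A fm sp by (simp add: emeasure_empirical_measure emeasure_distr indicator_def)
qed simp

text \<open>A share \<open>1 - s\<close> of the mass stays where it is and the rest follows the coupling \<open>p\<close>.\<close>

lemma W2_mixture_le:
  assumes m: "m \<in> P2" and m': "m' \<in> P2" and s: "0 \<le> s" "s \<le> 1" and p: "p \<in> couplings m m'"
    and ip: "integrable p (\<lambda>z. (dist (fst z) (snd z))\<^sup>2)"
  shows "W2 m (mixture s m m') \<le> sqrt (s * (\<integral>z. (dist (fst z) (snd z))\<^sup>2 \<partial>p))"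
proof -
  let ?d = "distr m borel (\<lambda>x. (x, x))"
  note d = diagonal_coupling[OF m]
  have sp: "sets p = sets borel" "prob_space p" "distr p borel fst = m" "distr p borel snd = m'"
    using p by (auto simp: couplings_def)
  have sd: "sets ?d = sets borel" "prob_space ?d" "distr ?d borel fst = m" "distr ?d borel snd = m"
    using d(1) by (auto simp: couplings_def)
  have fs: "fst \<in> borel_measurable (borel :: ('a \<times> 'a) measure)" "snd \<in> borel_measurable (borel :: ('a \<times> 'a) measure)"
    by (auto simp: borel_prod[symmetric])
  have "mixture s m m = m"
  proof (rule measure_eqI)
    fix A assume A: "A \<in> sets (mixture s m m)"
    have "ennreal (1 - s) * emeasure m A + ennreal s * emeasure m A = (ennreal (1 - s) + ennreal s) * emeasure m A"
      by (simp add: distrib_right)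
    also have "ennreal (1 - s) + ennreal s = 1"
      using s by (simp add: ennreal_plus[symmetric] del: ennreal_plus)
    finally show "emeasure (mixture s m m) A = emeasure m A"
      using A finite_moment_measuresD(2)[OF m] by (simp add: emeasure_mixture)
  qed (use finite_moment_measuresD(2)[OF m] in simp)
  then have "mixture s ?d p \<in> couplings m (mixture s m m')"
    unfolding couplings_def using prob_space_mixture[OF s sd(2) sp(2) sd(1) sp(1)]
      distr_mixture[OF fs(1) sd(1) sp(1)] distr_mixture[OF fs(2) sd(1) sp(1)] sd(3,4) sp(3,4) by simp
  then show ?thesis
    using W2_le_coupling_cost integral_mixture(2)[OF s sd(1) sp(1) d(2) ip] d(3) by fastforce
qed

text \<open>Couple the points of the two samples index by index and the shares of \<open>\<mu>\<close> along the diagonal. For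
\<open>s = 1\<close> this bounds the distance of the two partially replaced laws themselves.\<close>

lemma W2_partial_empirical_mixture_le:
  fixes \<mu> :: "'a::euclidean_space measure"
  assumes J: "finite J" "card J \<le> n" "0 < n" and \<mu>: "\<mu> \<in> P2" and s: "0 \<le> s" "s \<le> 1"
    and d: "0 \<le> d" "\<And>i. i \<in> J \<Longrightarrow> dist (x i) (x' i) \<le> d"
  shows "W2 (partial_empirical \<mu> n J x) (mixture s (partial_empirical \<mu> n J x) (partial_empirical \<mu> n J x')) \<le> d"
proof -
  let ?c = "\<lambda>z. (dist (fst z) (snd z))\<^sup>2"
  let ?d = "distr \<mu> borel (\<lambda>x. (x, x))" and ?e = "empirical_measure J (\<lambda>i. (x i, x' i))"
  let ?p = "mixture (card J / n) ?d ?e"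
  have t: "0 \<le> card J / n" "card J / n \<le> 1" using J by auto
  note dd = diagonal_coupling[OF \<mu>]
  have sd: "sets ?d = sets borel" "distr ?d borel fst = \<mu>" "distr ?d borel snd = \<mu>"
    using dd(1) by (auto simp: couplings_def)
  have fs: "fst \<in> borel_measurable (borel :: ('a \<times> 'a) measure)" "snd \<in> borel_measurable (borel :: ('a \<times> 'a) measure)"
    by (auto simp: borel_prod[symmetric])
  have cm: "?c \<in> borel_measurable (borel :: ('a \<times> 'a) measure)"
    by (intro borel_measurable_continuous_onI continuous_intros)
  have mg: "distr ?p borel fst = partial_empirical \<mu> n J x" "distr ?p borel snd = partial_empirical \<mu> n J x'"
    unfolding partial_empirical_def using sd
    by (simp_all add: distr_mixture[OF fs(1) sd(1)] distr_mixture[OF fs(2) sd(1)]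
        distr_empirical_measure[OF fs(1)] distr_empirical_measure[OF fs(2)])
  have P: "partial_empirical \<mu> n J x \<in> P2" "partial_empirical \<mu> n J x' \<in> P2"
    by (intro partial_empirical_finite_moment J \<mu>)+
  have "fst \<in> measurable ?p borel"
    unfolding measurable_cong_sets[OF sets_mixture refl] by (rule fs)
  then have "prob_space ?p"
    using prob_space_distrD[of fst ?p borel] finite_moment_measuresD(1)[OF P(1)] mg(1) by simp
  then have p: "?p \<in> couplings (partial_empirical \<mu> n J x) (partial_empirical \<mu> n J x')"
    using mg by (simp add: couplings_def)
  note i = integral_mixture[OF t sd(1) sets_empirical_measure dd(2) integral_empirical_measure(1)[OF cm]]
  have "card J / n * ((\<Sum>i\<in>J. (dist (x i) (x' i))\<^sup>2) / card J) \<le> d\<^sup>2"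
  proof (cases "J = {}")
    case False
    have "(\<Sum>i\<in>J. (dist (x i) (x' i))\<^sup>2) \<le> (\<Sum>i\<in>J. d\<^sup>2)"
      using d by (intro sum_mono power_mono) auto
    also have "\<dots> \<le> n * d\<^sup>2" using J by (simp add: mult_right_mono)
    finally show ?thesis using J False by (simp add: field_simps)
  qed simp
  then have "(\<integral>z. ?c z \<partial>?p) \<le> d\<^sup>2"
    unfolding i(2) dd(3) integral_empirical_measure(2)[OF cm] by simp
  moreover have "s * (\<integral>z. ?c z \<partial>?p) \<le> 1 * (\<integral>z. ?c z \<partial>?p)"
    using s by (intro mult_right_mono) auto
  ultimately have "s * (\<integral>z. ?c z \<partial>?p) \<le> d\<^sup>2" by simp
  then have "sqrt (s * (\<integral>z. ?c z \<partial>?p)) \<le> d"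
    using d(1) real_le_lsqrt by fastforce
  then show ?thesis
    using W2_mixture_le[OF P s p i(1)] by simp
qed

lemma continuous_P2D:
  assumes "continuous_P2 p G" "m \<in> P2" "length ys = p" "0 < e"
  obtains \<delta> where "0 < \<delta>" "\<And>m' ys'. m' \<in> P2 \<Longrightarrow> length ys' = p \<Longrightarrow> W2 m m' < \<delta> \<Longrightarrow>
     (\<And>i. i < p \<Longrightarrow> dist (ys ! i) (ys' ! i) < \<delta>) \<Longrightarrow> \<bar>G m' ys' - G m ys\<bar> < e"
  using assms unfolding continuous_P2_def by metis

lemma eventually_coordinates_close:
  fixes x :: "nat \<Rightarrow> 'a::euclidean_space"
  assumes "finite J" "0 < d"
  shows "\<forall>\<^sub>F x' in nhds x. \<forall>i\<in>J. dist (x i) (x' i) < d"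
proof (intro eventually_ball_finite[OF assms(1)] ballI)
  fix i
  have "((\<lambda>x'. x' i) \<longlongrightarrow> x i) (nhds x)"
    using continuous_on_product_coordinates[of i]
    by (metis UNIV_I at_within_open continuous_on_def open_UNIV tendsto_at_iff_tendsto_nhds)
  from tendstoD[OF this assms(2)] show "\<forall>\<^sub>F x' in nhds x. dist (x i) (x' i) < d"
    by (simp add: dist_commute)
qed

text \<open>The map is continuous, as close samples have close partially replaced laws. Joint measurability in
the sample and the point is needed for the exchange of integrals in conditioning on the past.\<close>

lemma partial_empirical_derivative_measurable:
  fixes \<mu> :: "'a::euclidean_space measure"
  assumes J: "finite J" "card J \<le> n" "0 < n" and \<mu>: "\<mu> \<in> P2"
    and G: "continuous_P2 (Suc p) G" and zs: "length zs = p"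
  shows "(\<lambda>(x, y). G (partial_empirical \<mu> n J x) (zs @ [y])) \<in> borel_measurable (borel \<Otimes>\<^sub>M borel)"
  unfolding borel_prod
proof (rule borel_measurable_continuous_onI)
  let ?m = "partial_empirical \<mu> n J"
  have P: "?m x \<in> P2" for x by (intro partial_empirical_finite_moment J \<mu>)
  have "((\<lambda>(x, y). G (?m x) (zs @ [y])) \<longlongrightarrow> G (?m x) (zs @ [y])) (nhds (x, y))" for x y
  proof (rule tendstoI)
    fix e :: real assume "0 < e"
    then obtain \<delta> where \<delta>: "0 < \<delta>" "\<And>m' ys'. m' \<in> P2 \<Longrightarrow> length ys' = Suc p \<Longrightarrow> W2 (?m x) m' < \<delta> \<Longrightarrow>
        (\<And>i. i < Suc p \<Longrightarrow> dist ((zs @ [y]) ! i) (ys' ! i) < \<delta>) \<Longrightarrow> \<bar>G m' ys' - G (?m x) (zs @ [y])\<bar> < e"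
      using continuous_P2D[OF G P[of x], of "zs @ [y]"] zs by (metis length_append_singleton)
    have 1: "\<forall>\<^sub>F x' in nhds x. \<forall>i\<in>J. dist (x i) (x' i) < \<delta> / 2"
      using \<delta>(1) J(1) by (intro eventually_coordinates_close) auto
    have 2: "\<forall>\<^sub>F y' in nhds y. dist y y' < \<delta>"
      using \<delta>(1) by (auto simp: eventually_nhds_metric dist_commute)
    have "\<forall>\<^sub>F z in nhds x \<times>\<^sub>F nhds y. dist (case z of (x', y') \<Rightarrow> G (?m x') (zs @ [y'])) (G (?m x) (zs @ [y])) < e"
      using eventually_prodI[OF 1 2]
    proof eventually_elim
      case (elim z)
      obtain x' y' where z: "z = (x', y')" by (cases z)
      have "W2 (?m x) (mixture 1 (?m x) (?m x')) \<le> \<delta> / 2"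
        using elim \<delta>(1) z by (intro W2_partial_empirical_mixture_le J \<mu>) auto
      then have "W2 (?m x) (?m x') < \<delta>"
        using \<delta>(1) by (simp add: mixture_1)
      moreover have "dist ((zs @ [y]) ! i) ((zs @ [y']) ! i) < \<delta>" if "i < Suc p" for i
        using that zs elim z \<delta>(1) by (auto simp: nth_append less_Suc_eq)
      ultimately show ?case
        using \<delta>(2)[OF P[of x'], of "zs @ [y']"] zs z by (simp add: dist_real_def)
    qed
    then show "\<forall>\<^sub>F z in nhds (x, y). dist (case z of (x', y') \<Rightarrow> G (?m x') (zs @ [y'])) (G (?m x) (zs @ [y])) < e"
      by (simp add: nhds_prod)
  qed
  then show "continuous_on UNIV (\<lambda>(x, y). G (?m x) (zs @ [y]))"
    by (auto simp: continuous_on_eq_continuous_at continuous_at tendsto_at_iff_tendsto_nhds)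
qed

text \<open>A derivative is continuous by definition, but the functional \<open>F\<close> need not be the derivative of
anything. Its continuity along samples comes from the increment formula: the difference of the two
laws is carried by the finitely many sample points, and \<open>G\<close> varies little between corresponding
points, uniformly along the segment.\<close>

lemma partial_empirical_functional_measurable:
  fixes \<mu> :: "'a::euclidean_space measure"
  assumes J: "finite J" "card J \<le> n" "0 < n" and \<mu>: "\<mu> \<in> P4"
    and lfd: "linear_functional_derivative p F G" and G: "quartic_bound (Suc p) C G" and ys: "length ys = p"
  shows "(\<lambda>x. F (partial_empirical \<mu> n J x) ys) \<in> borel_measurable borel"
proof (rule borel_measurable_continuous_onI)
  let ?m = "partial_empirical \<mu> n J"
  note \<mu>2 = P4_subset_P2[OF \<mu>]
  have P: "?m x \<in> P4" for x by (intro partial_empirical_finite_moment J \<mu>)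
  have cG: "continuous_P2 (Suc p) G" using lfd by (simp add: linear_functional_derivative_def)
  have "((\<lambda>x. F (?m x) ys) \<longlongrightarrow> F (?m x) ys) (nhds x)" for x
  proof (rule tendstoI)
    fix e :: real assume e: "0 < e"
    have "\<forall>\<^sub>F x' in nhds x. \<forall>i\<in>J. \<forall>s\<in>{0..1}.
        \<bar>G (mixture s (?m x) (?m x')) (ys @ [x' i]) - G (mixture s (?m x) (?m x')) (ys @ [x i])\<bar> \<le> e / 2"
    proof (intro eventually_ball_finite[OF J(1)] ballI)
      fix i assume i: "i \<in> J"
      have "0 < e / 4" using e by simp
      then obtain \<delta> where \<delta>: "0 < \<delta>" "\<And>m' ys'. m' \<in> P2 \<Longrightarrow> length ys' = Suc p \<Longrightarrow> W2 (?m x) m' < \<delta> \<Longrightarrow>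
          (\<And>k. k < Suc p \<Longrightarrow> dist ((ys @ [x i]) ! k) (ys' ! k) < \<delta>) \<Longrightarrow>
          \<bar>G m' ys' - G (?m x) (ys @ [x i])\<bar> < e / 4"
        using continuous_P2D[OF cG P4_subset_P2[OF P[of x]], of "ys @ [x i]"] ys
        by (metis length_append_singleton)
      have "\<forall>\<^sub>F x' in nhds x. \<forall>i\<in>J. dist (x i) (x' i) < \<delta> / 2"
        using \<delta>(1) J(1) by (intro eventually_coordinates_close) auto
      then show "\<forall>\<^sub>F x' in nhds x. \<forall>s\<in>{0..1}.
        \<bar>G (mixture s (?m x) (?m x')) (ys @ [x' i]) - G (mixture s (?m x) (?m x')) (ys @ [x i])\<bar> \<le> e / 2"
      proof (eventually_elim, intro ballI)
        fix x' and s :: real assume close: "\<forall>i\<in>J. dist (x i) (x' i) < \<delta> / 2" and "s \<in> {0..1}"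
        then have s: "0 \<le> s" "s \<le> 1" by auto
        let ?x = "mixture s (?m x) (?m x')"
        have W: "W2 (?m x) ?x \<le> \<delta> / 2"
          using close \<delta>(1) by (intro W2_partial_empirical_mixture_le J \<mu>2 s) (auto intro: less_imp_le)
        have near: "\<bar>G ?x (ys @ [w]) - G (?m x) (ys @ [x i])\<bar> < e / 4" if "dist (x i) w < \<delta>" for w
          using that W \<delta>(1) ys
          by (intro \<delta>(2) P4_subset_P2 mixture_finite_moment s P) (auto simp: nth_append less_Suc_eq)
        have "dist (x i) (x' i) < \<delta>" using close i \<delta>(1) by fastforce
        have "\<bar>a - b\<bar> \<le> e / 2" if "\<bar>a - c\<bar> < e / 4" "\<bar>b - c\<bar> < e / 4" for a b c :: real
          using that by linarith
        from this[OF near[OF \<open>dist (x i) (x' i) < \<delta>\<close>] near[of "x i"]] \<delta>(1)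
        show "\<bar>G ?x (ys @ [x' i]) - G ?x (ys @ [x i])\<bar> \<le> e / 2" by simp
      qed
    qed
    then show "\<forall>\<^sub>F x' in nhds x. dist (F (?m x') ys) (F (?m x) ys) < e"
    proof eventually_elim
      case (elim x')
      have "\<bar>F (?m x') ys - F (?m x) ys\<bar> \<le> e / 2"
        unfolding lfd_increment[OF lfd P4_subset_P2[OF P] P4_subset_P2[OF P] ys]
      proof (rule abs_integral_unit_interval_le)
        fix s :: real assume s: "0 \<le> s" "s \<le> 1"
        let ?x = "mixture s (?m x) (?m x')"
        note mx = mixture_finite_moment[OF s P P]
        note gm = lfd_derivative_measurable[OF lfd P4_subset_P2[OF mx] ys]
        note * = integral_partial_empirical(2)[OF J finite_moment_measuresD(2)[OF \<mu>] gm
            integral_derivative_le(1)[OF lfd G mx \<mu> ys]]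
        have "(\<integral>y. G ?x (ys @ [y]) \<partial>?m x') - (\<integral>y. G ?x (ys @ [y]) \<partial>?m x)
            = (\<Sum>i\<in>J. G ?x (ys @ [x' i]) - G ?x (ys @ [x i])) / n"
          unfolding * by (simp add: sum_subtractf diff_divide_distrib)
        also have "\<bar>\<dots>\<bar> \<le> (\<Sum>i\<in>J. e / 2) / n"
        proof -
          have "\<bar>\<Sum>i\<in>J. G ?x (ys @ [x' i]) - G ?x (ys @ [x i])\<bar> \<le> (\<Sum>i\<in>J. \<bar>G ?x (ys @ [x' i]) - G ?x (ys @ [x i])\<bar>)"
            by (rule sum_abs)
          also have "\<dots> \<le> (\<Sum>i\<in>J. e / 2)"
            using elim s by (intro sum_mono) simp
          finally show ?thesis
            unfolding abs_divide abs_of_nat by (rule divide_right_mono) simp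
        qed
        also have "\<dots> \<le> e / 2"
          using J e by (simp add: field_simps)
        finally show "\<bar>(\<integral>y. G ?x (ys @ [y]) \<partial>?m x') - (\<integral>y. G ?x (ys @ [y]) \<partial>?m x)\<bar> \<le> e / 2" .
      qed
      then show ?case using e by (simp add: dist_real_def)
    qed
  qed
  then show "continuous_on UNIV (\<lambda>x. F (?m x) ys)"
    unfolding continuous_on_def using tendsto_mono[OF at_within_le_nhds] by blast
qed

section \<open>Approximate martingales along an i.i.d. sample\<close>

lemma square_integrable_bound:
  fixes f g :: "'b \<Rightarrow> real"
  assumes f: "f \<in> borel_measurable M" and g: "integrable M g" and le: "\<And>x. (f x)\<^sup>2 \<le> g x"
  shows "integrable M (\<lambda>x. (f x)\<^sup>2)"
proof (rule Bochner_Integration.integrable_bound[OF g])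
  show "(\<lambda>x. (f x)\<^sup>2) \<in> borel_measurable M" using f by simp
  have "norm ((f x)\<^sup>2) \<le> norm (g x)" for x using le[of x] by simp
  then show "AE x in M. norm ((f x)\<^sup>2) \<le> norm (g x)" by simp
qed

lemma power2_add_le: "(a + b)\<^sup>2 \<le> 2 * a\<^sup>2 + 2 * b\<^sup>2" for a b :: real
  using zero_le_power2[of "a - b"] by (simp add: power2_sum power2_diff)

lemma square_integrable_mult:
  fixes f g :: "'b \<Rightarrow> real"
  assumes "f \<in> borel_measurable M" "g \<in> borel_measurable M"
    and "integrable M (\<lambda>x. (f x)\<^sup>2)" "integrable M (\<lambda>x. (g x)\<^sup>2)"
  shows "integrable M (\<lambda>x. f x * g x)"
proof (rule Bochner_Integration.integrable_bound)
  show "integrable M (\<lambda>x. (f x)\<^sup>2 + (g x)\<^sup>2)" using assms by simp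
  show "(\<lambda>x. f x * g x) \<in> borel_measurable M" using assms by simp
  have "\<bar>a * b\<bar> \<le> \<bar>a\<^sup>2 + b\<^sup>2\<bar>" for a b :: real
  proof -
    have "0 \<le> (\<bar>a\<bar> - \<bar>b\<bar>)\<^sup>2" "0 \<le> \<bar>a\<bar>\<^sup>2" "0 \<le> \<bar>b\<bar>\<^sup>2" by simp_all
    then have "\<bar>a\<bar> * \<bar>b\<bar> \<le> \<bar>a\<bar>\<^sup>2 + \<bar>b\<bar>\<^sup>2" unfolding power2_diff by linarith
    then show ?thesis by (simp add: abs_mult)
  qed
  then show "AE x in M. norm (f x * g x) \<le> norm ((f x)\<^sup>2 + (g x)\<^sup>2)" by simp
qed

lemma (in prob_space) square_expectation_le:
  fixes f :: "'a \<Rightarrow> real"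
  assumes "f \<in> borel_measurable M" "integrable M (\<lambda>x. (f x)\<^sup>2)"
  shows "(expectation f)\<^sup>2 \<le> expectation (\<lambda>x. (f x)\<^sup>2)"
proof -
  have "integrable M f" by (rule square_integrable_imp_integrable[OF assms])
  then have "0 \<le> expectation (\<lambda>x. (f x)\<^sup>2) - (expectation f)\<^sup>2"
    using variance_eq[of f] assms variance_positive[of f] by simp
  then show ?thesis by simp
qed

text \<open>The sample restricted to the indices in \<open>J\<close>, with \<open>0\<close> elsewhere so that it stays in the fixed
space \<open>nat \<Rightarrow> 'a\<close>, whose Borel sets are the product ones.\<close>

definition coordinates_in :: "nat set \<Rightarrow> (nat \<Rightarrow> 'a::zero) \<Rightarrow> nat \<Rightarrow> 'a" where
  "coordinates_in J x = (\<lambda>i. if i \<in> J then x i else 0)"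

lemma coordinates_in_measurable:
  "coordinates_in A \<in> measurable (PiM A (\<lambda>_. borel))
     (borel :: (nat \<Rightarrow> 'a::{second_countable_topology, zero}) measure)"
proof (rule measurable_coordinatewise_then_product)
  fix i show "(\<lambda>f. coordinates_in A f i) \<in> measurable (PiM A (\<lambda>_. borel)) (borel :: 'a measure)"
    by (cases "i \<in> A") (simp_all add: coordinates_in_def)
qed

text \<open>The part of the sample that enters one empirical measure.\<close>

locale iid_family = prob_space P for P :: "'w measure" +
  fixes \<mu> :: "'a::euclidean_space measure" and I :: "nat set" and X :: "nat \<Rightarrow> 'w \<Rightarrow> 'a"
  assumes fin: "finite I" and law: "\<And>i. i \<in> I \<Longrightarrow> distr P borel (X i) = \<mu>"
    and indep: "indep_vars (\<lambda>_. borel) X I"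
    and moment: "\<mu> \<in> finite_moment_measures 8"
begin

sublocale law: prob_space \<mu> by (rule finite_moment_measuresD(1)[OF moment])

lemmas sets_law = finite_moment_measuresD(2)[OF moment]

lemma sample_measurable: "i \<in> I \<Longrightarrow> X i \<in> borel_measurable P"
  using indep by (auto simp: indep_vars_def)

definition past :: "nat set \<Rightarrow> 'w \<Rightarrow> nat \<Rightarrow> 'a" where
  "past J \<omega> = coordinates_in J (\<lambda>i. X i \<omega>)"

lemma past_measurable:
  assumes "J \<subseteq> I"
  shows "past J \<in> measurable P borel"
proof (rule measurable_coordinatewise_then_product)
  fix i show "(\<lambda>\<omega>. past J \<omega> i) \<in> borel_measurable P"
    using assms sample_measurable[of i] by (cases "i \<in> J") (auto simp: past_def coordinates_in_def)
qed

text \<open>The predicate \<open>indep_var\<close> relates variables with the same range, so \<open>X j\<close> is first read as a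
coordinate of \<open>past {j}\<close>.\<close>

lemma distr_past_sample:
  assumes J: "J \<subseteq> I" and j: "j \<in> I" "j \<notin> J"
  shows "distr P (borel \<Otimes>\<^sub>M borel) (\<lambda>\<omega>. (past J \<omega>, X j \<omega>)) = distr P borel (past J) \<Otimes>\<^sub>M \<mu>"
proof -
  have past: "coordinates_in A \<circ> (\<lambda>\<omega>. restrict (\<lambda>i. X i \<omega>) A) = past A" for A
    by (auto simp: past_def coordinates_in_def fun_eq_iff)
  have "indep_var (PiM J (\<lambda>_. borel)) (\<lambda>\<omega>. restrict (\<lambda>i. X i \<omega>) J) (PiM {j} (\<lambda>_. borel)) (\<lambda>\<omega>. restrict (\<lambda>i. X i \<omega>) {j})"
    using J j by (intro indep_var_restrict[OF indep]) auto
  from indep_var_compose[OF this coordinates_in_measurable coordinates_in_measurable] have "indep_var borel (past J) borel (past {j})"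
    unfolding past .
  then have eq: "distr P borel (past J) \<Otimes>\<^sub>M distr P borel (past {j})
      = distr P (borel \<Otimes>\<^sub>M borel) (\<lambda>\<omega>. (past J \<omega>, past {j} \<omega>))"
    unfolding indep_var_distribution_eq by blast
  have pm: "past J \<in> measurable P borel" "past {j} \<in> measurable P borel"
    using past_measurable J j by auto
  have ev: "(\<lambda>x. x j) \<in> measurable (borel :: (nat \<Rightarrow> 'a) measure) borel"
    by (rule borel_measurable_continuous_onI[OF continuous_on_product_coordinates])
  have Xj: "distr (distr P borel (past {j})) borel (\<lambda>x. x j) = \<mu>"
    unfolding law[OF j(1), symmetric] using ev pm
    by (subst distr_distr) (auto simp: comp_def past_def coordinates_in_def)
  have "distr P borel (past J) \<Otimes>\<^sub>M \<mu>
      = distr (distr P borel (past J)) borel (\<lambda>x. x) \<Otimes>\<^sub>M distr (distr P borel (past {j})) borel (\<lambda>x. x j)"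
    unfolding Xj by (subst distr_id2) auto
  also have "\<dots> = distr (distr P borel (past J) \<Otimes>\<^sub>M distr P borel (past {j})) (borel \<Otimes>\<^sub>M borel) (\<lambda>(x, z). (x, z j))"
  proof (rule pair_measure_distr)
    show "sigma_finite_measure (distr (distr P borel (past {j})) borel (\<lambda>x. x j))"
      unfolding Xj by unfold_locales
  qed (use ev in auto)
  also have "\<dots> = distr P (borel \<Otimes>\<^sub>M borel) (\<lambda>\<omega>. (past J \<omega>, X j \<omega>))"
    unfolding eq
  proof (subst distr_distr)
    have "(\<lambda>z. z j) \<circ> snd \<in> measurable (borel \<Otimes>\<^sub>M borel) (borel :: 'a measure)"
      by (rule measurable_comp[OF measurable_snd ev])
    from measurable_Pair[OF measurable_fst this] show "(\<lambda>(x, z). (x, z j)) \<in> measurable (borel \<Otimes>\<^sub>M borel) ((borel :: (nat \<Rightarrow> 'a) measure) \<Otimes>\<^sub>M (borel :: 'a measure))"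
      by (simp add: case_prod_beta' comp_def)
    show "(\<lambda>\<omega>. (past J \<omega>, past {j} \<omega>)) \<in> measurable P (borel \<Otimes>\<^sub>M borel)"
      using pm by (rule measurable_Pair)
  qed (simp add: comp_def past_def coordinates_in_def)
  finally show ?thesis by (rule sym)
qed

lemma pair_law_measurable:
  fixes \<nu> :: "(nat \<Rightarrow> 'a) measure"
  assumes "sets \<nu> = sets borel" "g \<in> measurable (borel \<Otimes>\<^sub>M borel) N"
  shows "g \<in> measurable (\<nu> \<Otimes>\<^sub>M \<mu>) N"
  unfolding measurable_cong_sets[OF sets_pair_measure_cong[OF assms(1) sets_law] refl] by (rule assms)

lemma nn_expectation_past_sample:
  assumes J: "J \<subseteq> I" and j: "j \<in> I" "j \<notin> J" and g: "g \<in> borel_measurable (borel \<Otimes>\<^sub>M borel)"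
  shows "(\<integral>\<^sup>+\<omega>. g (past J \<omega>, X j \<omega>) \<partial>P) = (\<integral>\<^sup>+\<omega>. \<integral>\<^sup>+y. g (past J \<omega>, y) \<partial>\<mu> \<partial>P)"
proof -
  have g': "g \<in> borel_measurable (distr P borel (past J) \<Otimes>\<^sub>M \<mu>)" "g \<in> borel_measurable (borel \<Otimes>\<^sub>M \<mu>)"
    by (rule pair_law_measurable[OF _ g]; simp)+
  have m: "(\<lambda>\<omega>. (past J \<omega>, X j \<omega>)) \<in> measurable P (borel \<Otimes>\<^sub>M borel)"
    using past_measurable[OF J] sample_measurable[OF j(1)] by (rule measurable_Pair)
  have "(\<integral>\<^sup>+\<omega>. g (past J \<omega>, X j \<omega>) \<partial>P) = (\<integral>\<^sup>+z. g z \<partial>(distr P borel (past J) \<Otimes>\<^sub>M \<mu>))"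
    unfolding distr_past_sample[OF J j, symmetric] by (rule nn_integral_distr[OF m, symmetric]) (simp add: g)
  also have "\<dots> = (\<integral>\<^sup>+x. \<integral>\<^sup>+y. g (x, y) \<partial>\<mu> \<partial>distr P borel (past J))"
    by (rule law.nn_integral_fst[OF g'(1), symmetric])
  also have "\<dots> = (\<integral>\<^sup>+\<omega>. \<integral>\<^sup>+y. g (past J \<omega>, y) \<partial>\<mu> \<partial>P)"
    by (rule nn_integral_distr[OF past_measurable[OF J]])
      (simp add: law.borel_measurable_nn_integral_fst[OF g'(2)])
  finally show ?thesis .
qed

lemma expectation_past_sample:
  fixes g :: "(nat \<Rightarrow> 'a) \<times> 'a \<Rightarrow> real"
  assumes J: "J \<subseteq> I" and j: "j \<in> I" "j \<notin> J" and g: "g \<in> borel_measurable (borel \<Otimes>\<^sub>M borel)"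
    and i: "integrable P (\<lambda>\<omega>. g (past J \<omega>, X j \<omega>))"
  shows "expectation (\<lambda>\<omega>. g (past J \<omega>, X j \<omega>)) = expectation (\<lambda>\<omega>. \<integral>y. g (past J \<omega>, y) \<partial>\<mu>)"
proof -
  have m: "(\<lambda>\<omega>. (past J \<omega>, X j \<omega>)) \<in> measurable P (borel \<Otimes>\<^sub>M borel)"
    using past_measurable[OF J] sample_measurable[OF j(1)] by (rule measurable_Pair)
  interpret past: prob_space "distr P borel (past J)"
    by (rule prob_space_distr[OF past_measurable[OF J]])
  interpret pair: pair_sigma_finite "distr P borel (past J)" \<mu> ..
  have i': "integrable (distr P borel (past J) \<Otimes>\<^sub>M \<mu>) g"
    unfolding distr_past_sample[OF J j, symmetric] using i by (simp add: integrable_distr_eq[OF m] g)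
  have g': "(\<lambda>(x, y). g (x, y)) \<in> borel_measurable (borel \<Otimes>\<^sub>M \<mu>)"
    using pair_law_measurable[OF refl g] by simp
  have "expectation (\<lambda>\<omega>. g (past J \<omega>, X j \<omega>)) = (\<integral>z. g z \<partial>(distr P borel (past J) \<Otimes>\<^sub>M \<mu>))"
    unfolding distr_past_sample[OF J j, symmetric] by (rule integral_distr[OF m, symmetric]) (simp add: g)
  also have "\<dots> = (\<integral>x. \<integral>y. g (x, y) \<partial>\<mu> \<partial>distr P borel (past J))"
    by (rule pair.integral_fst'[OF i', symmetric])
  also have "\<dots> = expectation (\<lambda>\<omega>. \<integral>y. g (past J \<omega>, y) \<partial>\<mu>)"
    by (rule integral_distr[OF past_measurable[OF J]])
      (rule law.borel_measurable_lebesgue_integral[OF g'])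
  finally show ?thesis .
qed

text \<open>One step from \<open>S\<close> to \<open>S' = S + \<xi> + r\<close>, where \<open>\<xi>\<close> is \<open>1/N\<close> times \<open>K (past J) (X j)\<close> centred given
the past, hence orthogonal to \<open>S\<close>, and \<open>\<bar>r\<bar> \<le> B Q\<close>. The product \<open>S r\<close> has no cancellation; it is
split so that \<open>S\<^sup>2\<close> receives the factor \<open>1/N\<close>, which is harmless over \<open>N\<close> steps.\<close>

lemma approximate_martingale_step:
  assumes J: "J \<subseteq> I" and j: "j \<in> I" "j \<notin> J" and N: "0 < (N::real)"
    and s: "s \<in> borel_measurable borel" and K: "(\<lambda>(x, y). K x y) \<in> borel_measurable (borel \<Otimes>\<^sub>M borel)"
    and sq: "\<And>x. integrable \<mu> (\<lambda>y. (K x y)\<^sup>2)"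
    and \<kappa>: "(\<integral>\<^sup>+\<omega>. ennreal ((K (past J \<omega>) (X j \<omega>))\<^sup>2) \<partial>P) \<le> ennreal \<kappa>" "0 \<le> \<kappa>"
    and S: "integrable P (\<lambda>\<omega>. (s (past J \<omega>))\<^sup>2)"
    and Q: "integrable P (\<lambda>\<omega>. (Q \<omega>)\<^sup>2)"
    and S': "S' \<in> borel_measurable P"
      "\<And>\<omega>. \<bar>S' \<omega> - s (past J \<omega>) - 1 / N * (K (past J \<omega>) (X j \<omega>) - (\<integral>y. K (past J \<omega>) y \<partial>\<mu>))\<bar> \<le> B * Q \<omega>"
  shows "integrable P (\<lambda>\<omega>. (S' \<omega>)\<^sup>2)"
    and "expectation (\<lambda>\<omega>. (S' \<omega>)\<^sup>2) \<le> (1 + 1 / N) * expectation (\<lambda>\<omega>. (s (past J \<omega>))\<^sup>2)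
           + (8 * \<kappa> / N\<^sup>2 + (2 + N) * B\<^sup>2 * expectation (\<lambda>\<omega>. (Q \<omega>)\<^sup>2))"
proof -
  define S where "S \<omega> = s (past J \<omega>)" for \<omega>
  define k where "k \<omega> = K (past J \<omega>) (X j \<omega>)" for \<omega>
  define c where "c x = (\<integral>y. K x y \<partial>\<mu>)" for x
  define \<xi> where "\<xi> \<omega> = 1 / N * (k \<omega> - c (past J \<omega>))" for \<omega>
  define r where "r \<omega> = S' \<omega> - S \<omega> - \<xi> \<omega>" for \<omega>
  note pm = past_measurable[OF J]
  have pX: "(\<lambda>\<omega>. (past J \<omega>, X j \<omega>)) \<in> measurable P (borel \<Otimes>\<^sub>M borel)"
    using pm sample_measurable[OF j(1)] by (rule measurable_Pair)
  have K': "(\<lambda>(x, y). K x y) \<in> borel_measurable (borel \<Otimes>\<^sub>M \<mu>)"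
    by (rule pair_law_measurable[OF refl K])
  have cm: "c \<in> borel_measurable borel"
    unfolding c_def by (rule law.borel_measurable_lebesgue_integral[OF K'])
  have Sm: "S \<in> borel_measurable P" unfolding S_def by (rule measurable_compose[OF pm s])
  have km: "k \<in> borel_measurable P"
    using measurable_compose[OF pX K] unfolding k_def by simp
  have cpm: "(\<lambda>\<omega>. c (past J \<omega>)) \<in> borel_measurable P" by (rule measurable_compose[OF pm cm])
  have Ky: "K x \<in> borel_measurable \<mu>" for x
    using measurable_Pair2[OF K', of x] by simp
  have K2m: "(\<lambda>z. ennreal ((case z of (x, y) \<Rightarrow> K x y)\<^sup>2)) \<in> borel_measurable (borel \<Otimes>\<^sub>M borel)"
    using K by simp
  have c2: "(c x)\<^sup>2 \<le> (\<integral>y. (K x y)\<^sup>2 \<partial>\<mu>)" for x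
    unfolding c_def by (rule law.square_expectation_le[OF Ky sq])
  have bounded: "integrable P (\<lambda>\<omega>. (f \<omega>)\<^sup>2)" "expectation (\<lambda>\<omega>. (f \<omega>)\<^sup>2) \<le> \<kappa>"
    if f: "f \<in> borel_measurable P" "(\<integral>\<^sup>+\<omega>. ennreal ((f \<omega>)\<^sup>2) \<partial>P) \<le> ennreal \<kappa>" for f
  proof -
    show "integrable P (\<lambda>\<omega>. (f \<omega>)\<^sup>2)"
      using f by (intro integrableI_bounded) (auto simp: le_less_trans)
    show "expectation (\<lambda>\<omega>. (f \<omega>)\<^sup>2) \<le> \<kappa>"
      using f \<kappa>(2) by (intro integral_real_bounded) auto
  qed
  note k2 = bounded[OF km \<kappa>(1)[folded k_def]]
  have "(\<integral>\<^sup>+\<omega>. ennreal ((c (past J \<omega>))\<^sup>2) \<partial>P) \<le> (\<integral>\<^sup>+\<omega>. \<integral>\<^sup>+y. ennreal ((K (past J \<omega>) y)\<^sup>2) \<partial>\<mu> \<partial>P)"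
    using c2 sq by (intro nn_integral_mono) (simp add: nn_integral_eq_integral)
  also have "\<dots> = (\<integral>\<^sup>+\<omega>. ennreal ((K (past J \<omega>) (X j \<omega>))\<^sup>2) \<partial>P)"
    using nn_expectation_past_sample[OF J j K2m] by simp
  finally have "(\<integral>\<^sup>+\<omega>. ennreal ((c (past J \<omega>))\<^sup>2) \<partial>P) \<le> ennreal \<kappa>"
    using \<kappa>(1) by (rule order_trans)
  note cc2 = bounded[OF cpm this]
  have S2: "integrable P (\<lambda>\<omega>. (S \<omega>)\<^sup>2)" using S by (simp add: S_def)
  have iSk: "integrable P (\<lambda>\<omega>. S \<omega> * k \<omega>)" by (rule square_integrable_mult[OF Sm km S2 k2(1)])
  have iSc: "integrable P (\<lambda>\<omega>. S \<omega> * c (past J \<omega>))" by (rule square_integrable_mult[OF Sm cpm S2 cc2(1)])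
  have "(\<lambda>z. s (fst z) * (case z of (x, y) \<Rightarrow> K x y)) \<in> borel_measurable (borel \<Otimes>\<^sub>M borel)"
    using K measurable_compose[OF measurable_fst s] by (intro borel_measurable_times) auto
  from expectation_past_sample[OF J j this]
  have "expectation (\<lambda>\<omega>. S \<omega> * k \<omega>) = expectation (\<lambda>\<omega>. S \<omega> * c (past J \<omega>))"
    using iSk by (simp add: S_def k_def c_def)
  moreover have \<xi>S: "S \<omega> * \<xi> \<omega> = 1 / N * (S \<omega> * k \<omega> - S \<omega> * c (past J \<omega>))" for \<omega>
    unfolding \<xi>_def by (simp add: algebra_simps)
  ultimately have orth: "integrable P (\<lambda>\<omega>. S \<omega> * \<xi> \<omega>)" "expectation (\<lambda>\<omega>. S \<omega> * \<xi> \<omega>) = 0"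
    unfolding \<xi>S using iSk iSc by simp_all
  have \<xi>le: "(\<xi> \<omega>)\<^sup>2 \<le> 2 / N\<^sup>2 * ((k \<omega>)\<^sup>2 + (c (past J \<omega>))\<^sup>2)" for \<omega>
  proof -
    have "(k \<omega> - c (past J \<omega>))\<^sup>2 \<le> 2 * ((k \<omega>)\<^sup>2 + (c (past J \<omega>))\<^sup>2)"
      using power2_add_le[of "k \<omega>" "- c (past J \<omega>)"] by simp
    then have "(k \<omega> - c (past J \<omega>))\<^sup>2 / N\<^sup>2 \<le> 2 * ((k \<omega>)\<^sup>2 + (c (past J \<omega>))\<^sup>2) / N\<^sup>2"
      by (rule divide_right_mono) simp
    then show ?thesis
      by (simp add: \<xi>_def power_divide)
  qed
  have rle: "(r \<omega>)\<^sup>2 \<le> B\<^sup>2 * (Q \<omega>)\<^sup>2" for \<omega>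
  proof -
    have "\<bar>r \<omega>\<bar> \<le> B * Q \<omega>"
      using S'(2)[of \<omega>] by (simp add: r_def S_def \<xi>_def k_def c_def)
    then have "\<bar>r \<omega>\<bar>\<^sup>2 \<le> (B * Q \<omega>)\<^sup>2" by (intro power_mono) auto
    then show ?thesis by (simp add: power_mult_distrib)
  qed
  \<comment> \<open>A pointwise majorant of the square of \<open>S'\<close>; the cross term of \<open>S\<close> and \<open>\<xi>\<close> is kept exactly,
    as its expectation vanishes.\<close>
  define Z where "Z \<omega> = (1 + 1 / N) * (S \<omega>)\<^sup>2 + 2 * (S \<omega> * \<xi> \<omega>)
      + (4 / N\<^sup>2 * ((k \<omega>)\<^sup>2 + (c (past J \<omega>))\<^sup>2) + (2 + N) * B\<^sup>2 * (Q \<omega>)\<^sup>2)" for \<omega>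
  have iZ: "integrable P Z"
    unfolding Z_def
    by (intro Bochner_Integration.integrable_add integrable_mult_right S2 orth k2 cc2 Q)
  have S'Z: "(S' \<omega>)\<^sup>2 \<le> Z \<omega>" for \<omega>
  proof -
    \<comment> \<open>The weights \<open>1/N\<close> and \<open>N\<close> suit a step with \<open>r\<close> smaller than \<open>S\<close> by a factor \<open>1/N\<close>.\<close>
    have "2 * a * b \<le> a\<^sup>2 / N + N * b\<^sup>2" for a b
    proof -
      have "0 \<le> (a - N * b)\<^sup>2 / N" using N by simp
      also have "\<dots> = a\<^sup>2 / N + N * b\<^sup>2 - 2 * a * b"
        using N by (simp add: power2_eq_square field_simps)
      finally show ?thesis by simp
    qed
    from this[of "S \<omega>" "r \<omega>"]
    have 1: "2 * S \<omega> * r \<omega> \<le> (S \<omega>)\<^sup>2 / N + N * (r \<omega>)\<^sup>2" .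
    have 2: "2 * \<xi> \<omega> * r \<omega> \<le> (\<xi> \<omega>)\<^sup>2 + (r \<omega>)\<^sup>2"
      using zero_le_power2[of "\<xi> \<omega> - r \<omega>"] by (simp add: power2_diff)
    have 3: "(S' \<omega>)\<^sup>2 = (S \<omega>)\<^sup>2 + 2 * (S \<omega> * \<xi> \<omega>) + (\<xi> \<omega>)\<^sup>2 + (r \<omega>)\<^sup>2 + 2 * S \<omega> * r \<omega> + 2 * \<xi> \<omega> * r \<omega>"
      unfolding r_def by (simp add: power2_eq_square algebra_simps)
    have 4: "2 * (r \<omega>)\<^sup>2 + N * (r \<omega>)\<^sup>2 \<le> (2 + N) * B\<^sup>2 * (Q \<omega>)\<^sup>2"
      using mult_left_mono[OF rle[of \<omega>], of "2 + N"] N by (simp only: distrib_right mult.assoc)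
    have 5: "2 * (\<xi> \<omega>)\<^sup>2 \<le> 4 / N\<^sup>2 * ((k \<omega>)\<^sup>2 + (c (past J \<omega>))\<^sup>2)"
      using mult_left_mono[OF \<xi>le[of \<omega>], of 2] by simp
    have 6: "(1 + 1 / N) * (S \<omega>)\<^sup>2 = (S \<omega>)\<^sup>2 + (S \<omega>)\<^sup>2 / N" by (simp add: distrib_right)
    show ?thesis
      unfolding Z_def 6 using 1 2 3 4 5 by linarith
  qed
  show i': "integrable P (\<lambda>\<omega>. (S' \<omega>)\<^sup>2)"
    by (rule square_integrable_bound[OF S'(1) iZ S'Z])
  have "expectation (\<lambda>\<omega>. (S' \<omega>)\<^sup>2) \<le> expectation Z"
    by (rule integral_mono[OF i' iZ S'Z])
  also have "\<dots> = (1 + 1 / N) * expectation (\<lambda>\<omega>. (S \<omega>)\<^sup>2)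
      + (4 / N\<^sup>2 * (expectation (\<lambda>\<omega>. (k \<omega>)\<^sup>2) + expectation (\<lambda>\<omega>. (c (past J \<omega>))\<^sup>2))
        + (2 + N) * B\<^sup>2 * expectation (\<lambda>\<omega>. (Q \<omega>)\<^sup>2))"
    unfolding Z_def using S2 orth k2(1) cc2(1) Q by simp
  also have "\<dots> \<le> (1 + 1 / N) * expectation (\<lambda>\<omega>. (S \<omega>)\<^sup>2)
      + (4 / N\<^sup>2 * (\<kappa> + \<kappa>) + (2 + N) * B\<^sup>2 * expectation (\<lambda>\<omega>. (Q \<omega>)\<^sup>2))"
    using k2(2) cc2(2) N by (intro add_mono mult_left_mono order_refl) auto
  finally show "expectation (\<lambda>\<omega>. (S' \<omega>)\<^sup>2) \<le> (1 + 1 / N) * expectation (\<lambda>\<omega>. (s (past J \<omega>))\<^sup>2)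
           + (8 * \<kappa> / N\<^sup>2 + (2 + N) * B\<^sup>2 * expectation (\<lambda>\<omega>. (Q \<omega>)\<^sup>2))"
    unfolding S_def by simp
qed

end

definition eighth_moment :: "'a::euclidean_space measure \<Rightarrow> real" where
  "eighth_moment m = (\<integral>y. norm y ^ 8 \<partial>m)"

lemma eighth_moment_nonneg: "0 \<le> eighth_moment m"
  by (simp add: eighth_moment_def)

context iid_family
begin

lemma moment4: "\<mu> \<in> P4"
  by (rule finite_moment_measures_mono[OF moment]) simp

lemma partial_empirical_coordinates_in:
  "partial_empirical \<nu> n J (coordinates_in J x) = partial_empirical \<nu> n J x"
  by (rule partial_empirical_cong) (simp add: coordinates_in_def)

lemma partial_empirical_past: "partial_empirical \<nu> n J (past J \<omega>) = partial_empirical \<nu> n J (\<lambda>i. X i \<omega>)"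
  unfolding past_def by (rule partial_empirical_coordinates_in)

lemma card_subsample:
  assumes "I \<noteq> {}" "J \<subseteq> I"
  shows "finite J" "card J \<le> card I" "0 < card I" "j \<in> I \<Longrightarrow> j \<notin> J \<Longrightarrow> card J < card I"
proof -
  show "finite J" "card J \<le> card I" "0 < card I"
    using assms fin by (auto simp: card_mono card_gt_0_iff dest: finite_subset)
  assume "j \<in> I" "j \<notin> J"
  then show "card J < card I" using assms fin by (intro psubset_card_mono) auto
qed

lemma expectation_sample_norm_power:
  assumes "i \<in> I"
  shows "integrable P (\<lambda>\<omega>. norm (X i \<omega>) ^ 8)" "expectation (\<lambda>\<omega>. norm (X i \<omega>) ^ 8) = eighth_moment \<mu>"
proof -
  have "integrable (distr P borel (X i)) (\<lambda>y. norm y ^ 8)"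
    unfolding law[OF assms] by (rule finite_moment_measuresD(4)[OF moment])
  then show "integrable P (\<lambda>\<omega>. norm (X i \<omega>) ^ 8)"
    by (rule integrable_distr[OF sample_measurable[OF assms]])
  show "expectation (\<lambda>\<omega>. norm (X i \<omega>) ^ 8) = eighth_moment \<mu>"
    using integral_distr[OF sample_measurable[OF assms], of "\<lambda>y. norm y ^ 8"]
    unfolding eighth_moment_def law[OF assms] by simp
qed

text \<open>The square of the fourth moment of a probability measure is at most its eighth moment, and the
expected eighth moment of the partially replaced law is that of \<open>\<mu>\<close>.\<close>

lemma expectation_weight_sq:
  assumes J: "J \<subseteq> I" and j: "j \<in> I"
  defines "Q \<equiv> \<lambda>\<omega>. 1 + norm (X j \<omega>) ^ 4 + fourth_moment (partial_empirical \<mu> (card I) J (\<lambda>i. X i \<omega>))"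
  shows "integrable P (\<lambda>\<omega>. (Q \<omega>)\<^sup>2)" "expectation (\<lambda>\<omega>. (Q \<omega>)\<^sup>2) \<le> 3 * (1 + 2 * eighth_moment \<mu>)"
proof -
  let ?n = "card I" and ?R = "eighth_moment \<mu>"
  have c: "finite J" "card J \<le> ?n" "0 < ?n"
    using card_subsample[OF _ J] j by auto
  have Xm: "X i \<in> borel_measurable P" if "i \<in> J \<or> i = j" for i
    using that J j sample_measurable by auto
  define e where "e \<omega> = (1 - card J / ?n) * ?R + (\<Sum>i\<in>J. norm (X i \<omega>) ^ 8) / ?n" for \<omega>
  have ie: "integrable P e" "expectation e = ?R"
  proof -
    have i: "integrable P (\<lambda>\<omega>. norm (X i \<omega>) ^ 8)" "expectation (\<lambda>\<omega>. norm (X i \<omega>) ^ 8) = ?R"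
      if "i \<in> J" for i
      using expectation_sample_norm_power[of i] that J by auto
    show "integrable P e" unfolding e_def using i(1) by simp
    have "expectation e = (1 - card J / ?n) * ?R + (\<Sum>i\<in>J. expectation (\<lambda>\<omega>. norm (X i \<omega>) ^ 8)) / ?n"
      unfolding e_def using i(1) prob_space by simp
    also have "\<dots> = ?R"
      using c by (simp add: i(2) field_simps)
    finally show "expectation e = ?R" .
  qed
  have M: "(fourth_moment (partial_empirical \<mu> ?n J (\<lambda>i. X i \<omega>)))\<^sup>2 \<le> e \<omega>" for \<omega>
  proof -
    let ?m = "partial_empirical \<mu> ?n J (\<lambda>i. X i \<omega>)"
    note m = finite_moment_measuresD[OF partial_empirical_finite_moment[OF c moment, of "\<lambda>i. X i \<omega>"]]
    interpret m: prob_space ?m by (rule m)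
    have "(fourth_moment ?m)\<^sup>2 \<le> m.expectation (\<lambda>y. (norm y ^ 4)\<^sup>2)"
      unfolding fourth_moment_def
    proof (rule m.square_expectation_le)
      show "(\<lambda>y. norm y ^ 4) \<in> borel_measurable ?m"
        unfolding measurable_cong_sets[OF m(2) refl] by simp
      show "integrable ?m (\<lambda>y. (norm y ^ 4)\<^sup>2)" using m(4) by (simp add: power_mult[symmetric])
    qed
    also have "\<dots> = e \<omega>"
      unfolding e_def eighth_moment_def power_mult[symmetric]
      using integral_partial_empirical(2)[OF c sets_law _ finite_moment_measuresD(4)[OF moment], of "\<lambda>i. X i \<omega>"]
      by simp
    finally show ?thesis .
  qed
  define Z where "Z \<omega> = 3 * (1 + norm (X j \<omega>) ^ 8 + e \<omega>)" for \<omega>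
  have iZ: "integrable P Z"
    unfolding Z_def using ie expectation_sample_norm_power(1)[OF j] by simp
  have QZ: "(Q \<omega>)\<^sup>2 \<le> Z \<omega>" for \<omega>
  proof -
    have "(1 + a + b)\<^sup>2 \<le> 3 * (1 + a\<^sup>2 + b\<^sup>2)" for a b :: real
    proof -
      have "0 \<le> (1 - a)\<^sup>2 + (1 - b)\<^sup>2 + (a - b)\<^sup>2" by simp
      then show ?thesis by (simp add: power2_eq_square algebra_simps)
    qed
    from this[of "norm (X j \<omega>) ^ 4" "fourth_moment (partial_empirical \<mu> ?n J (\<lambda>i. X i \<omega>))"] M[of \<omega>]
    show ?thesis unfolding Q_def Z_def by (simp add: power_mult[symmetric])
  qed
  have Qm: "Q \<in> borel_measurable P"
    unfolding Q_def fourth_moment_partial_empirical[OF c moment4] using Xm by simp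
  show iQ: "integrable P (\<lambda>\<omega>. (Q \<omega>)\<^sup>2)"
    by (rule square_integrable_bound[OF Qm iZ QZ])
  have "expectation (\<lambda>\<omega>. (Q \<omega>)\<^sup>2) \<le> expectation Z" by (rule integral_mono[OF iQ iZ QZ])
  also have "\<dots> = 3 * (1 + 2 * ?R)"
    unfolding Z_def using ie expectation_sample_norm_power[OF j] prob_space by simp
  finally show "expectation (\<lambda>\<omega>. (Q \<omega>)\<^sup>2) \<le> 3 * (1 + 2 * ?R)" .
qed

text \<open>Iterating the step gives a discrete Gronwall inequality: \<open>card J\<close> increments, amplified by at most
\<open>(1 + 1/N)\<^sup>N \<le> exp 1 \<le> 3\<close>. The bound \<open>\<kappa>\<close> on the martingale differences counts with \<open>1/N\<close>, while the
remainders count with \<open>1/N\<^sup>2\<close>.\<close>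

lemma approximate_martingale_bound:
  fixes T :: "nat set \<Rightarrow> (nat \<Rightarrow> 'a) \<Rightarrow> real" and K :: "nat set \<Rightarrow> (nat \<Rightarrow> 'a) \<Rightarrow> 'a \<Rightarrow> real"
  assumes T0: "\<And>x. T {} x = 0" and Tm: "\<And>J. J \<subseteq> I \<Longrightarrow> T J \<in> borel_measurable borel"
    and Tl: "\<And>J x. T J (coordinates_in J x) = T J x" and Kl: "\<And>J x. K J (coordinates_in J x) = K J x"
    and Km: "\<And>J. J \<subseteq> I \<Longrightarrow> (\<lambda>(x, y). K J x y) \<in> borel_measurable (borel \<Otimes>\<^sub>M borel)"
    and sq: "\<And>J x. J \<subseteq> I \<Longrightarrow> integrable \<mu> (\<lambda>y. (K J x y)\<^sup>2)"
    and \<kappa>: "\<And>J j. J \<subseteq> I \<Longrightarrow> j \<in> I \<Longrightarrow> j \<notin> J \<Longrightarrow>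
      (\<integral>\<^sup>+\<omega>. ennreal ((K J (\<lambda>i. X i \<omega>) (X j \<omega>))\<^sup>2) \<partial>P) \<le> ennreal \<kappa>" "0 \<le> \<kappa>"
    and step: "\<And>J j x. J \<subseteq> I \<Longrightarrow> j \<in> I \<Longrightarrow> j \<notin> J \<Longrightarrow>
      \<bar>T (insert j J) x - T J x - 1 / card I * (K J x (x j) - (\<integral>y. K J x y \<partial>\<mu>))\<bar>
        \<le> b / (real (card I))\<^sup>2 * (1 + norm (x j) ^ 4 + fourth_moment (partial_empirical \<mu> (card I) J x))"
    and ne: "I \<noteq> {}" and J: "J \<subseteq> I"
  shows "integrable P (\<lambda>\<omega>. (T J (\<lambda>i. X i \<omega>))\<^sup>2) \<and>
    expectation (\<lambda>\<omega>. (T J (\<lambda>i. X i \<omega>))\<^sup>2)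
           \<le> 24 * \<kappa> / card I + 27 * b\<^sup>2 * (1 + 2 * eighth_moment \<mu>) / (real (card I))\<^sup>2"
proof -
  let ?N = "real (card I)" and ?A = "3 * (1 + 2 * eighth_moment \<mu>)"
  define c where "c = 8 * \<kappa> / ?N\<^sup>2 + (2 + ?N) * (b / ?N\<^sup>2)\<^sup>2 * ?A"
  have N: "0 < ?N" "1 \<le> ?N" using ne fin by (auto simp: card_gt_0_iff Suc_le_eq)
  have A: "0 \<le> ?A" using eighth_moment_nonneg[of \<mu>] by simp
  have c0: "0 \<le> c" unfolding c_def using N \<kappa>(2) A eighth_moment_nonneg[of \<mu>]
    by (intro add_nonneg_nonneg mult_nonneg_nonneg) auto
  have TX: "T J (past J \<omega>) = T J (\<lambda>i. X i \<omega>)" "K J (past J \<omega>) = K J (\<lambda>i. X i \<omega>)" for J \<omega>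
    unfolding past_def by (rule Tl Kl)+
  have "finite J" using J fin by (rule finite_subset)
  then have *: "integrable P (\<lambda>\<omega>. (T J (\<lambda>i. X i \<omega>))\<^sup>2) \<and>
      expectation (\<lambda>\<omega>. (T J (\<lambda>i. X i \<omega>))\<^sup>2) \<le> (1 + 1 / ?N) ^ card J * (card J * c)"
    using J
  proof (induction J rule: finite_induct)
    case empty
    show ?case by (simp add: T0)
  next
    case (insert j J)
    then have J: "J \<subseteq> I" and j: "j \<in> I" "j \<notin> J" and iJ: "insert j J \<subseteq> I" by auto
    let ?Q = "\<lambda>\<omega>. 1 + norm (X j \<omega>) ^ 4 + fourth_moment (partial_empirical \<mu> (card I) J (\<lambda>i. X i \<omega>))"
    note Q = expectation_weight_sq[OF J j(1)]
    have IH: "integrable P (\<lambda>\<omega>. (T J (past J \<omega>))\<^sup>2)"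
      "expectation (\<lambda>\<omega>. (T J (past J \<omega>))\<^sup>2) \<le> (1 + 1 / ?N) ^ card J * (card J * c)"
      unfolding TX using insert.IH[OF J] by auto
    have Sm: "(\<lambda>\<omega>. T (insert j J) (\<lambda>i. X i \<omega>)) \<in> borel_measurable P"
      unfolding TX[symmetric] by (rule measurable_compose[OF past_measurable[OF iJ] Tm[OF iJ]])
    have \<kappa>J: "(\<integral>\<^sup>+\<omega>. ennreal ((K J (past J \<omega>) (X j \<omega>))\<^sup>2) \<partial>P) \<le> ennreal \<kappa>"
      unfolding TX by (rule \<kappa>(1)[OF J j])
    have st: "\<bar>T (insert j J) (\<lambda>i. X i \<omega>) - T J (past J \<omega>)
        - 1 / ?N * (K J (past J \<omega>) (X j \<omega>) - (\<integral>y. K J (past J \<omega>) y \<partial>\<mu>))\<bar> \<le> b / ?N\<^sup>2 * ?Q \<omega>" for \<omega>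
      unfolding TX by (rule step[OF J j])
    note one = approximate_martingale_step[OF J j N(1) Tm[OF J] Km[OF J] sq[OF J] \<kappa>J \<kappa>(2) IH(1) Q(1) Sm st]
    have "expectation (\<lambda>\<omega>. (T (insert j J) (\<lambda>i. X i \<omega>))\<^sup>2) \<le> (1 + 1 / ?N) * expectation (\<lambda>\<omega>. (T J (past J \<omega>))\<^sup>2)
           + (8 * \<kappa> / ?N\<^sup>2 + (2 + ?N) * (b / ?N\<^sup>2)\<^sup>2 * expectation (\<lambda>\<omega>. (?Q \<omega>)\<^sup>2))"
      by (rule one(2))
    also have "\<dots> \<le> (1 + 1 / ?N) * ((1 + 1 / ?N) ^ card J * (card J * c)) + c"
      unfolding c_def using N Q(2) IH(2)
      by (intro add_mono mult_left_mono order_refl) (auto simp: c_def)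
    finally have 1: "expectation (\<lambda>\<omega>. (T (insert j J) (\<lambda>i. X i \<omega>))\<^sup>2)
        \<le> (1 + 1 / ?N) * ((1 + 1 / ?N) ^ card J * (card J * c)) + c" .
    have 2: "c \<le> (1 + 1 / ?N) ^ Suc (card J) * c"
      using c0 N mult_right_mono[OF one_le_power[of "1 + 1 / ?N" "Suc (card J)"] c0] by simp
    have 3: "(1 + 1 / ?N) * ((1 + 1 / ?N) ^ card J * (card J * c)) + (1 + 1 / ?N) ^ Suc (card J) * c
        = (1 + 1 / ?N) ^ card (insert j J) * (card (insert j J) * c)"
      using insert.hyps by (simp add: algebra_simps add_divide_distrib)
    show ?case using one(1) order_trans[OF 1 add_left_mono[OF 2]] unfolding 3 by simp
  qed
  have cJ: "real (card J) \<le> ?N" using J fin by (simp add: card_mono)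
  have "(1 + 1 / ?N) ^ card J \<le> exp (1 / ?N) ^ card J"
    using N by (intro power_mono exp_ge_add_one_self) auto
  also have "\<dots> = exp (card J / ?N)" by (simp add: exp_of_nat_mult[symmetric])
  also have "\<dots> \<le> exp 1" using cJ N by simp
  also have "\<dots> \<le> 3" by (rule exp_le)
  finally have "(1 + 1 / ?N) ^ card J * (card J * c) \<le> 3 * (?N * c)"
    using cJ c0 N by (intro mult_mono) auto
  also have "\<dots> = 24 * \<kappa> / ?N + 3 * ((2 + ?N) / ?N) * b\<^sup>2 * ?A / ?N\<^sup>2"
    unfolding c_def using N by (simp add: field_simps power2_eq_square)
  also have "\<dots> \<le> 24 * \<kappa> / ?N + 3 * 3 * b\<^sup>2 * ?A / ?N\<^sup>2"
  proof -
    have "(2 + ?N) / ?N \<le> 3" using N by (simp add: field_simps)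
    then have "3 * ((2 + ?N) / ?N) * (b\<^sup>2 * ?A / ?N\<^sup>2) \<le> 3 * 3 * (b\<^sup>2 * ?A / ?N\<^sup>2)"
      using A by (intro mult_right_mono mult_left_mono) auto
    then show ?thesis by simp
  qed
  also have "\<dots> = 24 * \<kappa> / ?N + 27 * b\<^sup>2 * (1 + 2 * eighth_moment \<mu>) / ?N\<^sup>2"
    by simp
  finally show ?thesis using * by (blast intro: order_trans)
qed

end

section \<open>Rates of convergence in mean square\<close>

lemma quartic_bound_section_sq_integrable:
  assumes lfd: "linear_functional_derivative p F G" and G: "quartic_bound (Suc p) C G"
    and \<mu>: "\<mu> \<in> finite_moment_measures 8" and m: "m \<in> P4" and ys: "length ys = p"
  shows "(\<lambda>y. G m (ys @ [y])) \<in> borel_measurable \<mu>" "integrable \<mu> (\<lambda>y. (G m (ys @ [y]))\<^sup>2)"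
proof -
  note n = finite_moment_measuresD[OF \<mu>]
  interpret prob_space \<mu> by (rule n)
  show gm: "(\<lambda>y. G m (ys @ [y])) \<in> borel_measurable \<mu>"
    unfolding measurable_cong_sets[OF n(2) refl]
    by (rule lfd_derivative_measurable[OF lfd P4_subset_P2[OF m] ys])
  define a where "a = C * (1 + (\<Sum>y\<leftarrow>ys. norm y ^ 4) + fourth_moment m)"
  have i: "integrable \<mu> (\<lambda>y. 2 * a\<^sup>2 + 2 * C\<^sup>2 * norm y ^ 8)" using n by simp
  have "(G m (ys @ [y]))\<^sup>2 \<le> 2 * a\<^sup>2 + 2 * C\<^sup>2 * norm y ^ 8" for y
  proof -
    have "\<bar>G m (ys @ [y])\<bar> \<le> a + C * norm y ^ 4"
      using quartic_bound_last[OF G m ys] by (simp add: a_def)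
    then have "\<bar>G m (ys @ [y])\<bar>\<^sup>2 \<le> (a + C * norm y ^ 4)\<^sup>2" by (intro power_mono) auto
    also have "\<dots> \<le> 2 * a\<^sup>2 + 2 * (C * norm y ^ 4)\<^sup>2"
      by (rule power2_add_le)
    finally show ?thesis by (simp add: power_mult_distrib power_mult[symmetric])
  qed
  then show "integrable \<mu> (\<lambda>y. (G m (ys @ [y]))\<^sup>2)"
    by (rule square_integrable_bound[OF gm i])
qed

context iid_family
begin

text \<open>The martingale differences are those of the derivative \<open>G\<close>, which is merely bounded in mean square:
\<open>\<kappa>\<close> is a constant and the rate is \<open>1/N\<close>. The explicit dependence on \<open>ys\<close> is kept because \<open>ys\<close>
is going to be integrated.\<close>

lemma sample_functional_L2_rate:
  assumes lfd: "linear_functional_derivative p F G" "linear_functional_derivative (Suc p) G H"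
    and GH: "quartic_bound (Suc p) C G" "quartic_bound (Suc (Suc p)) C H" and C: "0 \<le> C"
    and ys: "length ys = p" and ne: "I \<noteq> {}" and J: "J \<subseteq> I"
  defines "R \<equiv> \<lambda>\<omega>. F (partial_empirical \<mu> (card I) J (\<lambda>i. X i \<omega>)) ys - F \<mu> ys"
  shows "integrable P (\<lambda>\<omega>. (R \<omega>)\<^sup>2)"
    and "expectation (\<lambda>\<omega>. (R \<omega>)\<^sup>2) \<le> C\<^sup>2 * (1 + 2 * eighth_moment \<mu>) * (72 + 27648 * (1 + fourth_moment \<mu>)\<^sup>2)
           * (1 + (\<Sum>y\<leftarrow>ys. norm y ^ 4))\<^sup>2 / card I"
proof -
  let ?S = "(\<Sum>y\<leftarrow>ys. norm y ^ 4)" and ?N = "real (card I)" and ?E = "1 + 2 * eighth_moment \<mu>"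
  let ?m = "partial_empirical \<mu> (card I)"
  define T where "T J x = F (?m J x) ys - F \<mu> ys" for J x
  define K where "K J x y = G (?m J x) (ys @ [y])" for J x y
  define \<kappa> where "\<kappa> = (C * (1 + ?S))\<^sup>2 * (3 * ?E)"
  define b where "b = 32 * C * (1 + fourth_moment \<mu>) * (1 + ?S)"
  have E: "0 \<le> ?E" using eighth_moment_nonneg[of \<mu>] by simp
  have N: "1 \<le> ?N" using ne fin by (simp add: Suc_le_eq card_gt_0_iff)
  note card = card_subsample(1-3)[OF ne] and card' = card_subsample(4)[OF ne]
  have P: "?m J x \<in> P4" if "J \<subseteq> I" for J x
    by (rule partial_empirical_finite_moment[OF card[OF that] moment4])
  have T: "integrable P (\<lambda>\<omega>. (T J (\<lambda>i. X i \<omega>))\<^sup>2) \<and>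
    expectation (\<lambda>\<omega>. (T J (\<lambda>i. X i \<omega>))\<^sup>2) \<le> 24 * \<kappa> / ?N + 27 * b\<^sup>2 * ?E / ?N\<^sup>2"
  proof (rule approximate_martingale_bound[where K = K and T = T, OF _ _ _ _ _ _ _ _ _ ne J])
    show "T {} x = 0" for x by (simp add: T_def partial_empirical_empty sets_law)
    show "T J \<in> borel_measurable borel" if "J \<subseteq> I" for J
      unfolding T_def using partial_empirical_functional_measurable[OF card[OF that] moment4 lfd(1) GH(1) ys]
      by simp
    show "T J (coordinates_in J x) = T J x" "K J (coordinates_in J x) = K J x" for J x
      by (simp_all add: T_def K_def partial_empirical_coordinates_in fun_eq_iff)
    show "(\<lambda>(x, y). K J x y) \<in> borel_measurable (borel \<Otimes>\<^sub>M borel)" if "J \<subseteq> I" for J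
      unfolding K_def using lfd(1)
      by (intro partial_empirical_derivative_measurable[OF card[OF that] P4_subset_P2[OF moment4] _ ys])
        (simp add: linear_functional_derivative_def)
    show "integrable \<mu> (\<lambda>y. (K J x y)\<^sup>2)" if "J \<subseteq> I" for J x
      unfolding K_def by (rule quartic_bound_section_sq_integrable[OF lfd(1) GH(1) moment P[OF that] ys])
    show "0 \<le> \<kappa>" using E by (simp add: \<kappa>_def)
    show "(\<integral>\<^sup>+\<omega>. ennreal ((K J (\<lambda>i. X i \<omega>) (X j \<omega>))\<^sup>2) \<partial>P) \<le> ennreal \<kappa>"
      if J: "J \<subseteq> I" and j: "j \<in> I" "j \<notin> J" for J j
    proof -
      define Q where "Q \<omega> = 1 + norm (X j \<omega>) ^ 4 + fourth_moment (?m J (\<lambda>i. X i \<omega>))" for \<omega>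
      note Q = expectation_weight_sq[OF J j(1), folded Q_def]
      have "(K J (\<lambda>i. X i \<omega>) (X j \<omega>))\<^sup>2 \<le> (C * (1 + ?S))\<^sup>2 * (Q \<omega>)\<^sup>2" for \<omega>
      proof -
        have Q0: "0 \<le> norm (X j \<omega>) ^ 4 + fourth_moment (?m J (\<lambda>i. X i \<omega>))"
          by (simp add: fourth_moment_nonneg)
        have "\<bar>K J (\<lambda>i. X i \<omega>) (X j \<omega>)\<bar> \<le> C * (?S + Q \<omega>)"
          using quartic_boundD[OF GH(1) P[OF J, of "\<lambda>i. X i \<omega>"], of "ys @ [X j \<omega>]"] ys
          by (simp add: K_def Q_def algebra_simps)
        also have "\<dots> \<le> C * ((1 + ?S) * Q \<omega>)"
        proof (rule mult_left_mono[OF _ C])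
          have "0 \<le> ?S * (norm (X j \<omega>) ^ 4 + fourth_moment (?m J (\<lambda>i. X i \<omega>)))"
            using Q0 by simp
          then show "?S + Q \<omega> \<le> (1 + ?S) * Q \<omega>" unfolding Q_def by (simp add: algebra_simps)
        qed
        finally have "\<bar>K J (\<lambda>i. X i \<omega>) (X j \<omega>)\<bar>\<^sup>2 \<le> (C * ((1 + ?S) * Q \<omega>))\<^sup>2"
          by (intro power_mono) auto
        then show ?thesis by (simp add: power_mult_distrib mult_ac)
      qed
      then have "(\<integral>\<^sup>+\<omega>. ennreal ((K J (\<lambda>i. X i \<omega>) (X j \<omega>))\<^sup>2) \<partial>P) \<le> (\<integral>\<^sup>+\<omega>. ennreal ((C * (1 + ?S))\<^sup>2 * (Q \<omega>)\<^sup>2) \<partial>P)"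
        by (intro nn_integral_mono ennreal_leI)
      also have "\<dots> = ennreal ((C * (1 + ?S))\<^sup>2 * expectation (\<lambda>\<omega>. (Q \<omega>)\<^sup>2))"
        using Q(1) by (subst nn_integral_eq_integral) auto
      also have "\<dots> \<le> ennreal \<kappa>"
        unfolding \<kappa>_def using Q(2) by (intro ennreal_leI mult_left_mono) auto
      finally show ?thesis .
    qed
    show "\<bar>T (insert j J) x - T J x - 1 / card I * (K J x (x j) - (\<integral>y. K J x y \<partial>\<mu>))\<bar>
        \<le> b / ?N\<^sup>2 * (1 + norm (x j) ^ 4 + fourth_moment (?m J x))"
      if J: "J \<subseteq> I" and j: "j \<in> I" "j \<notin> J" for J j x
      using partial_empirical_second_order[OF lfd GH C card(1)[OF J] card'[OF J j] j(2) moment4 ys]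
      unfolding T_def K_def b_def by simp
  qed
  show "integrable P (\<lambda>\<omega>. (R \<omega>)\<^sup>2)" using conjunct1[OF T] by (simp add: T_def R_def)
  have "expectation (\<lambda>\<omega>. (R \<omega>)\<^sup>2) \<le> 24 * \<kappa> / ?N + 27 * b\<^sup>2 * ?E / ?N\<^sup>2"
    using conjunct2[OF T] by (simp add: T_def R_def)
  also have "27 * b\<^sup>2 * ?E / ?N\<^sup>2 \<le> 27 * b\<^sup>2 * ?E / ?N"
    using N E self_le_power[of ?N 2] by (intro divide_left_mono) (auto intro!: mult_pos_pos)
  finally have "expectation (\<lambda>\<omega>. (R \<omega>)\<^sup>2) \<le> 24 * \<kappa> / ?N + 27 * b\<^sup>2 * ?E / ?N" by simp
  also have "\<dots> = C\<^sup>2 * ?E * (72 + 27648 * (1 + fourth_moment \<mu>)\<^sup>2) * (1 + ?S)\<^sup>2 / ?N"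
    unfolding \<kappa>_def b_def power_mult_distrib add_divide_distrib[symmetric]
    by (rule arg_cong2[where f = "(/)"]) (simp_all add: algebra_simps)
  finally show "expectation (\<lambda>\<omega>. (R \<omega>)\<^sup>2)
      \<le> C\<^sup>2 * ?E * (72 + 27648 * (1 + fourth_moment \<mu>)\<^sup>2) * (1 + ?S)\<^sup>2 / ?N" .
qed

text \<open>After subtraction of the linear part the martingale differences are those of
\<open>G (m, \<cdot>) - G (\<mu>, \<cdot>)\<close>. By the preceding lemma, applied to \<open>G\<close> with its point frozen and then
integrated over that point, they have \<open>\<kappa> = O(1/N)\<close>.\<close>

lemma sample_linearisation_L2_rate:
  assumes lfd: "linear_functional_derivative 0 F G" "linear_functional_derivative (Suc 0) G H"
      "linear_functional_derivative (Suc (Suc 0)) H E"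
    and GH: "quartic_bound (Suc 0) C G" "quartic_bound (Suc (Suc 0)) C H"
      "quartic_bound (Suc (Suc (Suc 0))) C E" and C: "0 \<le> C" and ne: "I \<noteq> {}"
  defines "R \<equiv> \<lambda>\<omega>. F (empirical_measure I (\<lambda>i. X i \<omega>)) [] - F \<mu> []
      - 1 / card I * (\<Sum>i\<in>I. G \<mu> [X i \<omega>] - (\<integral>y. G \<mu> [y] \<partial>\<mu>))"
  shows "integrable P (\<lambda>\<omega>. (R \<omega>)\<^sup>2)"
    and "expectation (\<lambda>\<omega>. (R \<omega>)\<^sup>2)
      \<le> (48 * (C\<^sup>2 * (1 + 2 * eighth_moment \<mu>) * (72 + 27648 * (1 + fourth_moment \<mu>)\<^sup>2)) * (1 + eighth_moment \<mu>)
          + 27648 * C\<^sup>2 * (1 + fourth_moment \<mu>)\<^sup>2 * (1 + 2 * eighth_moment \<mu>)) / (real (card I))\<^sup>2"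
proof -
  let ?N = "real (card I)" and ?E = "1 + 2 * eighth_moment \<mu>"
  let ?m = "partial_empirical \<mu> (card I)"
  define A where "A = C\<^sup>2 * ?E * (72 + 27648 * (1 + fourth_moment \<mu>)\<^sup>2)"
  define c where "c = (\<integral>y. G \<mu> [y] \<partial>\<mu>)"
  define T where "T J x = F (?m J x) [] - F \<mu> [] - 1 / ?N * (\<Sum>i\<in>J. G \<mu> [x i] - c)" for J x
  define K where "K J x y = G (?m J x) [y] - G \<mu> [y]" for J x y
  define \<kappa> where "\<kappa> = A / ?N * (2 * (1 + eighth_moment \<mu>))"
  \<comment> \<open>The constant of the second-order remainder; its square is the origin of \<open>27648 = 27 * 32\<^sup>2\<close>.\<close>
  define b where "b = 32 * C * (1 + fourth_moment \<mu>)"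
  have E: "0 \<le> ?E" using eighth_moment_nonneg[of \<mu>] by simp
  have A: "0 \<le> A" unfolding A_def by (intro mult_nonneg_nonneg E) auto
  have N: "1 \<le> ?N" using ne fin by (simp add: Suc_le_eq card_gt_0_iff)
  note card = card_subsample(1-3)[OF ne] and card' = card_subsample(4)[OF ne]
  have P: "?m J x \<in> P4" if "J \<subseteq> I" for J x
    by (rule partial_empirical_finite_moment[OF card[OF that] moment4])
  have cont: "continuous_P2 (Suc 0) G" using lfd(1) by (simp add: linear_functional_derivative_def)
  have G\<mu>: "(\<lambda>y. G \<mu> [y]) \<in> borel_measurable borel"
    using lfd_derivative_measurable[OF lfd(1) P4_subset_P2[OF moment4], of "[]"] by simp
  have Km: "(\<lambda>(x, y). K J x y) \<in> borel_measurable (borel \<Otimes>\<^sub>M borel)" if "J \<subseteq> I" for J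
  proof -
    have "(\<lambda>(x, y). G (?m J x) ([] @ [y])) \<in> borel_measurable (borel \<Otimes>\<^sub>M borel)"
      by (rule partial_empirical_derivative_measurable[OF card[OF that] P4_subset_P2[OF moment4] cont]) simp
    moreover have "(\<lambda>z :: (nat \<Rightarrow> 'a) \<times> 'a. G \<mu> [snd z]) \<in> borel_measurable (borel \<Otimes>\<^sub>M borel)"
      by (rule measurable_compose[OF measurable_snd G\<mu>])
    ultimately have "(\<lambda>z. (case z of (x, y) \<Rightarrow> G (?m J x) ([] @ [y])) - G \<mu> [snd z]) \<in> borel_measurable (borel \<Otimes>\<^sub>M borel)"
      by (rule borel_measurable_diff)
    then show ?thesis by (simp add: K_def case_prod_beta')
  qed
  have T: "integrable P (\<lambda>\<omega>. (T I (\<lambda>i. X i \<omega>))\<^sup>2) \<and>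
    expectation (\<lambda>\<omega>. (T I (\<lambda>i. X i \<omega>))\<^sup>2) \<le> 24 * \<kappa> / ?N + 27 * b\<^sup>2 * ?E / ?N\<^sup>2"
  proof (rule approximate_martingale_bound[where K = K and T = T, OF _ _ _ _ Km _ _ _ _ ne subset_refl])
    show "T {} x = 0" for x by (simp add: T_def partial_empirical_empty sets_law)
    show "T J \<in> borel_measurable borel" if "J \<subseteq> I" for J
    proof -
      have "(\<lambda>x::nat \<Rightarrow> 'a. G \<mu> [x i]) \<in> borel_measurable borel" for i
        by (rule measurable_compose[OF borel_measurable_continuous_onI[OF continuous_on_product_coordinates] G\<mu>])
      then show ?thesis
        unfolding T_def using partial_empirical_functional_measurable[OF card[OF that] moment4 lfd(1) GH(1), of "[]"]
        by simp
    qed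
    show "T J (coordinates_in J x) = T J x" "K J (coordinates_in J x) = K J x" for J x
      by (simp_all add: T_def K_def partial_empirical_coordinates_in fun_eq_iff) (simp add: coordinates_in_def)
    show "integrable \<mu> (\<lambda>y. (K J x y)\<^sup>2)" if "J \<subseteq> I" for J x
    proof -
      note 1 = quartic_bound_section_sq_integrable[OF lfd(1) GH(1) moment P[OF that, of x] list.size(3)]
      note 2 = quartic_bound_section_sq_integrable[OF lfd(1) GH(1) moment moment4 list.size(3)]
      have "integrable \<mu> (\<lambda>y. G (?m J x) ([] @ [y]) * G \<mu> ([] @ [y]))"
        by (rule square_integrable_mult[OF 1(1) 2(1) 1(2) 2(2)])
      then show ?thesis
        using 1(2) 2(2) by (simp add: K_def power2_diff mult.assoc)
    qed
    show "0 \<le> \<kappa>" using A eighth_moment_nonneg[of \<mu>] by (simp add: \<kappa>_def)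
    show "(\<integral>\<^sup>+\<omega>. ennreal ((K J (\<lambda>i. X i \<omega>) (X j \<omega>))\<^sup>2) \<partial>P) \<le> ennreal \<kappa>"
      if J: "J \<subseteq> I" and j: "j \<in> I" "j \<notin> J" for J j
    proof -
      have Kp: "K J (\<lambda>i. X i \<omega>) = K J (past J \<omega>)" for \<omega>
        by (simp add: K_def partial_empirical_past fun_eq_iff)
      have K2: "(\<lambda>z. ennreal ((case z of (x, y) \<Rightarrow> K J x y)\<^sup>2)) \<in> borel_measurable (borel \<Otimes>\<^sub>M borel)"
        using Km[OF J] by simp
      interpret pair: pair_sigma_finite P \<mu> ..
      have "(\<lambda>z. (past J (fst z), snd z)) \<in> measurable (P \<Otimes>\<^sub>M \<mu>) (borel \<Otimes>\<^sub>M borel)"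
        using measurable_compose[OF measurable_fst past_measurable[OF J]]
          measurable_snd[of P \<mu>, unfolded measurable_cong_sets[OF refl sets_law]]
        by (intro measurable_Pair) auto
      from measurable_compose[OF this K2]
      have K3: "(\<lambda>(\<omega>, y). ennreal ((K J (past J \<omega>) y)\<^sup>2)) \<in> borel_measurable (P \<Otimes>\<^sub>M \<mu>)"
        by (simp add: case_prod_beta')
      have "(\<integral>\<^sup>+\<omega>. ennreal ((K J (\<lambda>i. X i \<omega>) (X j \<omega>))\<^sup>2) \<partial>P) = (\<integral>\<^sup>+\<omega>. \<integral>\<^sup>+y. ennreal ((K J (past J \<omega>) y)\<^sup>2) \<partial>\<mu> \<partial>P)"
        unfolding Kp using nn_expectation_past_sample[OF J j K2] by simp
      \<comment> \<open>The new point is independent of the past, so it can be frozen.\<close>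
      also have "\<dots> = (\<integral>\<^sup>+y. \<integral>\<^sup>+\<omega>. ennreal ((K J (past J \<omega>) y)\<^sup>2) \<partial>P \<partial>\<mu>)"
        using pair.Fubini[OF K3] by simp
      also have "\<dots> \<le> (\<integral>\<^sup>+y. ennreal (A / ?N * (2 * (1 + norm y ^ 8))) \<partial>\<mu>)"
      proof (intro nn_integral_mono)
        fix y
        note L2 = sample_functional_L2_rate[OF lfd(2,3) GH(2,3) C _ ne J, of "[y]"]
        have "(\<integral>\<^sup>+\<omega>. ennreal ((K J (past J \<omega>) y)\<^sup>2) \<partial>P) = ennreal (expectation (\<lambda>\<omega>. (K J (\<lambda>i. X i \<omega>) y)\<^sup>2))"
          unfolding Kp[symmetric] using L2(1) by (subst nn_integral_eq_integral) (auto simp: K_def)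
        also have "\<dots> \<le> ennreal (A * (1 + norm y ^ 4)\<^sup>2 / ?N)"
          using L2(2) by (intro ennreal_leI) (simp add: K_def A_def)
        also have "\<dots> \<le> ennreal (A / ?N * (2 * (1 + norm y ^ 8)))"
        proof (intro ennreal_leI)
          have "(1 + norm y ^ 4)\<^sup>2 \<le> 2 * (1 + norm y ^ 8)"
            using power2_add_le[of 1 "norm y ^ 4"] by (simp add: power_mult[symmetric])
          then have "A / ?N * (1 + norm y ^ 4)\<^sup>2 \<le> A / ?N * (2 * (1 + norm y ^ 8))"
            using A by (intro mult_left_mono) auto
          then show "A * (1 + norm y ^ 4)\<^sup>2 / ?N \<le> A / ?N * (2 * (1 + norm y ^ 8))" by simp
        qed
        finally show "(\<integral>\<^sup>+\<omega>. ennreal ((K J (past J \<omega>) y)\<^sup>2) \<partial>P) \<le> ennreal (A / ?N * (2 * (1 + norm y ^ 8)))" .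
      qed
      also have "\<dots> = ennreal (\<integral>y. A / ?N * (2 * (1 + norm y ^ 8)) \<partial>\<mu>)"
        using finite_moment_measuresD(4)[OF moment] A by (intro nn_integral_eq_integral) auto
      also have "(\<integral>y. A / ?N * (2 * (1 + norm y ^ 8)) \<partial>\<mu>) = \<kappa>"
        using finite_moment_measuresD(4)[OF moment] law.prob_space
        by (simp add: \<kappa>_def eighth_moment_def)
      finally show ?thesis .
    qed
    show "\<bar>T (insert j J) x - T J x - 1 / card I * (K J x (x j) - (\<integral>y. K J x y \<partial>\<mu>))\<bar>
        \<le> b / ?N\<^sup>2 * (1 + norm (x j) ^ 4 + fourth_moment (?m J x))"
      if J: "J \<subseteq> I" and j: "j \<in> I" "j \<notin> J" for J j x
    proof -
      have 1: "T (insert j J) x - T J x = F (?m (insert j J) x) [] - F (?m J x) [] - 1 / ?N * (G \<mu> [x j] - c)"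
        unfolding T_def using card(1)[OF J] j by (simp add: algebra_simps)
      have 2: "(\<integral>y. K J x y \<partial>\<mu>) = (\<integral>y. G (?m J x) [y] \<partial>\<mu>) - c"
        using integral_derivative_le(1)[OF lfd(1) GH(1) P[OF J] moment4, of "[]"]
          integral_derivative_le(1)[OF lfd(1) GH(1) moment4 moment4, of "[]"]
        by (simp add: K_def c_def)
      have "T (insert j J) x - T J x - 1 / card I * (K J x (x j) - (\<integral>y. K J x y \<partial>\<mu>))
          = F (?m (insert j J) x) [] - F (?m J x) [] - 1 / ?N * (G (?m J x) [x j] - (\<integral>y. G (?m J x) [y] \<partial>\<mu>))"
        unfolding 1 2 by (simp add: K_def algebra_simps)
      then show ?thesis
        using partial_empirical_second_order[OF lfd(1,2) GH(1,2) C card(1)[OF J] card'[OF J j] j(2) moment4, of "[]"]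
        unfolding b_def by simp
    qed
  qed
  have R: "R \<omega> = T I (\<lambda>i. X i \<omega>)" for \<omega>
    using partial_empirical_full[OF sets_law card(3)[OF subset_refl]] by (simp add: R_def T_def c_def)
  show "integrable P (\<lambda>\<omega>. (R \<omega>)\<^sup>2)" unfolding R by (rule conjunct1[OF T])
  have "24 * \<kappa> / ?N + 27 * b\<^sup>2 * ?E / ?N\<^sup>2 = (48 * A * (1 + eighth_moment \<mu>)
          + 27648 * C\<^sup>2 * (1 + fourth_moment \<mu>)\<^sup>2 * ?E) / ?N\<^sup>2"
    unfolding \<kappa>_def b_def power_mult_distrib add_divide_distrib
    by (simp add: power2_eq_square algebra_simps add_divide_distrib)
  then show "expectation (\<lambda>\<omega>. (R \<omega>)\<^sup>2) \<le> (48 * (C\<^sup>2 * ?E * (72 + 27648 * (1 + fourth_moment \<mu>)\<^sup>2)) * (1 + eighth_moment \<mu>)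
          + 27648 * C\<^sup>2 * (1 + fourth_moment \<mu>)\<^sup>2 * ?E) / ?N\<^sup>2"
    unfolding R A_def[symmetric] using conjunct2[OF T] by linarith
qed

end

section \<open>Functionals of the empirical measure\<close>

lemma (in prob_space) indep_vars_inj_reindex:
  fixes X :: "'i \<Rightarrow> 'a \<Rightarrow> 'b::topological_space"
  assumes X: "indep_vars (\<lambda>_. borel) X I" and h: "inj_on h L" "h ` L \<subseteq> I"
  shows "indep_vars (\<lambda>_. borel) (\<lambda>k. X (h k)) L"
proof -
  have "disjoint_family_on (\<lambda>k. {h k}) L"
    using h(1) by (auto simp: disjoint_family_on_def inj_on_def)
  then have "indep_vars (\<lambda>k. PiM {h k} (\<lambda>_. borel)) (\<lambda>k \<omega>. restrict (\<lambda>i. X i \<omega>) {h k}) L"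
    using h(2) by (intro indep_vars_restrict[OF X]) auto
  then have "indep_vars (\<lambda>_. borel) (\<lambda>k \<omega>. (\<lambda>f. f (h k)) (restrict (\<lambda>i. X i \<omega>) {h k})) L"
    by (rule indep_vars_compose2) simp
  then show ?thesis by simp
qed

lemma empirical_measure_reindex:
  assumes h: "inj_on h K"
  shows "empirical_measure (h ` K) x = empirical_measure K (\<lambda>k. x (h k))"
proof (rule measure_eqI)
  fix A assume "A \<in> sets (empirical_measure (h ` K) x)"
  then have A: "A \<in> sets borel" by simp
  show "emeasure (empirical_measure (h ` K) x) A = emeasure (empirical_measure K (\<lambda>k. x (h k))) A"
    unfolding emeasure_empirical_measure[OF A] card_image[OF h] sum.reindex[OF h] comp_def ..
qed simp

text \<open>The expectation of \<open>\<Phi> (\<mu>\<^sup>n)\<close> in terms of \<open>\<mu>\<close> and \<open>n\<close> alone, so that samples with different index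
sets and the halves of a sample can be compared.\<close>

definition empirical_expectation :: "('a::euclidean_space measure \<Rightarrow> real) \<Rightarrow> 'a measure \<Rightarrow> nat \<Rightarrow> real" where
  "empirical_expectation \<Phi> \<mu> n = (\<integral>x. \<Phi> (empirical_measure {..<n} x) \<partial>PiM {..<n} (\<lambda>_. \<mu>))"

lemma (in iid_family) expectation_empirical:
  assumes ne: "I \<noteq> {}" and meas: "(\<lambda>x. \<Phi> (empirical_measure {..<card I} x)) \<in> borel_measurable borel"
  shows "expectation (\<lambda>\<omega>. \<Phi> (empirical_measure I (\<lambda>i. X i \<omega>))) = empirical_expectation \<Phi> \<mu> (card I)"
proof -
  let ?K = "{..<card I}"
  obtain h where h: "bij_betw h ?K I" using ex_bij_betw_nat_finite[OF fin] by (auto simp: atLeast0LessThan)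
  then have inj: "inj_on h ?K" and im: "h ` ?K = I" by (auto simp: bij_betw_def)
  have "card I \<noteq> 0" using ne fin by simp
  then have K: "?K \<noteq> {}" by auto
  have Xm: "X (h k) \<in> borel_measurable P" if "k \<in> ?K" for k using that im sample_measurable by auto
  have "indep_vars (\<lambda>_. borel) (\<lambda>k. X (h k)) ?K"
    by (rule indep_vars_inj_reindex[OF indep inj]) (simp add: im)
  then have "distr P (PiM ?K (\<lambda>_. borel)) (\<lambda>\<omega>. \<lambda>k\<in>?K. X (h k) \<omega>) = PiM ?K (\<lambda>k. distr P borel (X (h k)))"
    using indep_vars_iff_distr_eq_PiM'[OF K, where M' = "\<lambda>_. borel" and X = "\<lambda>k. X (h k)"] Xm by blast
  also have "\<dots> = PiM ?K (\<lambda>_. \<mu>)"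
    using im law by (intro PiM_cong) auto
  finally have D: "PiM ?K (\<lambda>_. \<mu>) = distr P (PiM ?K (\<lambda>_. borel)) (\<lambda>\<omega>. \<lambda>k\<in>?K. X (h k) \<omega>)" by simp
  have c: "empirical_measure ?K (coordinates_in ?K x) = empirical_measure ?K x" for x :: "nat \<Rightarrow> 'a"
    by (rule empirical_measure_cong) (simp add: coordinates_in_def)
  have m: "(\<lambda>x. \<Phi> (empirical_measure ?K x)) \<in> borel_measurable (PiM ?K (\<lambda>_. borel))"
    using measurable_compose[OF coordinates_in_measurable[of ?K] meas] by (simp add: c)
  have "empirical_expectation \<Phi> \<mu> (card I) = expectation (\<lambda>\<omega>. \<Phi> (empirical_measure ?K (\<lambda>k\<in>?K. X (h k) \<omega>)))"
    unfolding empirical_expectation_def D using Xm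
    by (intro integral_distr measurable_restrict m) auto
  also have "\<dots> = expectation (\<lambda>\<omega>. \<Phi> (empirical_measure I (\<lambda>i. X i \<omega>)))"
  proof (intro Bochner_Integration.integral_cong refl)
    fix \<omega>
    have "empirical_measure ?K (\<lambda>k\<in>?K. X (h k) \<omega>) = empirical_measure ?K (\<lambda>k. X (h k) \<omega>)"
      by (rule empirical_measure_cong) simp
    then show "\<Phi> (empirical_measure ?K (\<lambda>k\<in>?K. X (h k) \<omega>)) = \<Phi> (empirical_measure I (\<lambda>i. X i \<omega>))"
      using empirical_measure_reindex[OF inj, of "\<lambda>i. X i \<omega>"] by (simp add: im)
  qed
  finally show ?thesis by simp
qed

definition linearisation_error ::
  "('a::euclidean_space measure \<Rightarrow> real) \<Rightarrow> 'a measure \<Rightarrow> ('a \<Rightarrow> real) \<Rightarrow> nat set \<Rightarrow> (nat \<Rightarrow> 'a) \<Rightarrow> real" where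
  "linearisation_error \<Phi> \<mu> g I x =
     \<Phi> (empirical_measure I x) - \<Phi> \<mu> - 1 / card I * (\<Sum>i\<in>I. g (x i) - (\<integral>y. g y \<partial>\<mu>))"

definition linearisation_rate ::
  "'w measure \<Rightarrow> 'a::euclidean_space measure \<Rightarrow> ('a measure \<Rightarrow> real) \<Rightarrow> ('a \<Rightarrow> real) \<Rightarrow> real \<Rightarrow> bool" where
  "linearisation_rate P \<mu> \<Phi> g B \<longleftrightarrow>
     (\<forall>I X. iid_family P \<mu> I X \<longrightarrow> I \<noteq> {} \<longrightarrow>
        integrable P (\<lambda>\<omega>. (linearisation_error \<Phi> \<mu> g I (\<lambda>i. X i \<omega>))\<^sup>2) \<and>
        (\<integral>\<omega>. (linearisation_error \<Phi> \<mu> g I (\<lambda>i. X i \<omega>))\<^sup>2 \<partial>P) \<le> B / (real (card I))\<^sup>2)"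

text \<open>The function \<open>g\<close> is the first derivative at \<open>\<mu>\<close>. From here on the derivatives enter only
through \<open>B\<close>, \<open>g\<close> and the rate.\<close>

lemma class_ML_linearisation:
  fixes \<mu> :: "'a::euclidean_space measure" and \<Phi> :: "'a measure \<Rightarrow> real"
  assumes \<mu>: "\<mu> \<in> finite_moment_measures 8" and \<Phi>: "\<Phi> \<in> class_ML 4"
  obtains B g where "0 \<le> B" "g \<in> borel_measurable borel" "integrable \<mu> (\<lambda>y. (g y)\<^sup>2)"
    and "\<And>I. finite I \<Longrightarrow> I \<noteq> {} \<Longrightarrow> (\<lambda>x. \<Phi> (empirical_measure I x)) \<in> borel_measurable borel"
    and "\<And>P::'w measure. linearisation_rate P \<mu> \<Phi> g B"
proof -
  note \<mu>4 = finite_moment_measures_mono[OF \<mu>, of 4, simplified]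
  note \<mu>2 = P4_subset_P2[OF \<mu>4]
  obtain D where D: "\<forall>m\<in>P2. D 0 m [] = \<Phi> m"
      "\<forall>p<4. linear_functional_derivative p (D p) (D (Suc p))"
      "\<exists>C>0. \<forall>m\<in>P2. \<forall>ys. length ys = 4 \<longrightarrow> \<bar>D 4 m ys\<bar> \<le> C * (\<Sum>y\<leftarrow>ys. norm y ^ 4)"
    using \<Phi> unfolding class_ML_def by blast
  note D0 = bspec[OF D(1)] and lfd = D(2)[rule_format]
  obtain K where K: "0 < K" "\<And>m ys. m \<in> P2 \<Longrightarrow> length ys = 4 \<Longrightarrow> \<bar>D 4 m ys\<bar> \<le> K * (\<Sum>y\<leftarrow>ys. norm y ^ 4)"
    using D(3) by metis
  have "quartic_bound 4 K (D 4)"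
    unfolding quartic_bound_def
  proof (intro ballI allI impI)
    fix m :: "'a measure" and ys :: "'a list"
    assume m: "m \<in> P4" and ys: "length ys = 4"
    show "\<bar>D 4 m ys\<bar> \<le> K * (1 + (\<Sum>y\<leftarrow>ys. norm y ^ 4) + fourth_moment m)"
      by (rule order_trans[OF K(2)[OF P4_subset_P2[OF m] ys]])
        (use K(1) in \<open>auto intro!: mult_left_mono simp: fourth_moment_nonneg add_nonneg_nonneg\<close>)
  qed
  then have "\<exists>C\<ge>0. quartic_bound 4 C (D 4)" using K(1) by (intro exI[of _ K]) auto
  from derivatives_quartic_bound[OF lfd this \<mu>4]
  obtain C where C: "0 \<le> C" "\<And>p. p \<in> {1..4} \<Longrightarrow> quartic_bound p C (D p)" by auto
  have q: "quartic_bound (Suc 0) C (D (Suc 0))" "quartic_bound (Suc (Suc 0)) C (D (Suc (Suc 0)))"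
    "quartic_bound (Suc (Suc (Suc 0))) C (D (Suc (Suc (Suc 0))))"
    by (rule C(2); simp)+
  have l: "linear_functional_derivative 0 (D 0) (D (Suc 0))"
    "linear_functional_derivative (Suc 0) (D (Suc 0)) (D (Suc (Suc 0)))"
    "linear_functional_derivative (Suc (Suc 0)) (D (Suc (Suc 0))) (D (Suc (Suc (Suc 0))))"
    by (rule lfd; simp)+
  define g where "g y = D (Suc 0) \<mu> [y]" for y
  define B where "B = 48 * (C\<^sup>2 * (1 + 2 * eighth_moment \<mu>) * (72 + 27648 * (1 + fourth_moment \<mu>)\<^sup>2)) * (1 + eighth_moment \<mu>)
          + 27648 * C\<^sup>2 * (1 + fourth_moment \<mu>)\<^sup>2 * (1 + 2 * eighth_moment \<mu>)"
  have emp: "\<Phi> (empirical_measure I x) = D 0 (partial_empirical \<mu> (card I) I x) []"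
    if I: "finite I" "I \<noteq> {}" for I x
  proof -
    have c: "0 < card I" using I by (simp add: card_gt_0_iff)
    have "D 0 (partial_empirical \<mu> (card I) I x) [] = \<Phi> (partial_empirical \<mu> (card I) I x)"
      by (rule D0) (rule partial_empirical_finite_moment[OF I(1) order_refl c \<mu>2])
    then show ?thesis
      using partial_empirical_full[OF finite_moment_measuresD(2)[OF \<mu>] c] by simp
  qed
  show ?thesis
  proof (rule that[of B g])
    show "0 \<le> B"
      unfolding B_def using eighth_moment_nonneg[of \<mu>] by (intro add_nonneg_nonneg mult_nonneg_nonneg) auto
    show "g \<in> borel_measurable borel"
      unfolding g_def using lfd_derivative_measurable[OF l(1) \<mu>2, of "[]"] by simp
    show "integrable \<mu> (\<lambda>y. (g y)\<^sup>2)"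
      unfolding g_def using quartic_bound_section_sq_integrable(2)[OF l(1) q(1) \<mu> \<mu>4, of "[]"] by simp
    show "(\<lambda>x. \<Phi> (empirical_measure I x)) \<in> borel_measurable borel" if I: "finite I" "I \<noteq> {}" for I
    proof -
      have "0 < card I" using I by (simp add: card_gt_0_iff)
      from partial_empirical_functional_measurable[OF I(1) order_refl this \<mu>4 l(1) q(1), of "[]"]
      show ?thesis by (simp add: emp[OF I])
    qed
    fix P :: "'w measure"
    show "linearisation_rate P \<mu> \<Phi> g B"
      unfolding linearisation_rate_def
    proof (intro allI impI)
      fix I X assume F: "iid_family P \<mu> I X" and I: "I \<noteq> {}"
      interpret iid_family P \<mu> I X by (rule F)
      have "linearisation_error \<Phi> \<mu> g I (\<lambda>i. X i \<omega>) = D 0 (empirical_measure I (\<lambda>i. X i \<omega>)) [] - D 0 \<mu> []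
        - 1 / card I * (\<Sum>i\<in>I. D (Suc 0) \<mu> [X i \<omega>] - (\<integral>y. D (Suc 0) \<mu> [y] \<partial>\<mu>))" for \<omega>
        unfolding linearisation_error_def g_def
        using emp[OF fin I] D0[OF \<mu>2] partial_empirical_full[OF sets_law, of I "\<lambda>i. X i \<omega>"] fin I
        by (simp add: card_gt_0_iff)
      with sample_linearisation_L2_rate[OF l q C(1) I]
      show "integrable P (\<lambda>\<omega>. (linearisation_error \<Phi> \<mu> g I (\<lambda>i. X i \<omega>))\<^sup>2) \<and>
        (\<integral>\<omega>. (linearisation_error \<Phi> \<mu> g I (\<lambda>i. X i \<omega>))\<^sup>2 \<partial>P) \<le> B / (real (card I))\<^sup>2"
        unfolding B_def by simp
    qed
  qed
qed

section \<open>Antithetic differences\<close>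

text \<open>The contribution of one sample of level \<open>l\<close>. The sizes \<open>2 ^ l div 2\<close> are kept as they stand in
\<open>amlmc_estimator\<close>.\<close>

definition antithetic_term :: "('a::euclidean_space measure \<Rightarrow> real) \<Rightarrow> nat \<Rightarrow> (nat \<Rightarrow> 'a) \<Rightarrow> real" where
  "antithetic_term \<Phi> l x =
     (if l = 0 then \<Phi> (empirical_measure {1..2 ^ 0} x)
      else \<Phi> (empirical_measure {1..2 ^ l} x)
            - 1 / 2 * (\<Phi> (empirical_measure {1..2 ^ l div 2} x)
                       + \<Phi> (empirical_measure {2 ^ l div 2 + 1..2 ^ l} x)))"

lemma amlmc_estimator_eq:
  "amlmc_estimator \<Phi> L M x = (\<Sum>l\<le>L. 1 / real (M l) * (\<Sum>\<theta>=1..M l. antithetic_term \<Phi> l (\<lambda>i. x i l \<theta>)))"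
proof -
  have "{..L} = insert 0 {1..L}" by auto
  then show ?thesis by (simp add: amlmc_estimator_def antithetic_term_def)
qed

lemma antithetic_term_coordinates_in:
  "antithetic_term \<Phi> l (coordinates_in {1..2 ^ l} x) = antithetic_term \<Phi> l x"
proof -
  have "empirical_measure J (coordinates_in {1..2 ^ l} x) = empirical_measure J x" if "J \<subseteq> {1..2 ^ l}" for J
    by (rule empirical_measure_cong) (use that in \<open>auto simp: coordinates_in_def\<close>)
  then show ?thesis by (cases l) (simp_all add: antithetic_term_def)
qed

lemma antithetic_term_measurable:
  assumes "\<And>I. finite I \<Longrightarrow> I \<noteq> {} \<Longrightarrow> (\<lambda>x. \<Phi> (empirical_measure I x)) \<in> borel_measurable borel"
  shows "antithetic_term \<Phi> l \<in> borel_measurable borel"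
proof (cases l)
  case 0
  then show ?thesis using assms[of "{1..1}"] by (simp add: antithetic_term_def[abs_def])
next
  case (Suc k)
  then show ?thesis
    unfolding antithetic_term_def[abs_def]
    using assms[of "{1..2 ^ l}"] assms[of "{1..2 ^ k}"] assms[of "{2 ^ k + 1..2 ^ l}"] by simp
qed

text \<open>The mean of a term of level \<open>l\<close>; these means telescope.\<close>

definition level_mean :: "('a::euclidean_space measure \<Rightarrow> real) \<Rightarrow> 'a measure \<Rightarrow> nat \<Rightarrow> real" where
  "level_mean \<Phi> \<mu> l = (if l = 0 then empirical_expectation \<Phi> \<mu> 1
     else empirical_expectation \<Phi> \<mu> (2 ^ l) - empirical_expectation \<Phi> \<mu> (2 ^ (l - 1)))"

lemma sum_level_mean: "(\<Sum>l\<le>L. level_mean \<Phi> \<mu> l) = empirical_expectation \<Phi> \<mu> (2 ^ L)"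
  by (induction L) (simp_all add: level_mean_def)

lemma (in prob_space) variance_le_second_moment_about:
  fixes f :: "'a \<Rightarrow> real"
  assumes f: "f \<in> borel_measurable M" "integrable M (\<lambda>x. (f x)\<^sup>2)"
  shows "expectation (\<lambda>x. (f x - expectation f)\<^sup>2) \<le> expectation (\<lambda>x. (f x - c)\<^sup>2)"
proof -
  have i: "integrable M f" by (rule square_integrable_imp_integrable[OF f])
  have "expectation (\<lambda>x. (f x - c)\<^sup>2) = expectation (\<lambda>x. (f x)\<^sup>2) - 2 * c * expectation f + c\<^sup>2"
    using i f(2) prob_space by (simp add: power2_diff mult_ac)
  then have "expectation (\<lambda>x. (f x - c)\<^sup>2) - variance f = (expectation f - c)\<^sup>2"
    using variance_eq[OF i f(2)] by (simp add: power2_diff mult_ac)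
  moreover have "0 \<le> (expectation f - c)\<^sup>2" by simp
  ultimately show ?thesis by linarith
qed

lemma iid_family_subset:
  assumes F: "iid_family P \<mu> I X" and J: "J \<subseteq> I"
  shows "iid_family P \<mu> J X"
proof -
  interpret iid_family P \<mu> I X by (rule F)
  show ?thesis
    by unfold_locales (use J fin law indep moment in \<open>auto intro: finite_subset indep_vars_subset\<close>)
qed

context iid_family
begin

text \<open>Here \<open>\<Phi>\<close> inherits its square integrability from the linearisation error and the linear part; the
latter is centred, so the error has the bias of \<open>\<Phi>\<close> as its expectation.\<close>

lemma empirical_functional_square_integrable:
  assumes ne: "I \<noteq> {}" and m: "(\<lambda>x. \<Phi> (empirical_measure I x)) \<in> borel_measurable borel"
    and g: "g \<in> borel_measurable borel" "integrable \<mu> (\<lambda>y. (g y)\<^sup>2)"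
    and R: "integrable P (\<lambda>\<omega>. (linearisation_error \<Phi> \<mu> g I (\<lambda>i. X i \<omega>))\<^sup>2)"
  shows "(\<lambda>\<omega>. \<Phi> (empirical_measure I (\<lambda>i. X i \<omega>))) \<in> borel_measurable P"
    and "(\<lambda>\<omega>. linearisation_error \<Phi> \<mu> g I (\<lambda>i. X i \<omega>)) \<in> borel_measurable P"
    and "integrable P (\<lambda>\<omega>. (\<Phi> (empirical_measure I (\<lambda>i. X i \<omega>)))\<^sup>2)"
    and "expectation (\<lambda>\<omega>. linearisation_error \<Phi> \<mu> g I (\<lambda>i. X i \<omega>))
           = expectation (\<lambda>\<omega>. \<Phi> (empirical_measure I (\<lambda>i. X i \<omega>))) - \<Phi> \<mu>"
proof -
  let ?F = "\<lambda>\<omega>. \<Phi> (empirical_measure I (\<lambda>i. X i \<omega>))"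
  define r where "r \<omega> = linearisation_error \<Phi> \<mu> g I (\<lambda>i. X i \<omega>)" for \<omega>
  define c where "c = (\<integral>y. g y \<partial>\<mu>)"
  have "empirical_measure I (past I \<omega>) = empirical_measure I (\<lambda>i. X i \<omega>)" for \<omega>
    by (rule empirical_measure_cong) (simp add: past_def coordinates_in_def)
  then show Fm: "?F \<in> borel_measurable P"
    using measurable_compose[OF past_measurable[OF subset_refl] m] by simp
  have gX: "(\<lambda>\<omega>. g (X i \<omega>)) \<in> borel_measurable P" if "i \<in> I" for i
    by (rule measurable_compose[OF sample_measurable[OF that] g(1)])
  have g\<mu>: "g \<in> borel_measurable \<mu>" unfolding measurable_cong_sets[OF sets_law refl] by (rule g(1))
  have gi: "integrable \<mu> g" by (rule law.square_integrable_imp_integrable[OF g\<mu> g(2)])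
  have gX2: "integrable P (\<lambda>\<omega>. (g (X i \<omega>))\<^sup>2)" and gX1: "integrable P (\<lambda>\<omega>. g (X i \<omega>))"
    and gXc: "expectation (\<lambda>\<omega>. g (X i \<omega>)) = c" if "i \<in> I" for i
  proof -
    note Xm = sample_measurable[OF that]
    show "integrable P (\<lambda>\<omega>. (g (X i \<omega>))\<^sup>2)"
      using g(2) unfolding law[OF that, symmetric] by (rule integrable_distr[OF Xm])
    show "integrable P (\<lambda>\<omega>. g (X i \<omega>))"
      using gi unfolding law[OF that, symmetric] by (rule integrable_distr[OF Xm])
    show "expectation (\<lambda>\<omega>. g (X i \<omega>)) = c"
      using integral_distr[OF Xm g(1)] unfolding law[OF that] c_def by simp
  qed
  have req: "r \<omega> = ?F \<omega> - \<Phi> \<mu> - 1 / card I * (\<Sum>i\<in>I. g (X i \<omega>) - c)" for \<omega>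
    by (simp add: r_def linearisation_error_def c_def)
  show rm: "(\<lambda>\<omega>. linearisation_error \<Phi> \<mu> g I (\<lambda>i. X i \<omega>)) \<in> borel_measurable P"
    unfolding r_def[symmetric] req using Fm gX by simp
  have r: "integrable P r"
    unfolding r_def[abs_def] by (rule square_integrable_imp_integrable[OF rm R])
  have Feq: "?F \<omega> = r \<omega> + \<Phi> \<mu> + 1 / card I * (\<Sum>i\<in>I. g (X i \<omega>) - c)" for \<omega>
    using req[of \<omega>] by simp
  have "expectation ?F = expectation r + \<Phi> \<mu> + 1 / card I * (\<Sum>i\<in>I. expectation (\<lambda>\<omega>. g (X i \<omega>)) - c)"
    unfolding Feq using r gX1 prob_space by simp
  then show "expectation (\<lambda>\<omega>. linearisation_error \<Phi> \<mu> g I (\<lambda>i. X i \<omega>)) = expectation ?F - \<Phi> \<mu>"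
    unfolding r_def[symmetric] by (simp add: gXc)
  have sq_add: "f \<in> borel_measurable P \<Longrightarrow> h \<in> borel_measurable P \<Longrightarrow> integrable P (\<lambda>\<omega>. (f \<omega>)\<^sup>2) \<Longrightarrow>
      integrable P (\<lambda>\<omega>. (h \<omega>)\<^sup>2) \<Longrightarrow> integrable P (\<lambda>\<omega>. (f \<omega> + h \<omega>)\<^sup>2)" for f h :: "'w \<Rightarrow> real"
    using square_integrable_mult[of f P h] by (simp add: power2_sum mult.assoc)
  have sum2: "integrable P (\<lambda>\<omega>. (\<Sum>i\<in>J. g (X i \<omega>) - c)\<^sup>2)" if "finite J" "J \<subseteq> I" for J
    using that
  proof (induction J rule: finite_induct)
    case (insert i J)
    then have i: "i \<in> I" "J \<subseteq> I" by auto
    have "integrable P (\<lambda>\<omega>. (g (X i \<omega>) - c)\<^sup>2)"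
      using gX2[OF i(1)] gX1[OF i(1)] by (simp add: power2_diff)
    then have "integrable P (\<lambda>\<omega>. ((g (X i \<omega>) - c) + (\<Sum>i\<in>J. g (X i \<omega>) - c))\<^sup>2)"
      using insert.IH[OF i(2)] i gX by (intro sq_add) (auto simp: subset_iff)
    then show ?case using insert.hyps by simp
  qed simp
  have "integrable P (\<lambda>\<omega>. (r \<omega> + (\<Phi> \<mu> + 1 / card I * (\<Sum>i\<in>I. g (X i \<omega>) - c)))\<^sup>2)"
  proof (rule sq_add)
    show "integrable P (\<lambda>\<omega>. (r \<omega>)\<^sup>2)" using R by (simp add: r_def)
    have "integrable P (\<lambda>\<omega>. (1 / card I * (\<Sum>i\<in>I. g (X i \<omega>) - c))\<^sup>2)"
      unfolding power_mult_distrib using sum2[OF fin subset_refl] by simp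
    then show "integrable P (\<lambda>\<omega>. (\<Phi> \<mu> + 1 / card I * (\<Sum>i\<in>I. g (X i \<omega>) - c))\<^sup>2)"
      using gX by (intro sq_add) auto
    show "r \<in> borel_measurable P" using rm by (simp add: r_def[abs_def])
    show "(\<lambda>\<omega>. \<Phi> \<mu> + 1 / card I * (\<Sum>i\<in>I. g (X i \<omega>) - c)) \<in> borel_measurable P" using gX by simp
  qed
  then show "integrable P (\<lambda>\<omega>. (?F \<omega>)\<^sup>2)" unfolding Feq by (simp add: add.assoc)
qed

end

text \<open>The constant and the linear part cancel: the empirical measure of a sample is the average of
those of its halves.\<close>

lemma linearisation_error_antithetic:
  fixes x :: "nat \<Rightarrow> 'a::euclidean_space"
  shows "antithetic_term \<Phi> (Suc k) x = linearisation_error \<Phi> \<mu> g {1..2 ^ Suc k} x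
    - 1 / 2 * (linearisation_error \<Phi> \<mu> g {1..2 ^ k} x + linearisation_error \<Phi> \<mu> g {2 ^ k + 1..2 ^ Suc k} x)"
proof -
  define h where "h i = g (x i) - (\<integral>y. g y \<partial>\<mu>)" for i
  have "{1..2 ^ Suc k} = {1..2 ^ k} \<union> {2 ^ k + 1..2 ^ Suc k :: nat}" by auto
  then have "(\<Sum>i\<in>{1..2 ^ Suc k}. h i) = (\<Sum>i\<in>{1..2 ^ k}. h i) + (\<Sum>i\<in>{2 ^ k + 1..2 ^ Suc k}. h i)"
    by (simp only:) (rule sum.union_disjoint; auto)
  then show ?thesis
    unfolding antithetic_term_def linearisation_error_def h_def[symmetric]
    by (simp add: field_simps)
qed

text \<open>For \<open>l \<ge> 1\<close> the term is a combination of three linearisation errors. At level \<open>0\<close> nothing cancels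
and the variance of the linear part remains, whence the second summand of the constant. The bias of
\<open>\<Phi> (\<mu>\<^sup>n)\<close> for \<open>n = 2 ^ l\<close> is the mean of a linearisation error.\<close>

lemma antithetic_term_moments:
  fixes P :: "'w measure" and \<mu> :: "'a::euclidean_space measure"
  assumes F: "iid_family P \<mu> {1..2 ^ l} X" and B: "0 \<le> B"
    and m: "\<And>I. finite I \<Longrightarrow> I \<noteq> {} \<Longrightarrow> (\<lambda>x. \<Phi> (empirical_measure I x)) \<in> borel_measurable borel"
    and g: "g \<in> borel_measurable borel" "integrable \<mu> (\<lambda>y. (g y)\<^sup>2)"
    and rate: "linearisation_rate P \<mu> \<Phi> g B"
  defines "Y \<equiv> \<lambda>\<omega>. antithetic_term \<Phi> l (\<lambda>i. X i \<omega>)"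
  shows "Y \<in> borel_measurable P" "integrable P (\<lambda>\<omega>. (Y \<omega>)\<^sup>2)" "(\<integral>\<omega>. Y \<omega> \<partial>P) = level_mean \<Phi> \<mu> l"
    "(\<integral>\<omega>. (Y \<omega> - level_mean \<Phi> \<mu> l)\<^sup>2 \<partial>P) \<le> (9 * B + 2 * (\<integral>y. (g y)\<^sup>2 \<partial>\<mu>)) / 4 ^ l"
    "(empirical_expectation \<Phi> \<mu> (2 ^ l) - \<Phi> \<mu>)\<^sup>2 \<le> B / 4 ^ l"
proof -
  interpret iid_family P \<mu> "{1..2 ^ l}" X by (rule F)
  let ?e = "empirical_expectation \<Phi> \<mu>" and ?G = "\<integral>y. (g y)\<^sup>2 \<partial>\<mu>"
  define R where "R J \<omega> = linearisation_error \<Phi> \<mu> g J (\<lambda>i. X i \<omega>)" for J \<omega>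
  define \<phi> where "\<phi> J \<omega> = \<Phi> (empirical_measure J (\<lambda>i. X i \<omega>))" for J \<omega>
  have G: "0 \<le> ?G" by simp
  have sub: "R J \<in> borel_measurable P" "integrable P (\<lambda>\<omega>. (R J \<omega>)\<^sup>2)" "expectation (\<lambda>\<omega>. (R J \<omega>)\<^sup>2) \<le> B / (real (card J))\<^sup>2"
    "expectation (R J) = ?e (card J) - \<Phi> \<mu>"
    "\<phi> J \<in> borel_measurable P" "integrable P (\<lambda>\<omega>. (\<phi> J \<omega>)\<^sup>2)" "expectation (\<phi> J) = ?e (card J)"
    if J: "J \<subseteq> {1..2 ^ l}" "J \<noteq> {}" for J
  proof -
    note FJ = iid_family_subset[OF F J(1)]
    interpret J: iid_family P \<mu> J X by (rule FJ)
    note r = rate[unfolded linearisation_rate_def, rule_format, OF FJ J(2)]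
    note * = J.empirical_functional_square_integrable[OF J(2) m[OF J.fin J(2)] g conjunct1[OF r]]
    have "{..<card J} \<noteq> {}" using J.fin J(2) by (auto simp: lessThan_empty_iff)
    then have e: "expectation (\<phi> J) = ?e (card J)"
      unfolding \<phi>_def by (intro J.expectation_empirical J(2) m) auto
    show "R J \<in> borel_measurable P" "integrable P (\<lambda>\<omega>. (R J \<omega>)\<^sup>2)" "expectation (\<lambda>\<omega>. (R J \<omega>)\<^sup>2) \<le> B / (real (card J))\<^sup>2"
      "\<phi> J \<in> borel_measurable P" "integrable P (\<lambda>\<omega>. (\<phi> J \<omega>)\<^sup>2)"
      using * r unfolding R_def \<phi>_def by auto
    show "expectation (\<phi> J) = ?e (card J)" by (rule e)
    show "expectation (R J) = ?e (card J) - \<Phi> \<mu>"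
      using *(4) e unfolding R_def \<phi>_def by simp
  qed
  have pw: "((2::real) ^ k)\<^sup>2 = 4 ^ k" for k :: nat
    by (simp add: power_mult[symmetric] mult.commute[of k 2]) (simp add: power_mult)
  show "(?e (2 ^ l) - \<Phi> \<mu>)\<^sup>2 \<le> B / 4 ^ l"
  proof -
    have J: "{1..2 ^ l} \<subseteq> {1..2 ^ l}" "{1..2 ^ l :: nat} \<noteq> {}" by auto
    have "(expectation (R {1..2 ^ l}))\<^sup>2 \<le> expectation (\<lambda>\<omega>. (R {1..2 ^ l} \<omega>)\<^sup>2)"
      by (rule square_expectation_le[OF sub(1,2)[OF J]])
    also have "\<dots> \<le> B / (real (2 ^ l))\<^sup>2" using sub(3)[OF J] by simp
    finally show ?thesis using sub(4)[OF J] by (simp add: pw)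
  qed
  have "Y \<in> borel_measurable P \<and> integrable P (\<lambda>\<omega>. (Y \<omega>)\<^sup>2) \<and> expectation Y = level_mean \<Phi> \<mu> l
    \<and> expectation (\<lambda>\<omega>. (Y \<omega> - expectation Y)\<^sup>2) \<le> (9 * B + 2 * ?G) / 4 ^ l"
  proof (cases l)
    case 0
    then have J: "{1} \<subseteq> {1..2 ^ l :: nat}" "{1 :: nat} \<noteq> {}" and 1: "1 \<in> {1..2 ^ l :: nat}" by auto
    have Y: "Y = \<phi> {1}" by (simp add: 0 Y_def \<phi>_def antithetic_term_def fun_eq_iff)
    note s = sub[OF J]
    define c where "c = (\<integral>y. g y \<partial>\<mu>)"
    have g\<mu>: "g \<in> borel_measurable \<mu>" unfolding measurable_cong_sets[OF sets_law refl] by (rule g(1))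
    have gi: "integrable \<mu> g" by (rule law.square_integrable_imp_integrable[OF g\<mu> g(2)])
    have gc: "integrable \<mu> (\<lambda>y. (g y - c)\<^sup>2)" using g(2) gi by (simp add: power2_diff)
    note X1 = sample_measurable[OF 1]
    have gX: "integrable P (\<lambda>\<omega>. (g (X 1 \<omega>) - c)\<^sup>2)"
      using gc unfolding law[OF 1, symmetric] by (rule integrable_distr[OF X1])
    have "expectation (\<lambda>\<omega>. (g (X 1 \<omega>) - c)\<^sup>2) = (\<integral>y. (g y - c)\<^sup>2 \<partial>\<mu>)"
      using integral_distr[OF X1, of "\<lambda>y. (g y - c)\<^sup>2"] g(1) unfolding law[OF 1] by simp
    also have "\<dots> \<le> ?G"
      using law.variance_le_second_moment_about[OF g\<mu> g(2), of 0] by (simp add: c_def)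
    finally have gX2: "expectation (\<lambda>\<omega>. (g (X 1 \<omega>) - c)\<^sup>2) \<le> ?G" .
    have "expectation (\<lambda>\<omega>. (\<phi> {1} \<omega> - expectation (\<phi> {1}))\<^sup>2) \<le> expectation (\<lambda>\<omega>. (\<phi> {1} \<omega> - \<Phi> \<mu>)\<^sup>2)"
      by (rule variance_le_second_moment_about[OF s(5,6)])
    also have "\<dots> \<le> expectation (\<lambda>\<omega>. 2 * (R {1} \<omega>)\<^sup>2 + 2 * (g (X 1 \<omega>) - c)\<^sup>2)"
    proof (rule integral_mono)
      show "integrable P (\<lambda>\<omega>. (\<phi> {1} \<omega> - \<Phi> \<mu>)\<^sup>2)"
        using s(6) square_integrable_imp_integrable[OF s(5,6)] by (simp add: power2_diff)
      show "integrable P (\<lambda>\<omega>. 2 * (R {1} \<omega>)\<^sup>2 + 2 * (g (X 1 \<omega>) - c)\<^sup>2)" using s(2) gX by simp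
      fix \<omega>
      have "\<phi> {1} \<omega> - \<Phi> \<mu> = R {1} \<omega> + (g (X 1 \<omega>) - c)"
        by (simp add: R_def \<phi>_def linearisation_error_def c_def)
      then show "(\<phi> {1} \<omega> - \<Phi> \<mu>)\<^sup>2 \<le> 2 * (R {1} \<omega>)\<^sup>2 + 2 * (g (X 1 \<omega>) - c)\<^sup>2"
        using power2_add_le by simp
    qed
    also have "\<dots> = 2 * expectation (\<lambda>\<omega>. (R {1} \<omega>)\<^sup>2) + 2 * expectation (\<lambda>\<omega>. (g (X 1 \<omega>) - c)\<^sup>2)"
      using s(2) gX by simp
    also have "\<dots> \<le> 9 * B + 2 * ?G"
      using s(3) gX2 B by simp
    finally show ?thesis using s(5-7) by (simp add: Y 0 level_mean_def)
  next
    case (Suc k)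
    let ?A = "{1..2 ^ l :: nat}" and ?J = "{1..2 ^ k :: nat}" and ?K = "{2 ^ k + 1..2 ^ l :: nat}"
    have c: "card ?A = 2 ^ l" "card ?J = 2 ^ k" "card ?K = 2 ^ k"
      by (simp_all add: Suc)
    have J: "?A \<subseteq> ?A" "?A \<noteq> {}" "?J \<subseteq> ?A" "?J \<noteq> {}" "?K \<subseteq> ?A" "?K \<noteq> {}"
      by (auto simp: Suc)
    note a = sub[OF J(1,2), unfolded c] and j = sub[OF J(3,4), unfolded c] and k = sub[OF J(5,6), unfolded c]
    have Y\<phi>: "Y \<omega> = \<phi> ?A \<omega> - 1 / 2 * (\<phi> ?J \<omega> + \<phi> ?K \<omega>)" for \<omega>
      by (simp add: Y_def \<phi>_def antithetic_term_def Suc)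
    have YR: "Y \<omega> = R ?A \<omega> - 1 / 2 * (R ?J \<omega> + R ?K \<omega>)" for \<omega>
      using linearisation_error_antithetic[of \<Phi> k "\<lambda>i. X i \<omega>" \<mu> g] by (simp add: Y_def R_def Suc)
    have Ym: "Y \<in> borel_measurable P" unfolding Y\<phi>[abs_def] using a(5) j(5) k(5) by simp
    have EY: "expectation Y = level_mean \<Phi> \<mu> l"
      unfolding Y\<phi> using square_integrable_imp_integrable[OF a(5,6)] square_integrable_imp_integrable[OF j(5,6)]
        square_integrable_imp_integrable[OF k(5,6)] a(7) j(7) k(7)
      by (simp add: level_mean_def Suc)
    define Z where "Z \<omega> = 3 * (R ?A \<omega>)\<^sup>2 + 3 / 4 * (R ?J \<omega>)\<^sup>2 + 3 / 4 * (R ?K \<omega>)\<^sup>2" for \<omega>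
    have iZ: "integrable P Z" unfolding Z_def using a(2) j(2) k(2) by simp
    have YZ: "(Y \<omega>)\<^sup>2 \<le> Z \<omega>" for \<omega>
    proof -
      have "(u - 1 / 2 * (v + w))\<^sup>2 \<le> 3 * u\<^sup>2 + 3 / 4 * v\<^sup>2 + 3 / 4 * w\<^sup>2" for u v w :: real
      proof -
        have "0 \<le> (u + v / 2)\<^sup>2 + (u + w / 2)\<^sup>2 + (v / 2 - w / 2)\<^sup>2" by simp
        then show ?thesis by (simp add: power2_eq_square field_simps)
      qed
      then show ?thesis unfolding YR Z_def .
    qed
    have Y2: "integrable P (\<lambda>\<omega>. (Y \<omega>)\<^sup>2)"
      by (rule square_integrable_bound[OF Ym iZ YZ])
    have "expectation (\<lambda>\<omega>. (Y \<omega> - expectation Y)\<^sup>2) \<le> expectation (\<lambda>\<omega>. (Y \<omega>)\<^sup>2)"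
      using variance_le_second_moment_about[OF Ym Y2, of 0] by simp
    also have "\<dots> \<le> expectation Z" by (rule integral_mono[OF Y2 iZ YZ])
    also have "\<dots> = 3 * expectation (\<lambda>\<omega>. (R ?A \<omega>)\<^sup>2) + 3 / 4 * expectation (\<lambda>\<omega>. (R ?J \<omega>)\<^sup>2)
        + 3 / 4 * expectation (\<lambda>\<omega>. (R ?K \<omega>)\<^sup>2)"
      unfolding Z_def using a(2) j(2) k(2) by simp
    also have "\<dots> \<le> 3 * (B / 4 ^ l) + 3 / 4 * (B / 4 ^ k) + 3 / 4 * (B / 4 ^ k)"
      using a(3) j(3) k(3) by (intro add_mono mult_left_mono) (auto simp: pw)
    also have "\<dots> = 9 * B / 4 ^ l" by (simp add: Suc field_simps)
    also have "\<dots> \<le> (9 * B + 2 * ?G) / 4 ^ l"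
      by (intro divide_right_mono) simp_all
    finally show ?thesis using Ym Y2 EY by simp
  qed
  then show "Y \<in> borel_measurable P" "integrable P (\<lambda>\<omega>. (Y \<omega>)\<^sup>2)" "(\<integral>\<omega>. Y \<omega> \<partial>P) = level_mean \<Phi> \<mu> l"
    "(\<integral>\<omega>. (Y \<omega> - level_mean \<Phi> \<mu> l)\<^sup>2 \<partial>P) \<le> (9 * B + 2 * ?G) / 4 ^ l"
    by auto
qed

section \<open>Error and cost of the estimator\<close>

lemma iid_samples_block:
  assumes P: "prob_space P" and X: "iid_samples P \<mu> (amlmc_indices L M) X" and \<mu>: "\<mu> \<in> finite_moment_measures 8"
    and l: "l \<le> L" and \<theta>: "\<theta> \<in> {1..M l}"
  shows "iid_family P \<mu> {1..2 ^ l} (\<lambda>i. X i l \<theta>)"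
proof -
  interpret prob_space P by (rule P)
  have h: "inj_on (\<lambda>i. (i, l, \<theta>)) {1..2 ^ l}" "(\<lambda>i. (i, l, \<theta>)) ` {1..2 ^ l} \<subseteq> amlmc_indices L M"
    using l \<theta> by (auto simp: inj_on_def amlmc_indices_def)
  have ind: "indep_vars (\<lambda>_. borel) (\<lambda>(i, l, \<theta>). X i l \<theta>) (amlmc_indices L M)"
    and law: "\<forall>(i, l, \<theta>)\<in>amlmc_indices L M. distr P borel (X i l \<theta>) = \<mu>"
    using X by (auto simp: iid_samples_def)
  show ?thesis
  proof unfold_locales
    show "distr P borel (X i l \<theta>) = \<mu>" if "i \<in> {1..2 ^ l}" for i
      using bspec[OF law, of "(i, l, \<theta>)"] h(2) that by blast
    show "indep_vars (\<lambda>_. borel) (\<lambda>i. X i l \<theta>) {1..2 ^ l}"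
      using indep_vars_inj_reindex[OF ind h] by simp
  qed (simp_all add: \<mu>)
qed

text \<open>Functions of the samples with different labels \<open>b\<close> and \<open>b'\<close>; below, a label is a pair of a level and
a replication number.\<close>

lemma (in prob_space) indep_var_blocks:
  fixes X :: "nat \<times> 'i \<Rightarrow> 'a \<Rightarrow> 'b::{second_countable_topology, zero}"
  assumes X: "indep_vars (\<lambda>_. borel) X I" and b: "b \<noteq> b'"
    and A: "A \<times> {b} \<subseteq> I" "A' \<times> {b'} \<subseteq> I"
    and f: "f \<in> borel_measurable (borel :: (nat \<Rightarrow> 'b) measure)" "\<And>x. f (coordinates_in A x) = f x"
    and f': "f' \<in> borel_measurable (borel :: (nat \<Rightarrow> 'b) measure)" "\<And>x. f' (coordinates_in A' x) = f' x"
  shows "indep_var borel (\<lambda>\<omega>. f (\<lambda>i. X (i, b) \<omega>) :: real) borel (\<lambda>\<omega>. f' (\<lambda>i. X (i, b') \<omega>) :: real)"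
proof -
  define \<pi> where "\<pi> C c z = (\<lambda>i. if i \<in> C then z (i, c) else 0)" for C and c :: 'i and z :: "nat \<times> 'i \<Rightarrow> 'b"
  have \<pi>m: "\<pi> C c \<in> measurable (PiM (C \<times> {c}) (\<lambda>_. borel)) borel" for C c
  proof (rule measurable_coordinatewise_then_product)
    fix i show "(\<lambda>z. \<pi> C c z i) \<in> measurable (PiM (C \<times> {c}) (\<lambda>_. borel)) borel"
      by (cases "i \<in> C") (simp_all add: \<pi>_def)
  qed
  have \<pi>X: "\<pi> C c (restrict (\<lambda>i. X i \<omega>) (C \<times> {c})) = coordinates_in C (\<lambda>i. X (i, c) \<omega>)" for C c \<omega>
    by (auto simp: \<pi>_def coordinates_in_def)
  have "indep_var (PiM (A \<times> {b}) (\<lambda>_. borel)) (\<lambda>\<omega>. restrict (\<lambda>i. X i \<omega>) (A \<times> {b}))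
      (PiM (A' \<times> {b'}) (\<lambda>_. borel)) (\<lambda>\<omega>. restrict (\<lambda>i. X i \<omega>) (A' \<times> {b'}))"
    using b A by (intro indep_var_restrict[OF X]) auto
  from indep_var_compose[OF this measurable_comp[OF \<pi>m f(1)] measurable_comp[OF \<pi>m f'(1)]]
  show ?thesis by (simp add: comp_def \<pi>X f(2) f'(2))
qed

lemma (in prob_space) expectation_square_orthogonal_sum:
  fixes Z :: "'k \<Rightarrow> 'a \<Rightarrow> real"
  assumes fin: "finite K" and m: "\<And>k. k \<in> K \<Longrightarrow> Z k \<in> borel_measurable M"
    and sq: "\<And>k. k \<in> K \<Longrightarrow> integrable M (\<lambda>x. (Z k x)\<^sup>2)"
    and orth: "\<And>k k'. k \<in> K \<Longrightarrow> k' \<in> K \<Longrightarrow> k \<noteq> k' \<Longrightarrow> expectation (\<lambda>x. Z k x * Z k' x) = 0"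
  shows "integrable M (\<lambda>x. (\<Sum>k\<in>K. a k * Z k x)\<^sup>2)"
    and "expectation (\<lambda>x. (\<Sum>k\<in>K. a k * Z k x)\<^sup>2) = (\<Sum>k\<in>K. (a k)\<^sup>2 * expectation (\<lambda>x. (Z k x)\<^sup>2))"
proof -
  have i: "integrable M (\<lambda>x. Z k x * Z k' x)" if "k \<in> K" "k' \<in> K" for k k'
    using that m sq by (intro square_integrable_mult) auto
  have eq: "(\<Sum>k\<in>K. a k * Z k x)\<^sup>2 = (\<Sum>k\<in>K. \<Sum>k'\<in>K. a k * a k' * (Z k x * Z k' x))" for x
    unfolding power2_eq_square sum_product by (intro sum.cong refl) (simp add: mult_ac)
  show "integrable M (\<lambda>x. (\<Sum>k\<in>K. a k * Z k x)\<^sup>2)"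
    unfolding eq using i by simp
  have "expectation (\<lambda>x. (\<Sum>k\<in>K. a k * Z k x)\<^sup>2) = (\<Sum>k\<in>K. \<Sum>k'\<in>K. a k * a k' * expectation (\<lambda>x. Z k x * Z k' x))"
    unfolding eq using i by simp
  also have "\<dots> = (\<Sum>k\<in>K. \<Sum>k'\<in>K. if k' = k then (a k)\<^sup>2 * expectation (\<lambda>x. (Z k x)\<^sup>2) else 0)"
    using orth by (intro sum.cong refl) (auto simp: power2_eq_square)
  also have "\<dots> = (\<Sum>k\<in>K. (a k)\<^sup>2 * expectation (\<lambda>x. (Z k x)\<^sup>2))"
    using fin by simp
  finally show "expectation (\<lambda>x. (\<Sum>k\<in>K. a k * Z k x)\<^sup>2) = (\<Sum>k\<in>K. (a k)\<^sup>2 * expectation (\<lambda>x. (Z k x)\<^sup>2))" .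
qed

text \<open>The estimator minus \<open>\<Phi> \<mu>\<close> is an orthogonal sum of centred terms plus the bias at the finest level.\<close>

lemma amlmc_mean_square_error:
  fixes P :: "'w measure" and \<mu> :: "'a::euclidean_space measure"
  assumes P: "prob_space P" and X: "iid_samples P \<mu> (amlmc_indices L M) X" and \<mu>: "\<mu> \<in> finite_moment_measures 8"
    and M: "\<And>l. l \<le> L \<Longrightarrow> 0 < M l" and B: "0 \<le> B"
    and m: "\<And>I. finite I \<Longrightarrow> I \<noteq> {} \<Longrightarrow> (\<lambda>x. \<Phi> (empirical_measure I x)) \<in> borel_measurable borel"
    and g: "g \<in> borel_measurable borel" "integrable \<mu> (\<lambda>y. (g y)\<^sup>2)"
    and rate: "linearisation_rate P \<mu> \<Phi> g B"
  defines "V \<equiv> 9 * B + 2 * (\<integral>y. (g y)\<^sup>2 \<partial>\<mu>)"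
    and "E \<equiv> \<lambda>\<omega>. (\<Phi> \<mu> - amlmc_estimator \<Phi> L M (\<lambda>i l \<theta>. X i l \<theta> \<omega>))\<^sup>2"
  shows "integrable P E"
    and "(\<integral>\<omega>. E \<omega> \<partial>P) \<le> 2 * (\<Sum>l\<le>L. V / (4 ^ l * M l)) + 2 * (B / 4 ^ L)"
proof -
  interpret prob_space P by (rule P)
  define K where "K = Sigma {..L} (\<lambda>l. {1..M l})"
  define Y where "Y k \<omega> = antithetic_term \<Phi> (fst k) (\<lambda>i. X i (fst k) (snd k) \<omega>)" for k \<omega>
  define Z where "Z k \<omega> = Y k \<omega> - level_mean \<Phi> \<mu> (fst k)" for k \<omega>
  define a where "a k = 1 / real (M (fst k))" for k :: "nat \<times> nat"
  define \<beta> where "\<beta> = empirical_expectation \<Phi> \<mu> (2 ^ L) - \<Phi> \<mu>"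
  have fam: "iid_family P \<mu> {1..2 ^ fst k} (\<lambda>i. X i (fst k) (snd k))" if "k \<in> K" for k
    using that by (intro iid_samples_block[OF P X \<mu>]) (auto simp: K_def)
  note mom = antithetic_term_moments[OF fam B m g rate, folded Y_def[abs_def] V_def]
  have Y: "Y k \<in> borel_measurable P" "integrable P (\<lambda>\<omega>. (Y k \<omega>)\<^sup>2)" "expectation (Y k) = level_mean \<Phi> \<mu> (fst k)"
    "expectation (\<lambda>\<omega>. (Z k \<omega>)\<^sup>2) \<le> V / 4 ^ fst k" if "k \<in> K" for k
    using mom[OF that] unfolding Z_def Y_def[abs_def] by auto
  have finK: "finite K" by (simp add: K_def)
  have Yi: "integrable P (Y k)" if "k \<in> K" for k
    by (rule square_integrable_imp_integrable[OF Y(1,2)[OF that]])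
  have Z: "Z k \<in> borel_measurable P" "integrable P (\<lambda>\<omega>. (Z k \<omega>)\<^sup>2)" "integrable P (Z k)" "expectation (Z k) = 0"
    if "k \<in> K" for k
    using Y(1-3)[OF that] Yi[OF that] prob_space unfolding Z_def by (simp_all add: power2_diff)
  have ind: "indep_vars (\<lambda>_. borel) (\<lambda>(i, l, \<theta>). X i l \<theta>) (amlmc_indices L M)"
    using X by (simp add: iid_samples_def)
  have orth: "expectation (\<lambda>\<omega>. Z k \<omega> * Z k' \<omega>) = 0" if k: "k \<in> K" "k' \<in> K" "k \<noteq> k'" for k k'
  proof -
    let ?f = "\<lambda>k x. antithetic_term \<Phi> (fst k) x - level_mean \<Phi> \<mu> (fst k)"
    have fm: "?f k \<in> borel_measurable borel" for k :: "nat \<times> nat"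
      using antithetic_term_measurable[OF m, of "fst k"] by simp
    have "indep_var borel (\<lambda>\<omega>. ?f k (\<lambda>i. (\<lambda>(i, l, \<theta>). X i l \<theta>) (i, k) \<omega>))
        borel (\<lambda>\<omega>. ?f k' (\<lambda>i. (\<lambda>(i, l, \<theta>). X i l \<theta>) (i, k') \<omega>))"
      using k by (intro indep_var_blocks[OF ind k(3), of "{1..2 ^ fst k}" "{1..2 ^ fst k'}"] fm)
        (auto simp: K_def amlmc_indices_def antithetic_term_coordinates_in[unfolded One_nat_def])
    then have "indep_var borel (Z k) borel (Z k')"
      unfolding Z_def[abs_def] Y_def by (simp add: case_prod_beta')
    then show ?thesis
      using indep_var_lebesgue_integral[of "Z k" "Z k'"] Z(3,4) k by simp
  qed
  note sum = expectation_square_orthogonal_sum[where a = a, OF finK Z(1,2) orth]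
  have err: "amlmc_estimator \<Phi> L M (\<lambda>i l \<theta>. X i l \<theta> \<omega>) - \<Phi> \<mu> = (\<Sum>k\<in>K. a k * Z k \<omega>) + \<beta>" for \<omega>
  proof -
    have "(\<Sum>k\<in>K. a k * Z k \<omega>) = (\<Sum>l\<le>L. \<Sum>\<theta>=1..M l. 1 / M l * (Y (l, \<theta>) \<omega> - level_mean \<Phi> \<mu> l))"
      unfolding K_def by (subst sum.Sigma) (auto simp: a_def Z_def case_prod_beta')
    also have "\<dots> = (\<Sum>l\<le>L. 1 / M l * (\<Sum>\<theta>=1..M l. Y (l, \<theta>) \<omega>) - level_mean \<Phi> \<mu> l)"
      using M by (intro sum.cong refl) (simp add: sum_subtractf sum_divide_distrib[symmetric] diff_divide_distrib)
    also have "\<dots> = amlmc_estimator \<Phi> L M (\<lambda>i l \<theta>. X i l \<theta> \<omega>) - empirical_expectation \<Phi> \<mu> (2 ^ L)"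
      unfolding sum_subtractf sum_level_mean amlmc_estimator_eq Y_def by simp
    finally show ?thesis by (simp add: \<beta>_def)
  qed
  have E: "E \<omega> = ((\<Sum>k\<in>K. a k * Z k \<omega>) + \<beta>)\<^sup>2" for \<omega>
    unfolding E_def power2_commute[of "\<Phi> \<mu>"] err ..
  define W where "W \<omega> = 2 * (\<Sum>k\<in>K. a k * Z k \<omega>)\<^sup>2 + 2 * \<beta>\<^sup>2" for \<omega>
  have iW: "integrable P W" unfolding W_def using sum(1) by simp
  have EW: "E \<omega> \<le> W \<omega>" for \<omega> unfolding E W_def by (rule power2_add_le)
  show iE: "integrable P E"
    unfolding E[abs_def]
    by (rule square_integrable_bound[OF _ iW]) (use Z(1) EW in \<open>simp_all add: E\<close>)
  have "(L, 1) \<in> K" using M[of L] by (simp add: K_def Suc_le_eq)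
  from mom(5)[OF this] have \<beta>: "\<beta>\<^sup>2 \<le> B / 4 ^ L" by (simp add: \<beta>_def)
  have "(\<integral>\<omega>. E \<omega> \<partial>P) \<le> expectation W" by (rule integral_mono[OF iE iW EW])
  also have "\<dots> = 2 * (\<Sum>k\<in>K. (a k)\<^sup>2 * expectation (\<lambda>\<omega>. (Z k \<omega>)\<^sup>2)) + 2 * \<beta>\<^sup>2"
    unfolding W_def using sum prob_space by simp
  also have "\<dots> \<le> 2 * (\<Sum>k\<in>K. (a k)\<^sup>2 * (V / 4 ^ fst k)) + 2 * (B / 4 ^ L)"
    using Y(4) \<beta> by (intro add_mono mult_left_mono sum_mono) auto
  also have "(\<Sum>k\<in>K. (a k)\<^sup>2 * (V / 4 ^ fst k)) = (\<Sum>l\<le>L. \<Sum>\<theta>=1..M l. (1 / M l)\<^sup>2 * (V / 4 ^ l))"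
    unfolding K_def by (subst sum.Sigma) (auto simp: a_def case_prod_beta')
  also have "\<dots> = (\<Sum>l\<le>L. V / (4 ^ l * M l))"
    using M by (intro sum.cong refl) (simp add: power2_eq_square)
  finally show "(\<integral>\<omega>. E \<omega> \<partial>P) \<le> 2 * (\<Sum>l\<le>L. V / (4 ^ l * M l)) + 2 * (B / 4 ^ L)" .
qed

text \<open>Take \<open>L\<close> least with \<open>2 ^ L \<ge> 1/\<epsilon>\<close> and \<open>M l\<close> the ceiling of \<open>\<epsilon>\<^sup>-\<^sup>2 3\<^sup>-\<^sup>l\<close>. Rounding up adds at most
\<open>2 ^ l\<close> to the cost of level \<open>l\<close>, in total \<open>O(1/\<epsilon>)\<close>.\<close>

lemma amlmc_parameters:
  fixes \<epsilon> :: real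
  assumes \<epsilon>: "0 < \<epsilon>" "\<epsilon> < 1"
  obtains L M where "\<And>l. 0 < M l" "antimono M" "1 / 4 ^ L \<le> \<epsilon>\<^sup>2"
    "(\<Sum>l\<le>L. 1 / (4 ^ l * real (M l))) \<le> 4 * \<epsilon>\<^sup>2" "real (amlmc_cost L M) \<le> 7 / \<epsilon>\<^sup>2"
proof -
  have ex: "\<exists>L. 1 / \<epsilon> \<le> 2 ^ L" using real_arch_pow[of 2 "1 / \<epsilon>"] by (auto intro: less_imp_le)
  define L where "L = (LEAST L. 1 / \<epsilon> \<le> (2::real) ^ L)"
  have L1: "1 / \<epsilon> \<le> 2 ^ L" unfolding L_def by (rule LeastI_ex[OF ex])
  have "L \<noteq> 0"
  proof
    assume "L = 0"
    then show False using L1 \<epsilon> by (simp add: field_simps)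
  qed
  then obtain k where k: "L = Suc k" by (cases L) auto
  have "\<not> 1 / \<epsilon> \<le> 2 ^ k" using not_less_Least[of k "\<lambda>L. 1 / \<epsilon> \<le> (2::real) ^ L"] k by (simp add: L_def)
  then have L2: "2 ^ L \<le> 2 / \<epsilon>" by (simp add: k)
  define M where "M l = nat \<lceil>1 / \<epsilon>\<^sup>2 / 3 ^ l\<rceil>" for l
  have pos: "0 < 1 / \<epsilon>\<^sup>2 / 3 ^ l" for l using \<epsilon> by simp
  have Ml: "1 / \<epsilon>\<^sup>2 / 3 ^ l \<le> M l" "M l \<le> 1 / \<epsilon>\<^sup>2 / 3 ^ l + 1" for l
    unfolding M_def using pos[of l] by linarith+
  have M0: "0 < M l" for l unfolding M_def using pos[of l] by simp
  have geo: "(\<Sum>l\<le>n. q ^ l) \<le> 1 / (1 - q)" if "0 \<le> q" "q < 1" for q :: real and n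
    using sum_gp[of q 0 n] that by (simp add: atLeast0AtMost sum_gp0 divide_right_mono)
  show ?thesis
  proof (rule that[of M L])
    show "0 < M l" for l by (rule M0)
    show "antimono M"
    proof (rule antimonoI)
      fix l l' :: nat assume "l \<le> l'"
      then show "M l' \<le> M l"
        unfolding M_def using \<epsilon> by (intro nat_mono ceiling_mono divide_left_mono power_increasing) auto
    qed
    have "(1 / \<epsilon>)\<^sup>2 \<le> (2 ^ L)\<^sup>2" using L1 \<epsilon> by (intro power_mono) auto
    also have "((2::real) ^ L)\<^sup>2 = 4 ^ L" by (simp add: power_mult[symmetric] mult.commute[of L 2]) (simp add: power_mult)
    finally show "1 / 4 ^ L \<le> \<epsilon>\<^sup>2" using \<epsilon> by (simp add: field_simps power_divide)
    have "(\<Sum>l\<le>L. 1 / (4 ^ l * real (M l))) \<le> (\<Sum>l\<le>L. \<epsilon>\<^sup>2 * (3 / 4) ^ l)"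
    proof (intro sum_mono)
      fix l
      have "1 / (4 ^ l * real (M l)) \<le> 1 / (4 ^ l * (1 / \<epsilon>\<^sup>2 / 3 ^ l))"
        using Ml(1)[of l] pos[of l] M0[of l] by (intro divide_left_mono mult_left_mono mult_pos_pos) auto
      also have "\<dots> = \<epsilon>\<^sup>2 * (3 / 4) ^ l" using \<epsilon> by (simp add: power_divide)
      finally show "1 / (4 ^ l * real (M l)) \<le> \<epsilon>\<^sup>2 * (3 / 4) ^ l" .
    qed
    also have "\<dots> \<le> \<epsilon>\<^sup>2 * 4"
      unfolding sum_distrib_left[symmetric] using geo[of "3 / 4" L] by (intro mult_left_mono) auto
    finally show "(\<Sum>l\<le>L. 1 / (4 ^ l * real (M l))) \<le> 4 * \<epsilon>\<^sup>2" by simp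
    have "real (amlmc_cost L M) = (\<Sum>l\<le>L. real (M l) * 2 ^ l)"
      by (simp add: amlmc_cost_def atLeast0AtMost)
    also have "\<dots> \<le> (\<Sum>l\<le>L. 1 / \<epsilon>\<^sup>2 * (2 / 3) ^ l + 2 ^ l)"
    proof (intro sum_mono)
      fix l
      have "real (M l) * 2 ^ l \<le> (1 / \<epsilon>\<^sup>2 / 3 ^ l + 1) * 2 ^ l" using Ml(2)[of l] by (intro mult_right_mono) auto
      also have "\<dots> = 1 / \<epsilon>\<^sup>2 * (2 / 3) ^ l + 2 ^ l" by (simp add: power_divide distrib_right)
      finally show "real (M l) * 2 ^ l \<le> 1 / \<epsilon>\<^sup>2 * (2 / 3) ^ l + 2 ^ l" .
    qed
    also have "\<dots> = 1 / \<epsilon>\<^sup>2 * (\<Sum>l\<le>L. (2 / 3) ^ l) + (\<Sum>l\<le>L. 2 ^ l)"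
      by (simp add: sum.distrib sum_distrib_left)
    also have "\<dots> \<le> 1 / \<epsilon>\<^sup>2 * 3 + 2 * 2 ^ L"
    proof (intro add_mono mult_left_mono)
      show "(\<Sum>l\<le>L. (2 / 3) ^ l) \<le> (3::real)" using geo[of "2 / 3" L] by simp
      have "(\<Sum>l\<le>n. 2 ^ l) \<le> 2 * (2::real) ^ n" for n by (induction n) auto
      then show "(\<Sum>l\<le>L. 2 ^ l) \<le> 2 * (2::real) ^ L" .
    qed simp
    also have "\<dots> \<le> 3 / \<epsilon>\<^sup>2 + 4 / \<epsilon>" using L2 by simp
    also have "4 / \<epsilon> \<le> 4 / \<epsilon>\<^sup>2"
      using \<epsilon> by (intro divide_left_mono) (auto simp: power2_eq_square mult_left_le)
    finally show "real (amlmc_cost L M) \<le> 7 / \<epsilon>\<^sup>2" by simp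
  qed
qed

theorem theorem2p3:
  fixes \<mu> :: "(real ^ 'd) measure" and \<Phi> :: "(real ^ 'd) measure \<Rightarrow> real"
  assumes "\<mu> \<in> finite_moment_measures 8" and "\<Phi> \<in> class_ML 4"
  shows "\<exists>C1>0. \<exists>C2>0. \<exists>\<epsilon>0>0. \<forall>\<epsilon>::real. 0 < \<epsilon> \<and> \<epsilon> < \<epsilon>0 \<longrightarrow>
    (\<exists>(L::nat) (M::nat \<Rightarrow> nat).
       (\<forall>l\<le>L. 0 < M l) \<and> antimono_on {0..L} M \<and>
       (\<forall>(P::'w measure) X. prob_space P \<and> iid_samples P \<mu> (amlmc_indices L M) X \<longrightarrow>
          integrable P (\<lambda>\<omega>. (\<Phi> \<mu> - amlmc_estimator \<Phi> L M (\<lambda>i l \<theta>. X i l \<theta> \<omega>))\<^sup>2) \<and>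
          prob_space.expectation P
            (\<lambda>\<omega>. (\<Phi> \<mu> - amlmc_estimator \<Phi> L M (\<lambda>i l \<theta>. X i l \<theta> \<omega>))\<^sup>2) \<le> C1 * \<epsilon>\<^sup>2) \<and>
       real (amlmc_cost L M) \<le> C2 / \<epsilon>\<^sup>2)"
proof -
  obtain B g where B: "0 \<le> B" and g: "g \<in> borel_measurable borel" "integrable \<mu> (\<lambda>y. (g y)\<^sup>2)"
    and m: "\<And>I. finite I \<Longrightarrow> I \<noteq> {} \<Longrightarrow> (\<lambda>x. \<Phi> (empirical_measure I x)) \<in> borel_measurable borel"
    and rate: "\<And>P::'w measure. linearisation_rate P \<mu> \<Phi> g B"
    using class_ML_linearisation[OF assms] by metis
  define V where "V = 9 * B + 2 * (\<integral>y. (g y)\<^sup>2 \<partial>\<mu>)"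
  have V: "0 \<le> V" using B by (simp add: V_def)
  let ?Q = "\<lambda>(\<epsilon>::real) L M. (\<forall>l\<le>L. 0 < M l) \<and> antimono_on {0..L} M \<and>
       (\<forall>(P::'w measure) X. prob_space P \<and> iid_samples P \<mu> (amlmc_indices L M) X \<longrightarrow>
          integrable P (\<lambda>\<omega>. (\<Phi> \<mu> - amlmc_estimator \<Phi> L M (\<lambda>i l \<theta>. X i l \<theta> \<omega>))\<^sup>2) \<and>
          prob_space.expectation P
            (\<lambda>\<omega>. (\<Phi> \<mu> - amlmc_estimator \<Phi> L M (\<lambda>i l \<theta>. X i l \<theta> \<omega>))\<^sup>2) \<le> (1 + 8 * V + 2 * B) * \<epsilon>\<^sup>2) \<and>
       real (amlmc_cost L M) \<le> 7 / \<epsilon>\<^sup>2"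
  have main: "\<forall>\<epsilon>. 0 < \<epsilon> \<and> \<epsilon> < 1 \<longrightarrow> (\<exists>L M. ?Q \<epsilon> L M)"
  proof (intro allI impI)
    fix \<epsilon> :: real assume "0 < \<epsilon> \<and> \<epsilon> < 1"
    then have \<epsilon>: "0 < \<epsilon>" "\<epsilon> < 1" by auto
    obtain L M where LM: "\<And>l. 0 < M l" "antimono M" "1 / 4 ^ L \<le> \<epsilon>\<^sup>2"
      "(\<Sum>l\<le>L. 1 / (4 ^ l * real (M l))) \<le> 4 * \<epsilon>\<^sup>2" "real (amlmc_cost L M) \<le> 7 / \<epsilon>\<^sup>2"
      by (rule amlmc_parameters[OF \<epsilon>]) (rule that)
    have mse: "integrable P (\<lambda>\<omega>. (\<Phi> \<mu> - amlmc_estimator \<Phi> L M (\<lambda>i l \<theta>. X i l \<theta> \<omega>))\<^sup>2) \<and>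
        (\<integral>\<omega>. (\<Phi> \<mu> - amlmc_estimator \<Phi> L M (\<lambda>i l \<theta>. X i l \<theta> \<omega>))\<^sup>2 \<partial>P) \<le> (1 + 8 * V + 2 * B) * \<epsilon>\<^sup>2"
      if P: "prob_space P" "iid_samples P \<mu> (amlmc_indices L M) X" for P :: "'w measure" and X
    proof
      note * = amlmc_mean_square_error[OF P assms(1) LM(1) B m g rate, folded V_def]
      show "integrable P (\<lambda>\<omega>. (\<Phi> \<mu> - amlmc_estimator \<Phi> L M (\<lambda>i l \<theta>. X i l \<theta> \<omega>))\<^sup>2)" by (rule *(1))
      have "(\<integral>\<omega>. (\<Phi> \<mu> - amlmc_estimator \<Phi> L M (\<lambda>i l \<theta>. X i l \<theta> \<omega>))\<^sup>2 \<partial>P)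
          \<le> 2 * (\<Sum>l\<le>L. V / (4 ^ l * M l)) + 2 * (B / 4 ^ L)" by (rule *(2))
      also have "(\<Sum>l\<le>L. V / (4 ^ l * M l)) = V * (\<Sum>l\<le>L. 1 / (4 ^ l * real (M l)))"
        by (simp add: sum_distrib_left)
      also have "2 * (V * (\<Sum>l\<le>L. 1 / (4 ^ l * real (M l)))) + 2 * (B / 4 ^ L) \<le> 2 * (V * (4 * \<epsilon>\<^sup>2)) + 2 * (B * \<epsilon>\<^sup>2)"
        using mult_left_mono[OF LM(4) V] mult_left_mono[OF LM(3) B] by simp
      also have "\<dots> \<le> (1 + 8 * V + 2 * B) * \<epsilon>\<^sup>2" by (simp add: algebra_simps)
      finally show "(\<integral>\<omega>. (\<Phi> \<mu> - amlmc_estimator \<Phi> L M (\<lambda>i l \<theta>. X i l \<theta> \<omega>))\<^sup>2 \<partial>P) \<le> (1 + 8 * V + 2 * B) * \<epsilon>\<^sup>2" .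
    qed
    have mono: "antimono_on {0..L} M" using LM(2) by (rule monotone_on_subset) simp
    show "\<exists>L M. ?Q \<epsilon> L M"
    proof (rule exI[of _ L], rule exI[of _ M], intro conjI allI impI)
      fix P :: "'w measure" and X assume "prob_space P \<and> iid_samples P \<mu> (amlmc_indices L M) X"
      then have "prob_space P" "iid_samples P \<mu> (amlmc_indices L M) X" by auto
      note * = mse[OF this]
      show "integrable P (\<lambda>\<omega>. (\<Phi> \<mu> - amlmc_estimator \<Phi> L M (\<lambda>i l \<theta>. X i l \<theta> \<omega>))\<^sup>2)"
        using * by (rule conjunct1)
      show "prob_space.expectation P (\<lambda>\<omega>. (\<Phi> \<mu> - amlmc_estimator \<Phi> L M (\<lambda>i l \<theta>. X i l \<theta> \<omega>))\<^sup>2)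
          \<le> (1 + 8 * V + 2 * B) * \<epsilon>\<^sup>2"
        using * by (rule conjunct2)
    qed (rule LM mono)+
  qed
  have pos: "0 < 1 + 8 * V + 2 * B" "(0::real) < 7" "(0::real) < 1" using V B by auto
  show ?thesis
    by (rule exI[of _ "1 + 8 * V + 2 * B"], rule conjI, rule pos, rule exI[of _ 7], rule conjI, rule pos,
        rule exI[of _ 1], rule conjI, rule pos, rule main)
qed

end
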